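(* Let $G^{C_4}$ be a $4$-chromatic semi-maximal planar graph with outer cycle $C_4=v_1v_2v_3v_4v_1$ such that $F_2(G^{C_4})\neq\emptyset$. Then $G^{C_4}$ is a $4$-base-module if and only if there exists $f_0\in F_2(G^{C_4})$ such that either every colouring in $F^{f_0}(G^{C_4})$ is a shared-endpoint-colouring on $\{v_2,v_4\}$, or every colouring in $F^{f_0}(G^{C_4})$ is a shared-endpoint-colouring on $\{v_1,v_3\}$.
   Context: A semi-maximal planar graph (SMPG) $G^C$ with respect to a cycle $C$ is a plane graph whose outer face is bounded by the cycle $C$ (length $\ge4$) and all other faces are triangles. Colours are $\{1,2,3,4\}$; $C_4^0(\cdot)$ denotes proper $4$-colourings up to permutation of colour names; $f(H)=\{f(v):v\in V(H)\}$. A bichromatic cycle of $f$ is a cycle $C$ with $|f(C)|=2$. If $f(C)=\{i,j\}$ and $\{s,t\}$ are the other two colours, $\sigma(f,C)$ interchanges $s$ and $t$ on all vertices in the interior of $C$. Colourings are Kempe-equivalent if related by a finite sequence of $\sigma$-operations; $F^f(\cdot)$ is the Kempe-equivalence class of $f$. $F_2(G^{C_4})$ is the set of colourings $f$ with $|f(C_4)|=2$; for such $f$ colours are named so that $f(v_1)=f(v_3)=1$, $f(v_2)=f(v_4)=2$. For $i\in\{3,4\}$, $P_{1i}^f(v_1,v_3)$ (resp. $P_{2i}^f(v_2,v_4)$) is the set of paths from $v_1$ to $v_3$ (resp. $v_2$ to $v_4$) all of whose vertices have colours in $\{1,i\}$ (resp. $\{2,i\}$). The colouring $f\in F_2(G^{C_4})$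 is a shared-endpoint-colouring on $\{v_2,v_4\}$ if $P_{13}^f(v_1,v_3)=P_{14}^f(v_1,v_3)=\emptyset$, and on $\{v_1,v_3\}$ if both $P_{13}^f(v_1,v_3)$ and $P_{14}^f(v_1,v_3)$ are nonempty. For a $4$-chromatic maximal planar graph $G$ with $\delta(G)\ge4$, a bichromatic cycle $C$ of $f\in C_4^0(G)$ is an unchanged bichromatic cycle (UB-cycle) if $|f'(C)|=2$ for all $f'\in F^f(G)$; $G$ is a UBCMPG with respect to $C$ if some $f$ has $C$ as a UB-cycle. An SMPG $G^{C}$ with $|C|=4$ is a $4$-base-module if there is an SMPG $G_1^{C}$ with $G^{C}\cap G_1^{C}=C$ (placed in the exterior of $C$) such that $G=G^{C}\cup G_1^{C}$ is a $4$-chromatic maximal planar graph with $\delta(G)\ge 4$ which is a UBCMPG with respect to $C$.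
   Formalization: Adds the hypothesis that every vertex of G^{C_4} not on C_4 has degree at least 4; without it the "if" direction fails, since an interior vertex of degree 3 can satisfy the colouring condition while no union G has δ(G) ≥ 4. *)

theory Defs
  imports "HOL-Analysis.Analysis" "HOL-Combinatorics.Permutations"
begin

section \<open>Plane graphs\<close>

text \<open>
  Vertices are points of the plane and an edge is the point set of an arc, so a subgraph, a union
  or an intersection is formed on the vertex sets and on the edge sets.
\<close>

record drawing =
  verts :: "complex set"
  edges :: "complex set set"

definition arc_between :: "complex set \<Rightarrow> complex \<Rightarrow> complex \<Rightarrow> bool" where
  "arc_between e u v \<longleftrightarrow>
     (\<exists>\<gamma>. arc \<gamma> \<and> path_image \<gamma> = e \<and> pathstart \<gamma> = u \<and> pathfinish \<gamma> = v)"

text \<open>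
  An edge meets the vertex set exactly in its two ends. Distinct edges meet only in vertices and
  have distinct pairs of ends, so the graph is simple (\<^const>\<open>arc\<close> already excludes loops).
\<close>

definition plane_graph :: "drawing \<Rightarrow> bool" where
  "plane_graph G \<longleftrightarrow>
     finite (verts G) \<and> finite (edges G) \<and>
     (\<forall>e\<in>edges G. \<exists>u\<in>verts G. \<exists>v\<in>verts G. arc_between e u v \<and> e \<inter> verts G = {u, v}) \<and>
     (\<forall>e\<in>edges G. \<forall>e'\<in>edges G. e \<noteq> e' \<longrightarrow>
        e \<inter> e' \<subseteq> verts G \<and> e \<inter> verts G \<noteq> e' \<inter> verts G)"

definition adj :: "drawing \<Rightarrow> complex \<Rightarrow> complex \<Rightarrow> bool" where
  "adj G u v \<longleftrightarrow> u \<noteq> v \<and> (\<exists>e\<in>edges G. e \<inter> verts G = {u, v})"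

definition degree :: "drawing \<Rightarrow> complex \<Rightarrow> nat" where
  "degree G v = card {u. adj G v u}"

definition min_degree :: "drawing \<Rightarrow> nat" where
  "min_degree G = Min (degree G ` verts G)"

definition faces :: "drawing \<Rightarrow> complex set set" where
  "faces G = components (- (verts G \<union> \<Union>(edges G)))"

definition graph_union :: "drawing \<Rightarrow> drawing \<Rightarrow> drawing" where
  "graph_union G H = \<lparr>verts = verts G \<union> verts H, edges = edges G \<union> edges H\<rparr>"

text \<open>A cycle is given by the list of its vertices in cyclic order.\<close>

definition is_cycle :: "drawing \<Rightarrow> complex list \<Rightarrow> bool" where
  "is_cycle G C \<longleftrightarrow> 3 \<le> length C \<and> distinct C \<and> set C \<subseteq> verts G \<and>
     (\<forall>i<length C. adj G (C ! i) (C ! (Suc i mod length C)))"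

definition cycle_edges :: "drawing \<Rightarrow> complex list \<Rightarrow> complex set set" where
  "cycle_edges G C =
     {e \<in> edges G. \<exists>i<length C. e \<inter> verts G = {C ! i, C ! (Suc i mod length C)}}"

definition cycle_curve :: "drawing \<Rightarrow> complex list \<Rightarrow> complex set" where
  "cycle_curve G C = \<Union>(cycle_edges G C)"

definition face_bounded_by :: "drawing \<Rightarrow> complex set \<Rightarrow> complex list \<Rightarrow> bool" where
  "face_bounded_by G F C \<longleftrightarrow> F \<in> faces G \<and> is_cycle G C \<and> frontier F = cycle_curve G C"

definition triangular_face :: "drawing \<Rightarrow> complex set \<Rightarrow> bool" where
  "triangular_face G F \<longleftrightarrow> (\<exists>T. length T = 3 \<and> face_bounded_by G F T)"

definition maximal_plane :: "drawing \<Rightarrow> bool" where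
  "maximal_plane G \<longleftrightarrow> plane_graph G \<and> (\<forall>F\<in>faces G. triangular_face G F)"

definition smpg_at :: "complex set \<Rightarrow> drawing \<Rightarrow> complex list \<Rightarrow> bool" where
  "smpg_at F0 G C \<longleftrightarrow> plane_graph G \<and> 4 \<le> length C \<and> face_bounded_by G F0 C \<and>
     (\<forall>F\<in>faces G. F \<noteq> F0 \<longrightarrow> triangular_face G F)"

definition smpg :: "drawing \<Rightarrow> complex list \<Rightarrow> bool" where
  "smpg G C \<longleftrightarrow> (\<exists>F0. \<not> bounded F0 \<and> smpg_at F0 G C)"

text \<open>
  A semi-maximal planar graph placed in the exterior of its cycle: the drawing is turned inside
  out, so that the face which is not required to be a triangle is the inside of the cycle.
\<close>

definition exterior_smpg :: "drawing \<Rightarrow> complex list \<Rightarrow> bool" where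
  "exterior_smpg G C \<longleftrightarrow> smpg_at (inside (cycle_curve G C)) G C"


section \<open>Colourings and Kempe equivalence\<close>

definition colouring :: "nat \<Rightarrow> drawing \<Rightarrow> (complex \<Rightarrow> nat) \<Rightarrow> bool" where
  "colouring k G f \<longleftrightarrow> f \<in> verts G \<rightarrow>\<^sub>E {1..k} \<and> (\<forall>u v. adj G u v \<longrightarrow> f u \<noteq> f v)"

definition chromatic_number :: "drawing \<Rightarrow> nat" where
  "chromatic_number G = (LEAST k. \<exists>f. colouring k G f)"

definition bichromatic_cycle :: "drawing \<Rightarrow> (complex \<Rightarrow> nat) \<Rightarrow> complex list \<Rightarrow> bool" where
  "bichromatic_cycle G f C \<longleftrightarrow> is_cycle G C \<and> card (f ` set C) = 2"

definition swap_inside ::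
    "drawing \<Rightarrow> complex list \<Rightarrow> nat \<Rightarrow> nat \<Rightarrow> (complex \<Rightarrow> nat) \<Rightarrow> complex \<Rightarrow> nat" where
  "swap_inside G C s t f =
     (\<lambda>v. if v \<in> verts G \<inter> inside (cycle_curve G C) then Transposition.transpose s t (f v) else f v)"

definition sigma_step :: "drawing \<Rightarrow> (complex \<Rightarrow> nat) \<Rightarrow> (complex \<Rightarrow> nat) \<Rightarrow> bool" where
  "sigma_step G f g \<longleftrightarrow>
     (\<exists>C s t. bichromatic_cycle G f C \<and> s \<noteq> t \<and> {s, t} = {1..4} - f ` set C \<and>
        g = swap_inside G C s t f)"

definition renaming :: "drawing \<Rightarrow> (complex \<Rightarrow> nat) \<Rightarrow> (complex \<Rightarrow> nat) \<Rightarrow> bool" where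
  "renaming G f g \<longleftrightarrow> (\<exists>\<pi>. \<pi> permutes {1..4} \<and> g = restrict (\<pi> \<circ> f) (verts G))"

text \<open>
  Colourings are taken up to a permutation of the colour names: instead of forming a quotient, a
  Kempe class is a set of colourings that is closed under renaming.
  Both kinds of step are reversible, so the reflexive transitive closure is an equivalence.
\<close>

definition kempe_class :: "drawing \<Rightarrow> (complex \<Rightarrow> nat) \<Rightarrow> (complex \<Rightarrow> nat) set" where
  "kempe_class G f = {g. (\<lambda>h h'. sigma_step G h h' \<or> renaming G h h')\<^sup>*\<^sup>* f g}"

definition F2 :: "drawing \<Rightarrow> complex list \<Rightarrow> (complex \<Rightarrow> nat) set" where
  "F2 G C = {f. colouring 4 G f \<and> card (f ` set C) = 2}"

definition kempe_paths ::
    "drawing \<Rightarrow> (complex \<Rightarrow> nat) \<Rightarrow> nat \<Rightarrow> nat \<Rightarrow> complex \<Rightarrow> complex \<Rightarrow> complex list set" where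
  "kempe_paths G f i j u v =
     {p. p \<noteq> [] \<and> distinct p \<and> set p \<subseteq> verts G \<and> hd p = u \<and> last p = v \<and>
         successively (adj G) p \<and> f ` set p \<subseteq> {i, j}}"

text \<open>
  Shared-endpoint-colourings, on the pair of the second and fourth and on the pair of the first
  and third vertex of a 4-cycle. The colours of the first and second vertex take the role of the
  names 1 and 2, and the remaining two colours that of 3 and 4, so that no normalisation of
  the colour names is needed.
\<close>

definition shared_endpoint_24 ::
    "drawing \<Rightarrow> complex list \<Rightarrow> (complex \<Rightarrow> nat) \<Rightarrow> bool" where
  "shared_endpoint_24 G C f \<longleftrightarrow> f \<in> F2 G C \<and>
     (\<forall>i \<in> {1..4} - {f (C ! 0), f (C ! 1)}. kempe_paths G f (f (C ! 0)) i (C ! 0) (C ! 2) = {})"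

definition shared_endpoint_13 ::
    "drawing \<Rightarrow> complex list \<Rightarrow> (complex \<Rightarrow> nat) \<Rightarrow> bool" where
  "shared_endpoint_13 G C f \<longleftrightarrow> f \<in> F2 G C \<and>
     (\<forall>i \<in> {1..4} - {f (C ! 0), f (C ! 1)}. kempe_paths G f (f (C ! 0)) i (C ! 0) (C ! 2) \<noteq> {})"


section \<open>Unchanged bichromatic cycles and 4-base-modules\<close>

definition UB_cycle :: "drawing \<Rightarrow> (complex \<Rightarrow> nat) \<Rightarrow> complex list \<Rightarrow> bool" where
  "UB_cycle G f C \<longleftrightarrow> colouring 4 G f \<and> bichromatic_cycle G f C \<and>
     (\<forall>f'\<in>kempe_class G f. card (f' ` set C) = 2)"

definition UBCMPG :: "drawing \<Rightarrow> complex list \<Rightarrow> bool" where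
  "UBCMPG G C \<longleftrightarrow> maximal_plane G \<and> chromatic_number G = 4 \<and> 4 \<le> min_degree G \<and>
     (\<exists>f. UB_cycle G f C)"

definition base_module4 :: "drawing \<Rightarrow> complex list \<Rightarrow> bool" where
  "base_module4 G C \<longleftrightarrow> smpg G C \<and> length C = 4 \<and>
     (\<exists>G1. exterior_smpg G1 C \<and>
        verts G \<inter> verts G1 = set C \<and> edges G \<inter> edges G1 = cycle_edges G C \<and>
        UBCMPG (graph_union G G1) C)"

end

theory Submission
  imports Defs
begin

text \<open>
  Let \<open>H\<close> be \<open>G\<close> with an exterior graph \<open>G1\<close> pasted along the quadrangle. In a triangulated quadrangle
  coloured 1, 2, 1, 2 on its boundary there is a 13-path between \<open>v1\<close> and \<open>v3\<close> if and only if there is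
  no 24-path between \<open>v2\<close> and \<open>v4\<close>. If the quadrangle is a UB-cycle, a 13-path in \<open>G\<close> and one in
  \<open>G1\<close> cannot coexist, as they would close up to a cycle separating \<open>v2\<close> from \<open>v4\<close>; the same holds
  for the other colour pairs. So \<open>G1\<close>, whose colouring is fixed up to renaming by Kempe changes inside
  \<open>G\<close>, determines which Kempe paths \<open>G\<close> has, and the change at the quadrangle itself, which
  exchanges 3 and 4 in \<open>G\<close> only, shows that the colours 3 and 4 behave alike.

  Conversely, if \<open>G\<close> never has a 13- or 14-path between \<open>v1\<close> and \<open>v3\<close>, put two adjacent vertices
  \<open>a\<close> and \<open>b\<close> outside, both joined to \<open>v1\<close> and \<open>v3\<close>, with \<open>a\<close> joined to \<open>v2\<close> and \<open>b\<close> to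
  \<open>v4\<close>. A bichromatic cycle through \<open>a\<close> or \<open>b\<close> would contain such a path, so all Kempe changes
  take place in \<open>G\<close>. The other case follows by rotating the quadrangle.
\<close>

section \<open>Jordan curves and crosscuts\<close>

text \<open>Drawings are topological, so every crossing argument is reduced to one tool: a crosscut
  divides a side of a Jordan curve into exactly two sides of smaller Jordan curves. The exceptional
  face is the outside of the quadrangle for \<open>G\<close> and its inside for \<open>G1\<close>;
  therefore \<open>jordan_side\<close> treats both sides of a curve alike.

  The path dichotomy has two halves of different nature: that two disjoint crossing paths cannot
  coexist is topology, that one of them exists is a parity count over the triangles.

  The cap is an octahedron with poles \<open>v1\<close>, \<open>v3\<close> and equator
  \<open>v2\<close>, \<open>a\<close>, \<open>b\<close>, \<open>v4\<close> from which the edge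
  between \<open>v2\<close> and \<open>v4\<close> is deleted; this opens the quadrangular face. As
  long as the quadrangle has two colours, \<open>a\<close> and \<open>b\<close> carry the other two,
  so \<open>v1\<close> and \<open>v3\<close> are the only equally coloured neighbours of either. The
  cap gives \<open>v2\<close> and \<open>v4\<close> just one neighbour each; their fourth one is the
  apex of a triangle of \<open>G\<close> at a boundary edge. Interior vertices of \<open>G\<close>
  gain no neighbour from outside, whence the assumption \<open>interior_degree\<close> for the
  converse.\<close>

definition jordan_side :: "complex set \<Rightarrow> complex set \<Rightarrow> bool" where
  "jordan_side J D \<longleftrightarrow>
     (\<exists>\<gamma>. simple_path \<gamma> \<and> pathfinish \<gamma> = pathstart \<gamma> \<and> path_image \<gamma> = J) \<and> (D = inside J \<or> D = outside J)"

text \<open>A connected set that contains \<open>F\<close> properly has to meet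
  \<open>frontier F = J\<close>; hence \<open>F\<close> cannot be enlarged within the complement of
  \<open>J\<close>.\<close>

lemma component_Compl_frontier:
  assumes "open F" "connected F" "F \<noteq> {}" "frontier F = J"
  shows "F \<in> components (- J)"
  unfolding in_components_maximal
proof (intro conjI allI impI)
  have "F \<inter> J = {}" using assms(1,4) by (auto simp: frontier_def interior_open)
  then show "F \<noteq> {}" "connected F" "F \<subseteq> - J" using assms by auto
  fix d assume d: "d \<noteq> {} \<and> F \<subseteq> d \<and> d \<subseteq> - J \<and> connected d"
  show "d = F"
  proof (rule ccontr)
    assume "d \<noteq> F"
    then have "d \<inter> F \<noteq> {}" "d - F \<noteq> {}" using d assms by auto
    then have "d \<inter> frontier F \<noteq> {}" using connected_Int_frontier[of d F] d by blast
    then show False using d assms by auto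
  qed
qed

lemma jordan_sideD:
  assumes "jordan_side J D"
  shows "open D" "connected D" "D \<noteq> {}" "frontier D = J" "D \<inter> J = {}" "compact J" "D \<in> components (- J)"
proof -
  obtain \<gamma> where g: "simple_path \<gamma>" "pathfinish \<gamma> = pathstart \<gamma>" "path_image \<gamma> = J" and D: "D = inside J \<or> D = outside J"
    using assms unfolding jordan_side_def by blast
  note J = Jordan_inside_outside[OF g(1,2), unfolded g(3)]
  show o: "open D" and c: "connected D" and ne: "D \<noteq> {}" and fr: "frontier D = J"
    using J D by auto
  show dis: "D \<inter> J = {}" using o fr by (auto simp: frontier_def interior_open)
  show "compact J" using g by (metis compact_simple_path_image)
  show "D \<in> components (- J)" by (rule component_Compl_frontier[OF o c ne fr])
qed

lemma jordan_side_opposite: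
  assumes "jordan_side J D"
  obtains D' where "jordan_side J D'" "D \<inter> D' = {}" "D \<union> D' = - J"
proof -
  obtain \<gamma> where g: "simple_path \<gamma>" "pathfinish \<gamma> = pathstart \<gamma>" "path_image \<gamma> = J" and D: "D = inside J \<or> D = outside J"
    using assms unfolding jordan_side_def by blast
  note J = Jordan_inside_outside[OF g(1,2), unfolded g(3)]
  show thesis
    using that[of "inside J"] that[of "outside J"] D J g unfolding jordan_side_def by blast
qed

lemma jordan_sides_unique:
  assumes "jordan_side J D" "jordan_side J D'" "jordan_side J D''" "D \<noteq> D'"
  shows "D'' = D \<or> D'' = D'"
  using assms unfolding jordan_side_def by auto

text \<open>Faces are known only through their frontier. Since a component of the complement is
  determined by any of its points, a face whose frontier is a Jordan curve must be one of the two
  sides.\<close>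

lemma jordan_sideI_frontier:
  assumes "jordan_side J D0" "connected F" "open F" "F \<noteq> {}" "frontier F = J"
  shows "jordan_side J F"
proof -
  obtain D1 where D1: "jordan_side J D1" "D0 \<inter> D1 = {}" "D0 \<union> D1 = - J"
    using jordan_side_opposite[OF assms(1)] by blast
  have FJ: "F \<inter> J = {}" using assms(3,5) by (auto simp: frontier_def interior_open)
  have "F = D" if D: "jordan_side J D" and ne: "F \<inter> D \<noteq> {}" for D
  proof -
    have "F \<in> components (- J)" by (rule component_Compl_frontier[OF assms(3,2,4,5)])
    then show ?thesis using jordan_sideD(7)[OF D] ne components_nonoverlap by blast
  qed
  then show ?thesis using D1 assms(1,4) FJ
    by (metis Compl_disjoint2 Int_Un_distrib Un_Int_eq(1) Un_empty disjoint_eq_subset_Compl inf_absorb1)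
qed

text \<open>
  The complement of a Jordan curve is uniformly locally connected at the points of the curve: by
  Janiszewski's theorem the far part of the curve and the exterior of the ball do not separate.
\<close>
lemma jordan_locally_connected:
  assumes "jordan_side J D" "p \<in> J" "0 < e"
  obtains d where "0 < d" "d \<le> e"
    "\<And>x y D'. \<lbrakk>jordan_side J D'; x \<in> ball p d \<inter> D'; y \<in> ball p d \<inter> D'\<rbrakk> \<Longrightarrow> connected_component (ball p e - J) x y"
proof -
  obtain \<gamma> where g: "simple_path \<gamma>" "pathfinish \<gamma> = pathstart \<gamma>" "path_image \<gamma> = J"
    using assms unfolding jordan_side_def by blast
  obtain u where u: "u \<in> {0..1}" "\<gamma> u = p" using assms(2) g(3) by (auto simp: path_image_def)
  \<comment> \<open>Shifting the parameter makes the loop begin and end at \<open>p\<close>; the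
    middle piece \<open>B\<close> then keeps a positive distance from \<open>p\<close> but contains
    everything of the curve outside the ball of radius \<open>e\<close>.\<close>
  define h where "h = shiftpath u \<gamma>"
  have h: "simple_path h" "path_image h = J" "h 0 = p" "h 1 = p"
    using u g simple_path_shiftpath[of \<gamma> u] path_image_shiftpath[of u \<gamma>] endpoints_shiftpath[of \<gamma> u]
    by (auto simp: h_def pathstart_def pathfinish_def)
  have ch: "continuous_on {0..1} h" using h(1) by (simp add: simple_path_def path_def)
  obtain d0 where d0: "d0 > 0" "\<And>t. t \<in> {0..1} \<Longrightarrow> dist t 0 < d0 \<Longrightarrow> dist (h t) p < e"
    using ch assms(3) h(3) unfolding continuous_on_iff by (metis atLeastAtMost_iff order_refl zero_le_one)
  obtain d1 where d1: "d1 > 0" "\<And>t. t \<in> {0..1} \<Longrightarrow> dist t 1 < d1 \<Longrightarrow> dist (h t) p < e"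
    using ch assms(3) h(4) unfolding continuous_on_iff by (metis atLeastAtMost_iff order_refl zero_le_one)
  define t where "t = min (1/4) (min d0 d1 / 2)"
  have t: "0 < t" "t \<le> 1/4" "t < d0" "t < d1" using d0 d1 by (auto simp: t_def min_def)
  define B where "B = h ` {t..1-t}"
  have cB: "continuous_on {t..1-t} h" by (rule continuous_on_subset[OF ch]) (use t in auto)
  have B: "compact B" "connected B"
    unfolding B_def by (rule compact_continuous_image[OF cB]; simp) (rule connected_continuous_image[OF cB]; simp)
  have pB: "p \<notin> B"
  proof
    assume "p \<in> B"
    then obtain s where s: "s \<in> {t..1-t}" "h s = h 0" using h by (auto simp: B_def)
    have "loop_free h" using h(1) by (simp add: simple_path_def)
    then have "s = 0 \<or> s = 1" using s t unfolding loop_free_def by fastforce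
    then show False using s t by auto
  qed
  have JB: "J - ball p e \<subseteq> B"
  proof
    fix z assume z: "z \<in> J - ball p e"
    then obtain s where s: "s \<in> {0..1}" "h s = z" using h(2) by (auto simp: path_image_def)
    have "t \<le> s" using d0(2)[of s] s z t by (force simp: dist_real_def dist_commute)
    moreover have "s \<le> 1 - t" using d1(2)[of s] s z t by (force simp: dist_real_def dist_commute)
    ultimately show "z \<in> B" using s by (auto simp: B_def)
  qed
  have BJ: "B \<subseteq> J" using h(2) t by (auto simp: B_def path_image_def)
  have "open (- B)" using B(1) by (simp add: compact_imp_closed open_Compl)
  then obtain d2 where d2: "d2 > 0" "ball p d2 \<subseteq> - B" using pB by (meson ComplI open_contains_ball)
  define d where "d = min e d2"
  show thesis
  proof
    show "0 < d" "d \<le> e" using d2 assms by (auto simp: d_def)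
    fix x y D' assume D': "jordan_side J D'" and x: "x \<in> ball p d \<inter> D'" and y: "y \<in> ball p d \<inter> D'"
    \<comment> \<open>\<open>J\<close> and \<open>?T\<close> meet exactly in \<open>B\<close>, and
      connectedness of this intersection is the hypothesis of Janiszewski's theorem.\<close>
    let ?T = "- ball p e \<union> B"
    have "connected_component (- (J \<union> ?T)) x y"
    proof (rule Janiszewski)
      show "compact J" using jordan_sideD[OF D'] by simp
      show "closed ?T" using B(1) by (intro closed_Un) (auto intro: compact_imp_closed)
      have "J \<inter> ?T = B" using JB BJ by auto
      then show "connected (J \<inter> ?T)" using B by simp
      show "connected_component (- J) x y"
        unfolding connected_component_def
        by (rule exI[of _ D']) (use jordan_sideD(2,5)[OF D'] x y in auto)
      show "connected_component (- ?T) x y"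
        unfolding connected_component_def
        by (rule exI[of _ "ball p d"]) (use x y d2 in \<open>auto simp: d_def\<close>)
    qed
    then show "connected_component (ball p e - J) x y"
      by (rule connected_component_of_subset) auto
  qed
qed

text \<open>The \<open>n\<close>-th path is run over \<open>[n, n + 1]\<close>, and
  \<open>s / (1 - s)\<close> maps \<open>[0, 1)\<close> onto the half-line. Continuity at the last
  parameter is the shrinking of the images towards \<open>p\<close>.\<close>

lemma path_concat_sequence:
  fixes p :: "'a::real_normed_vector"
  assumes g: "\<And>n. path (g n)" "\<And>n. pathfinish (g n) = pathstart (g (Suc n))" "\<And>n. path_image (g n) \<subseteq> S"
    and lim: "\<And>e. e > 0 \<Longrightarrow> \<exists>N. \<forall>n\<ge>N. path_image (g n) \<subseteq> ball p e"
  obtains h where "path h" "pathstart h = pathstart (g (0::nat))" "pathfinish h = p" "path_image h \<subseteq> insert p S"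
proof -
  define G where "G = (\<lambda>t::real. g (nat \<lfloor>t\<rfloor>) (t - \<lfloor>t\<rfloor>))"
  \<comment> \<open>The interval is closed: at its right end the floor has already jumped, and the
    value agrees because consecutive paths fit together.\<close>
  have Gn: "G t = g n (t - real n)" if "t \<in> {real n..real (Suc n)}" for n t
  proof (cases "t = real (Suc n)")
    case True
    have fl: "\<lfloor>t\<rfloor> = int (Suc n)" unfolding True by (rule floor_of_nat)
    have "nat \<lfloor>t\<rfloor> = Suc n" "t - \<lfloor>t\<rfloor> = 0" using True unfolding fl by auto
    then show ?thesis using g(2)[of n] True by (simp add: G_def pathstart_def pathfinish_def)
  next
    case False
    then have "\<lfloor>t\<rfloor> = int n" using that by (intro floor_unique) auto
    then show ?thesis by (simp add: G_def)
  qed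
  have GS: "G t \<in> path_image (g (nat \<lfloor>t\<rfloor>))" for t
    unfolding G_def path_image_def by (rule imageI) (auto, linarith)
  have cG: "continuous_on {0..real n} G" for n
  proof (induction n)
    case 0 then show ?case by simp
  next
    case (Suc n)
    have "continuous_on {real n..real (Suc n)} (\<lambda>t. g n (t - real n))"
      by (rule continuous_on_compose2[where g="g n" and t="{0..1}"])
        (use g(1)[of n] in \<open>auto simp: path_def intro!: continuous_intros\<close>)
    then have "continuous_on {real n..real (Suc n)} G"
      using Gn by (subst continuous_on_cong[OF refl, where g="\<lambda>t. g n (t - real n)"]) auto
    then have "continuous_on ({0..real n} \<union> {real n..real (Suc n)}) G"
      using Suc by (intro continuous_on_closed_Un) auto
    moreover have "{0..real n} \<union> {real n..real (Suc n)} = {0..real (Suc n)}" by auto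
    ultimately show ?case by metis
  qed
  define h where "h = (\<lambda>s::real. if s < 1 then G (s / (1 - s)) else p)"
  show thesis
  proof
    have "continuous (at s within {0..1}) h" if s: "s \<in> {0..1}" for s
    proof (cases "s < 1")
      case True
      define r where "r = (s + 1) / 2"
      have r: "s < r" "r < 1" using True by (auto simp: r_def)
      obtain n where n: "r / (1 - r) \<le> real n" using real_arch_simple by blast
      have "t / (1 - t) \<le> real n" if "0 \<le> t" "t \<le> r" for t
      proof -
        have "t / (1 - t) \<le> r / (1 - r)" using that r by (intro frac_le) auto
        then show ?thesis using n by simp
      qed
      then have "continuous_on {0..r} (\<lambda>t. G (t / (1 - t)))"
        using r by (intro continuous_on_compose2[OF cG[of n]] continuous_intros) auto
      then have "continuous_on {0..r} h"
        using r by (subst continuous_on_cong[OF refl, where g="\<lambda>t. G (t / (1 - t))"]) (auto simp: h_def)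
      then have "continuous (at s within {0..r}) h" using s r by (simp add: continuous_on_eq_continuous_within)
      moreover have "at s within {0..r} = at s within {0..1}"
        by (rule at_within_nhd[where S="{..<r}"]) (use r in auto)
      ultimately show ?thesis by simp
    next
      case False
      then have s1: "s = 1" using s by auto
      show ?thesis unfolding continuous_within_eps_delta
      proof (intro allI impI)
        fix e :: real assume e: "e > 0"
        obtain N where N: "\<And>n. n \<ge> N \<Longrightarrow> path_image (g n) \<subseteq> ball p e" using lim[OF e] by blast
        \<comment> \<open>For \<open>t < 1\<close>, the bound \<open>1 - t < 1 / (N + 1)\<close> is
          equivalent to \<open>t / (1 - t) > N\<close>, so \<open>t\<close> has reached the paths
          that stay in the ball.\<close>
        define d where "d = 1 / (real N + 1)"
        have "dist (h t) (h s) < e" if t: "t \<in> {0..1}" "dist t s < d" for t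
        proof (cases "t < 1")
          case True
          have "1 - t < 1 / (real N + 1)" using t True by (simp add: s1 dist_real_def d_def)
          then have "(1 - t) * (real N + 1) < 1" by (simp add: field_simps)
          moreover have "(1 - t) * (real N + 1) = (1 - t) * real N + 1 - t" by (simp add: algebra_simps)
          ultimately have "real N * (1 - t) \<le> t" by (simp add: mult.commute)
          then have "real N \<le> t / (1 - t)" using True by (simp add: le_divide_eq)
          then have "N \<le> nat \<lfloor>t / (1 - t)\<rfloor>" by (simp add: le_nat_iff le_floor_iff)
          then have "G (t / (1 - t)) \<in> ball p e" using N GS by blast
          then show ?thesis using True s1 by (simp add: h_def dist_commute)
        qed (use e s1 in \<open>simp add: h_def\<close>)
        moreover have "d > 0" by (simp add: d_def)
        ultimately show "\<exists>d>0. \<forall>x'\<in>{0..1}. dist x' s < d \<longrightarrow> dist (h x') (h s) < e" by blast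
      qed
    qed
    then show "path h" by (simp add: path_def continuous_on_eq_continuous_within)
    show "pathstart h = pathstart (g 0)" by (simp add: h_def G_def pathstart_def)
    show "pathfinish h = p" by (simp add: h_def pathfinish_def)
    show "path_image h \<subseteq> insert p S" using GS g(3) by (force simp: h_def path_image_def)
  qed
qed

text \<open>Local connectedness at \<open>p\<close> joins successive points of a sequence in
  \<open>D\<close> tending to \<open>p\<close> by paths in shrinking balls; their concatenation
  arrives at \<open>p\<close>. A general domain may have boundary points that no path reaches, so
  the Jordan curve is essential here.\<close>

lemma jordan_accessible:
  assumes D: "jordan_side J D" and p: "p \<in> J" and q: "q \<in> D"
  obtains h where "path h" "pathstart h = q" "pathfinish h = p" "path_image h \<subseteq> insert p D"
proof -
  have "\<forall>n. \<exists>d. 0 < d \<and> (\<forall>x y. x \<in> ball p d \<inter> D \<longrightarrow> y \<in> ball p d \<inter> D \<longrightarrow> connected_component (ball p (1 / real (Suc n)) - J) x y)"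
  proof
    fix n
    have "1 / real (Suc n) > 0" by simp
    from jordan_locally_connected[OF D p this]
    show "\<exists>d. 0 < d \<and> (\<forall>x y. x \<in> ball p d \<inter> D \<longrightarrow> y \<in> ball p d \<inter> D \<longrightarrow> connected_component (ball p (1 / real (Suc n)) - J) x y)"
      using D by metis
  qed
  then obtain d where d: "\<And>n. 0 < d n"
    "\<And>n x y. \<lbrakk>x \<in> ball p (d n) \<inter> D; y \<in> ball p (d n) \<inter> D\<rbrakk> \<Longrightarrow> connected_component (ball p (1 / real (Suc n)) - J) x y"
    by metis
  have pc: "p \<in> closure D" using jordan_sideD(4)[OF D] p by (auto simp: frontier_def)
  \<comment> \<open>The running minimum makes \<open>e\<close> decreasing, so that both
    \<open>x n\<close> and its successor lie within \<open>d n\<close> of \<open>p\<close>.\<close>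
  define e where "e = (\<lambda>n. Min (d ` {..n}))"
  have e: "0 < e n" "k \<le> n \<Longrightarrow> e n \<le> d k" for n k using d(1) by (auto simp: e_def)
  have "\<forall>n. \<exists>x\<in>D. dist x p < e n" using pc e(1) unfolding closure_approachable by blast
  then obtain x where x: "\<And>n. x n \<in> D" "\<And>n. dist (x n) p < e n" by metis
  have step: "\<exists>g. path g \<and> path_image g \<subseteq> D \<inter> ball p (1 / real (Suc n)) \<and> pathstart g = x n \<and> pathfinish g = x (Suc n)" for n
  proof -
    have "x n \<in> ball p (d n) \<inter> D" "x (Suc n) \<in> ball p (d n) \<inter> D"
      using x(1)[of n] x(1)[of "Suc n"] x(2)[of n] x(2)[of "Suc n"] e(2)[of n n] e(2)[of n "Suc n"]
      by (auto simp: dist_commute)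
    then have c: "connected_component (ball p (1 / real (Suc n)) - J) (x n) (x (Suc n))" by (rule d(2))
    have "open (ball p (1 / real (Suc n)) - J)" using jordan_sideD(6)[OF D] by (auto intro: open_Diff compact_imp_closed)
    with c have "path_component (ball p (1 / real (Suc n)) - J) (x n) (x (Suc n))"
      by (simp add: open_path_connected_component)
    then obtain g where g: "path g" "path_image g \<subseteq> ball p (1 / real (Suc n)) - J" "pathstart g = x n" "pathfinish g = x (Suc n)"
      by (auto simp: path_component_def)
    have "path_image g \<subseteq> D"
      by (rule components_maximal[OF jordan_sideD(7)[OF D]])
         (use g x(1)[of n] pathstart_in_path_image[of g] in \<open>auto simp: connected_path_image\<close>)
    then show ?thesis using g by blast
  qed
  then obtain g where g: "\<And>n. path (g n)" "\<And>n. path_image (g n) \<subseteq> D \<inter> ball p (1 / real (Suc n))"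
    "\<And>n. pathstart (g n) = x n" "\<And>n. pathfinish (g n) = x (Suc n)" by metis
  obtain h where h: "path h" "pathstart h = x 0" "pathfinish h = p" "path_image h \<subseteq> insert p D"
  proof (rule path_concat_sequence[of g D p])
    fix r :: real assume "r > 0"
    then obtain N where N: "1 / real (Suc N) < r" using nat_approx_posE by blast
    have "path_image (g n) \<subseteq> ball p r" if "n \<ge> N" for n
    proof -
      have "1 / real (Suc n) \<le> 1 / real (Suc N)" using that by (simp add: frac_le)
      then have "ball p (1 / real (Suc n)) \<subseteq> ball p r" using N by (intro subset_ball) simp
      then show ?thesis using g(2)[of n] by blast
    qed
    then show "\<exists>N. \<forall>n\<ge>N. path_image (g n) \<subseteq> ball p r" by blast
  qed (use g in auto)
  have "path_connected D" using jordan_sideD[OF D] by (simp add: connected_open_path_connected)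
  then obtain k where k: "path k" "path_image k \<subseteq> D" "pathstart k = q" "pathfinish k = x 0"
    using q x(1)[of 0] unfolding path_connected_def by metis
  show thesis
    by (rule that[of "k +++ h"]) (use h k in \<open>auto simp: path_image_join\<close>)
qed

lemma connected_subset_jordan_side:
  assumes "jordan_side J D" "connected X" "X \<inter> J = {}" "X \<inter> D \<noteq> {}"
  shows "X \<subseteq> D"
  by (rule components_maximal[OF jordan_sideD(7)[OF assms(1)] assms(2)]) (use assms in auto)

section \<open>Arcs and their ends, joining and splitting\<close>

lemma arc_betweenD:
  assumes "arc_between e u v"
  shows "u \<noteq> v" "u \<in> e" "v \<in> e" "compact e" "connected e" "connected (e - {u, v})" "e - {u, v} \<noteq> {}"
proof -
  obtain g where g: "arc g" "path_image g = e" "pathstart g = u" "pathfinish g = v"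
    using assms by (auto simp: arc_between_def)
  show uv: "u \<noteq> v" "u \<in> e" "v \<in> e" "compact e" "connected e"
    using g arc_distinct_ends pathstart_in_path_image pathfinish_in_path_image compact_arc_image connected_arc_image
    by blast+
  show "connected (e - {u, v})" using connected_simple_path_endless[of g] g arc_imp_simple_path by fastforce
  show "e - {u, v} \<noteq> {}"
  proof
    assume "e - {u, v} = {}"
    then have "finite e" using finite_subset by fastforce
    then show False using uv connected_finite_iff_sing by fastforce
  qed
qed

lemma arc_between_sym: "arc_between e u v \<Longrightarrow> arc_between e v u"
  unfolding arc_between_def
  by (metis arc_reversepath path_image_reversepath pathfinish_reversepath pathstart_reversepath)

lemma arc_between_join:
  assumes "arc_between e u v" "arc_between e' v w" "e \<inter> e' \<subseteq> {v}"
  shows "arc_between (e \<union> e') u w"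
proof -
  obtain g where g: "arc g" "path_image g = e" "pathstart g = u" "pathfinish g = v"
    using assms by (auto simp: arc_between_def)
  obtain g' where g': "arc g'" "path_image g' = e'" "pathstart g' = v" "pathfinish g' = w"
    using assms by (auto simp: arc_between_def)
  have "arc (g +++ g')" using g g' assms(3) by (intro arc_join) auto
  then show ?thesis unfolding arc_between_def
    using g g' by (intro exI[of _ "g +++ g'"]) (simp add: path_image_join)
qed

lemma arc_between_split:
  assumes "arc_between e u v" "w \<in> e - {u, v}"
  obtains e1 e2 where "arc_between e1 u w" "arc_between e2 w v" "e1 \<union> e2 = e" "e1 \<inter> e2 = {w}"
proof -
  obtain g where g: "arc g" "path_image g = e" "pathstart g = u" "pathfinish g = v"
    using assms by (auto simp: arc_between_def)
  obtain t where t: "t \<in> {0..1}" "g t = w" using assms(2) g(2) by (auto simp: path_image_def)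
  have t': "0 < t" "t < 1" using t g assms(2) by (auto simp: pathstart_def pathfinish_def less_le)
  have inj: "inj_on g {0..1}" using g by (simp add: arc_def)
  show thesis
  proof
    show "arc_between (path_image (subpath 0 t g)) u w"
      unfolding arc_between_def using g t t' arc_subpath_arc[of g 0 t]
      by (intro exI[of _ "subpath 0 t g"]) (auto simp: pathstart_def pathfinish_def subpath_def)
    show "arc_between (path_image (subpath t 1 g)) w v"
      unfolding arc_between_def using g t t' arc_subpath_arc[of g t 1]
      by (intro exI[of _ "subpath t 1 g"]) (auto simp: pathstart_def pathfinish_def subpath_def)
    have im: "path_image (subpath 0 t g) = g ` {0..t}" "path_image (subpath t 1 g) = g ` {t..1}"
      using t' by (auto simp: path_image_subpath)
    have "{0..t} \<union> {t..1} = {0..1}" using t' by auto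
    then show "path_image (subpath 0 t g) \<union> path_image (subpath t 1 g) = e"
      unfolding im image_Un[symmetric] using g(2) by (simp add: path_image_def)
    have "g ` {0..t} \<inter> g ` {t..1} = g ` ({0..t} \<inter> {t..1})"
      by (rule inj_on_image_Int[OF inj, symmetric]) (use t' in auto)
    also have "{0..t} \<inter> {t..1} = {t}" using t' by auto
    finally show "path_image (subpath 0 t g) \<inter> path_image (subpath t 1 g) = {w}"
      unfolding im using t by simp
  qed
qed

lemma jordan_of_arcs:
  assumes "arc_between c1 a b" "arc_between c2 a b" "c1 \<inter> c2 \<subseteq> {a, b}"
  shows "jordan_side (c1 \<union> c2) (inside (c1 \<union> c2))"
proof -
  obtain g where g: "arc g" "path_image g = c1" "pathstart g = a" "pathfinish g = b"
    using assms by (auto simp: arc_between_def)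
  obtain g' where g': "arc g'" "path_image g' = c2" "pathstart g' = b" "pathfinish g' = a"
    using arc_between_sym[OF assms(2)] by (auto simp: arc_between_def)
  have "simple_path (g +++ g')" using g g' assms(3) by (intro simple_path_join_loop) auto
  then show ?thesis unfolding jordan_side_def
    using g g' by (intro conjI exI[of _ "g +++ g'"]) (auto simp: path_image_join)
qed

text \<open>In the small ball \<open>S\<close> contributes no points beyond the curve, so the
  connections found there avoid all of \<open>S\<close>. It is applied with \<open>S\<close> a theta
  curve and with \<open>S\<close> the whole drawing.\<close>

lemma jordan_side_local:
  assumes D: "jordan_side J D" and p: "p \<in> J" "0 < r" "ball p r \<inter> S \<subseteq> J"
  obtains d where "0 < d"
    "\<And>x y D'. \<lbrakk>jordan_side J D'; x \<in> ball p d \<inter> D'; y \<in> ball p d \<inter> D'\<rbrakk> \<Longrightarrow> connected_component (- S) x y"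
proof -
  have sub: "ball p r - J \<subseteq> - S" using p by auto
  show thesis
    by (rule jordan_locally_connected[OF D p(1,2)]) (metis that connected_component_of_subset[OF _ sub])
qed

lemma closure_meets_ball: "p \<in> closure X \<Longrightarrow> 0 < d \<Longrightarrow> ball p d \<inter> X \<noteq> {}"
  by (metis closure_approachable dist_commute disjoint_iff mem_ball)

text \<open>
  For \<open>i = 1, 2\<close> let \<open>Ai\<close> be the side of \<open>ci \<union> c\<close> which avoids the opposite side \<open>D'\<close>
  of the Jordan curve. Close to any point of the theta curve other than \<open>a\<close> and \<open>b\<close> there are only
  points of two of the regions \<open>A1\<close>, \<open>A2\<close>, \<open>D'\<close>; so a further region would have its
  frontier in \<open>{a, b}\<close>, which is impossible.
\<close>
lemma jordan_crosscut:
  assumes D: "jordan_side (c1 \<union> c2) D"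
    and arcs: "arc_between c1 a b" "arc_between c2 a b" "c1 \<inter> c2 = {a, b}"
    and c: "arc_between c a b" "c - {a, b} \<subseteq> D"
  obtains A1 A2 where "jordan_side (c1 \<union> c) A1" "jordan_side (c2 \<union> c) A2" "A1 \<inter> A2 = {}" "A1 \<union> A2 = D - c"
proof -
  define S where "S = c1 \<union> c2 \<union> c"
  note a1 = arc_betweenD[OF arcs(1)] and a2 = arc_betweenD[OF arcs(2)] and a3 = arc_betweenD[OF c(1)]
  have dis: "c1 \<inter> c = {a, b}" "c2 \<inter> c = {a, b}" using c a1 a2 a3 jordan_sideD(5)[OF D] by auto
  have cl: "closed c1" "closed c2" "closed c" using a1(4) a2(4) a3(4) compact_imp_closed by auto
  have clS: "closed S" unfolding S_def using cl by auto
  obtain D' where D': "jordan_side (c1 \<union> c2) D'" "D \<inter> D' = {}" "D \<union> D' = - (c1 \<union> c2)"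
    using jordan_side_opposite[OF D] by blast
  have D'S: "D' \<inter> S = {}" unfolding S_def using D' c(2) jordan_sideD(5)[OF D'(1)] a1 by auto
  have D'cl: "c1 \<union> c2 \<subseteq> closure D'" using jordan_sideD(4)[OF D'(1)] by (auto simp: frontier_def)
  \<comment> \<open>Done once for both halves: \<open>k\<close> is the half that bounds together
    with \<open>c\<close>, and \<open>l\<close> is the other half.\<close>
  have *: "\<exists>A B. jordan_side (k \<union> c) A \<and> jordan_side (k \<union> c) B \<and> A \<inter> B = {} \<and> A \<union> B = - (k \<union> c) \<and> D' \<subseteq> B
      \<and> A \<subseteq> D - c \<and> A \<inter> S = {}"
    if k: "arc_between k a b" "k \<inter> c = {a, b}" "k \<union> l = c1 \<union> c2" "k \<inter> l = {a, b}" "l \<inter> c = {a, b}" for k l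
  proof -
    have "jordan_side (k \<union> c) (inside (k \<union> c))" by (rule jordan_of_arcs[OF k(1) c(1)]) (use k in auto)
    then obtain E E' where E: "jordan_side (k \<union> c) E" "jordan_side (k \<union> c) E'" "E \<inter> E' = {}" "E \<union> E' = - (k \<union> c)"
      using jordan_side_opposite by metis
    have D'k: "D' \<inter> (k \<union> c) = {}" using D'S k(3) by (auto simp: S_def)
    have sub: "D' \<subseteq> X" if "jordan_side (k \<union> c) X" "D' \<inter> X \<noteq> {}" for X
      using connected_subset_jordan_side[OF that(1) jordan_sideD(2)[OF D'(1)] D'k that(2)] .
    have "D' \<inter> E \<noteq> {} \<or> D' \<inter> E' \<noteq> {}" using E(4) D'k jordan_sideD(3)[OF D'(1)] by blast
    then obtain A B where AB: "jordan_side (k \<union> c) A" "jordan_side (k \<union> c) B" "A \<inter> B = {}" "A \<union> B = - (k \<union> c)" "D' \<subseteq> B"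
      using sub[OF E(1)] sub[OF E(2)] E by (metis Int_commute Un_commute)
    \<comment> \<open>Each point of \<open>l\<close> is a limit of points of \<open>D'\<close>, and
      the open set \<open>A\<close> is disjoint from \<open>D'\<close>.\<close>
    have "A \<inter> l = {}"
    proof (rule ccontr)
      assume "A \<inter> l \<noteq> {}"
      then obtain p where "p \<in> A" "p \<in> l" by blast
      then have "p \<in> closure D'" using D'cl k(3) by blast
      then have "A \<inter> D' \<noteq> {}"
        using open_Int_closure_eq_empty[OF jordan_sideD(1)[OF AB(1)], of D'] \<open>p \<in> A\<close> by blast
      then show False using AB by blast
    qed
    then have "A \<inter> S = {}" using AB(4) k(3) unfolding S_def by blast
    moreover have "A \<inter> D' = {}" using AB by blast
    ultimately have "A \<subseteq> D - c" using D'(3) unfolding S_def by blast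
    then show ?thesis using AB \<open>A \<inter> S = {}\<close> by blast
  qed
  obtain A1 B1 where A1: "jordan_side (c1 \<union> c) A1" "jordan_side (c1 \<union> c) B1" "A1 \<inter> B1 = {}" "A1 \<union> B1 = - (c1 \<union> c)"
    "D' \<subseteq> B1" "A1 \<subseteq> D - c" "A1 \<inter> S = {}"
    using *[of c1 c2] arcs dis by blast
  obtain A2 B2 where A2: "jordan_side (c2 \<union> c) A2" "jordan_side (c2 \<union> c) B2" "A2 \<inter> B2 = {}" "A2 \<union> B2 = - (c2 \<union> c)"
    "D' \<subseteq> B2" "A2 \<subseteq> D - c" "A2 \<inter> S = {}"
    using *[of c2 c1] arcs dis by blast
  have max: "X \<subseteq> A1" if "connected X" "X \<inter> S = {}" "X \<inter> A1 \<noteq> {}" for X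
    by (rule connected_subset_jordan_side[OF A1(1) that(1) _ that(3)]) (use that in \<open>auto simp: S_def\<close>)
  have max2: "X \<subseteq> A2" if "connected X" "X \<inter> S = {}" "X \<inter> A2 \<noteq> {}" for X
    by (rule connected_subset_jordan_side[OF A2(1) that(1) _ that(3)]) (use that in \<open>auto simp: S_def\<close>)
  \<comment> \<open>Overlapping sides would coincide by maximality, and equal frontiers would leave
    \<open>c1\<close> without inner points.\<close>
  have A12: "A1 \<inter> A2 = {}"
  proof (rule ccontr)
    assume "A1 \<inter> A2 \<noteq> {}"
    then have "A1 = A2" using max[of A2] max2[of A1] A1 A2 jordan_sideD(2) by (metis Int_commute subset_antisym)
    then have "c1 \<union> c = c2 \<union> c" using jordan_sideD(4) A1(1) A2(1) by metis
    then have "c1 - {a, b} = {}" using arcs(3) dis by blast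
    then show False using a1 by blast
  qed
  have cov: "x \<in> A1 \<union> A2" if x: "x \<in> D - c" for x
  proof (rule ccontr)
    assume nx: "x \<notin> A1 \<union> A2"
    have xS: "x \<notin> S" using x D'(3) unfolding S_def by blast
    define W where "W = connected_component_set (- S) x"
    have xW: "x \<in> W" using xS by (simp add: W_def)
    have Wcomp: "W \<in> components (- S)" using xS by (auto simp: W_def components_def)
    have W: "connected W" "open W" "W \<inter> S = {}"
      using Wcomp clS in_components_connected open_components in_components_subset by blast+
    have WA: "W \<inter> A1 = {}" "W \<inter> A2 = {}" using max[OF W(1,3)] max2[OF W(1,3)] xW nx by auto
    have "W \<subseteq> D" by (rule connected_subset_jordan_side[OF D W(1)]) (use W xW x in \<open>auto simp: S_def\<close>)
    then have WD': "W \<inter> D' = {}" using D'(2) by blast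
    \<comment> \<open>\<open>X\<close> is a known region on the side \<open>B\<close> that
      accumulates at \<open>p\<close>. The region \<open>W\<close> accumulates there too and avoids
      \<open>A\<close>, so near \<open>p\<close> it lies in \<open>B\<close> as well and is
      connected to \<open>X\<close>, contrary to disjointness.\<close>
    have key: False if J: "jordan_side (k \<union> c) A" "jordan_side (k \<union> c) B" "A \<union> B = - (k \<union> c)" "k \<subseteq> S"
      and X: "X \<subseteq> B" "X \<inter> S = {}" "p \<in> closure X" "W \<inter> X = {}" "W \<inter> A = {}"
      and p: "p \<in> k \<union> c" "p \<in> closure W" "p \<notin> l" "closed l" "S = k \<union> l \<union> c" for k A B X l p
    proof -
      obtain r where r: "r > 0" "ball p r \<subseteq> - l" using p by (metis ComplI open_Compl open_contains_ball)
      then have "ball p r \<inter> S \<subseteq> k \<union> c" using p(5) by blast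
      then obtain d where d: "0 < d" "\<And>x y D'. \<lbrakk>jordan_side (k \<union> c) D'; x \<in> ball p d \<inter> D'; y \<in> ball p d \<inter> D'\<rbrakk> \<Longrightarrow> connected_component (- S) x y"
        using jordan_side_local[OF J(1) p(1) r(1)] by metis
      obtain y where y: "y \<in> ball p d" "y \<in> W" using closure_meets_ball[OF p(2) d(1)] by blast
      obtain z where z: "z \<in> ball p d" "z \<in> X" using closure_meets_ball[OF X(3) d(1)] by blast
      have "y \<in> B" using y W(3) J(3,4) X(5) p(5) by blast
      then have "connected_component (- S) y z" using d(2)[OF J(2)] y z X(1) by blast
      then have "z \<in> W" using y(2) unfolding W_def by (simp add: connected_component_trans)
      then show False using z X(4) by blast
    qed
    have fr: "frontier W \<subseteq> {a, b}"
    proof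
      fix p assume "p \<in> frontier W"
      then have pW: "p \<in> closure W" "p \<in> S"
        using frontier_of_components_subset[OF Wcomp] frontier_subset_closed[OF clS]
        by (auto simp: frontier_def[of W])
      show "p \<in> {a, b}"
      proof (rule ccontr)
        assume pn: "p \<notin> {a, b}"
        have clA2: "c2 \<union> c \<subseteq> closure A2" using jordan_sideD(4)[OF A2(1)] by (auto simp: frontier_def)
        consider "p \<in> c1" "p \<notin> c2" | "p \<in> c2" "p \<notin> c1" | "p \<in> c" "p \<notin> c2"
          using pW(2) pn arcs(3) dis unfolding S_def by blast
        then show False
        proof cases
          case 1
          show False
            by (rule key[of c1 A1 B1 D' p c2])
              (use A1 D'S D'cl 1 WD' WA pW cl in \<open>auto simp: S_def\<close>)
        next
          case 2
          show False
            by (rule key[of c2 A2 B2 D' p c1])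
              (use A2 D'S D'cl 2 WD' WA pW cl in \<open>auto simp: S_def\<close>)
        next
          case 3
          \<comment> \<open>On the crosscut itself the two known regions are \<open>A1\<close> and
            \<open>A2\<close>; here \<open>A2\<close> takes the role that \<open>D'\<close> has in
            the other cases.\<close>
          have "A2 \<subseteq> B1" using A12 A1(4) A2(7) unfolding S_def by blast
          then show False
            using key[of c1 A1 B1 A2 p c2] A1(1,2,4) A2(7) clA2 3 WA pW(1) cl unfolding S_def by blast
        qed
      qed
    qed
    \<comment> \<open>Two points do not separate the plane, so a nonempty region with frontier in
      \<open>{a, b}\<close> would fill the rest and swallow the crosscut.\<close>
    have "connected (- {a, b})"
      by (rule path_connected_imp_connected, rule path_connected_complement_countable) auto
    moreover have "x \<notin> {a, b}" using xS a1(2,3) by (auto simp: S_def)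
    then have "- {a, b} \<inter> W \<noteq> {}" using xW by blast
    moreover have "- {a, b} \<inter> frontier W = {}" using fr by blast
    ultimately have "- {a, b} \<subseteq> W" using connected_Int_frontier[of "- {a, b}" W] by blast
    then show False using a3(7) W(3) unfolding S_def by blast
  qed
  show thesis using that[OF A1(1) A2(1) A12] cov A1(6) A2(6) by blast
qed

text \<open>Two accessibility paths from a common inner point connect \<open>p\<close> with
  \<open>q\<close>; an arc is extracted from their union.\<close>

lemma jordan_crosscut_exists:
  assumes D: "jordan_side J D" and "p \<in> J" "q \<in> J" "p \<noteq> q"
  obtains c where "arc_between c p q" "c - {p, q} \<subseteq> D"
proof -
  obtain z where z: "z \<in> D" using jordan_sideD(3)[OF D] by blast
  obtain h1 where h1: "path h1" "pathstart h1 = z" "pathfinish h1 = p" "path_image h1 \<subseteq> insert p D"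
    using jordan_accessible[OF D assms(2) z] by blast
  obtain h2 where h2: "path h2" "pathstart h2 = z" "pathfinish h2 = q" "path_image h2 \<subseteq> insert q D"
    using jordan_accessible[OF D assms(3) z] by blast
  define h where "h = reversepath h1 +++ h2"
  have h: "path h" "pathstart h = p" "pathfinish h = q" "path_image h \<subseteq> {p,q} \<union> D"
    using h1 h2 by (simp_all add: h_def path_image_join) blast
  obtain g where g: "arc g" "path_image g \<subseteq> path_image h" "pathstart g = p" "pathfinish g = q"
    by (rule path_contains_arc[OF h(1-3) assms(4)])
  show thesis
    by (rule that[of "path_image g"]) (use g h in \<open>auto simp: arc_between_def\<close>)
qed


section \<open>Paths, cycles and faces of plane graphs\<close>

text \<open>Determined only for adjacent vertices of a plane graph, where an edge is fixed by its
  ends; nothing is claimed elsewhere.\<close>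

definition edge :: "drawing \<Rightarrow> complex \<Rightarrow> complex \<Rightarrow> complex set" where
  "edge G u v = (THE e. e \<in> edges G \<and> e \<inter> verts G = {u, v})"

lemma plane_graph_edgeE:
  assumes "plane_graph G" "e \<in> edges G"
  obtains u v where "u \<noteq> v" "arc_between e u v" "e \<inter> verts G = {u, v}" "adj G u v"
proof -
  have "\<exists>u\<in>verts G. \<exists>v\<in>verts G. arc_between e u v \<and> e \<inter> verts G = {u, v}"
    using assms by (simp add: plane_graph_def)
  then obtain u v where e: "arc_between e u v" "e \<inter> verts G = {u, v}" by auto
  have "u \<noteq> v" using e(1) by (rule arc_betweenD(1))
  moreover from this have "adj G u v" using e(2) assms(2) by (auto simp: adj_def)
  ultimately show thesis using that e by simp
qed

lemma adj_sym: "adj G u v \<longleftrightarrow> adj G v u"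
  unfolding adj_def by (metis insert_commute)

lemma edge_sym: "edge G u v = edge G v u"
  unfolding edge_def by (simp add: insert_commute)

lemma adj_verts: "adj G u v \<Longrightarrow> u \<in> verts G \<and> v \<in> verts G \<and> u \<noteq> v"
  unfolding adj_def by blast

lemma plane_edge_unique:
  assumes "plane_graph G" "e \<in> edges G" "e' \<in> edges G" "e \<inter> verts G = e' \<inter> verts G"
  shows "e = e'"
proof -
  have "\<forall>e\<in>edges G. \<forall>e'\<in>edges G. e \<noteq> e' \<longrightarrow> e \<inter> verts G \<noteq> e' \<inter> verts G"
    using assms(1) by (simp add: plane_graph_def)
  then show ?thesis using assms(2-4) by auto
qed

lemma plane_edges_inter:
  assumes "plane_graph G" "e \<in> edges G" "e' \<in> edges G" "e \<noteq> e'"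
  shows "e \<inter> e' \<subseteq> verts G"
  using assms by (simp add: plane_graph_def)

lemma edge_eqI:
  assumes "plane_graph G" "e \<in> edges G" "e \<inter> verts G = {u, v}"
  shows "edge G u v = e"
  unfolding edge_def by (rule the_equality) (use assms plane_edge_unique in auto)

lemma edgeD:
  assumes "plane_graph G" "adj G u v"
  shows "edge G u v \<in> edges G" "edge G u v \<inter> verts G = {u, v}" "arc_between (edge G u v) u v"
proof -
  obtain e where e: "e \<in> edges G" "e \<inter> verts G = {u, v}" using assms unfolding adj_def by blast
  then have eq: "edge G u v = e" using edge_eqI assms by blast
  show "edge G u v \<in> edges G" "edge G u v \<inter> verts G = {u, v}" using eq e by auto
  obtain x y where xy: "arc_between e x y" "e \<inter> verts G = {x, y}" using plane_graph_edgeE[OF assms(1) e(1)] by metis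
  then have "(x = u \<and> y = v) \<or> (x = v \<and> y = u)" using e by (auto simp: doubleton_eq_iff)
  then show "arc_between (edge G u v) u v" using xy eq arc_between_sym by auto
qed

lemma edge_inter_edge:
  assumes "plane_graph G" "adj G u v" "adj G w x" "{u, v} \<noteq> {w, x}"
  shows "edge G u v \<inter> edge G w x = {u, v} \<inter> {w, x}"
proof -
  note e = edgeD[OF assms(1,2)] and e' = edgeD[OF assms(1,3)]
  have "edge G u v \<noteq> edge G w x" using e(2) e'(2) assms(4) by metis
  then have "edge G u v \<inter> edge G w x \<subseteq> verts G" using plane_edges_inter assms(1) e(1) e'(1) by blast
  then have "edge G u v \<inter> edge G w x = (edge G u v \<inter> verts G) \<inter> (edge G w x \<inter> verts G)" by blast
  then show ?thesis by (simp only: e(2) e'(2))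
qed

text \<open>A one-vertex list yields the empty set, not the vertex; therefore arcs are obtained only
  from lists of length at least 2.\<close>

fun path_curve :: "drawing \<Rightarrow> complex list \<Rightarrow> complex set" where
  "path_curve G (u # v # p) = edge G u v \<union> path_curve G (v # p)"
| "path_curve G _ = {}"

lemma path_curve_append: "path_curve G (p @ v # q) = path_curve G (p @ [v]) \<union> path_curve G (v # q)"
proof (induction p)
  case (Cons u p) then show ?case by (cases p) auto
qed simp

lemma path_curve_rev: "path_curve G (rev p) = path_curve G p"
proof (induction p rule: induct_list012)
  case (3 u v p)
  have "path_curve G (rev (u # v # p)) = path_curve G (rev p @ v # [u])" by simp
  also have "\<dots> = path_curve G (rev p @ [v]) \<union> path_curve G (v # [u])" by (rule path_curve_append)
  finally show ?case using 3 by (auto simp: edge_sym)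
qed auto

lemma path_curve_conv_nth: "path_curve G p = (\<Union>i\<in>{i. Suc i < length p}. edge G (p ! i) (p ! Suc i))"
proof (induction p rule: induct_list012)
  case (3 u v p)
  have *: "{i. Suc i < length (u # v # p)} = insert 0 (Suc ` {i. Suc i < length (v # p)})"
  proof (rule set_eqI)
    fix i show "i \<in> {i. Suc i < length (u # v # p)} \<longleftrightarrow> i \<in> insert 0 (Suc ` {i. Suc i < length (v # p)})"
      by (cases i) auto
  qed
  show ?case unfolding * UN_insert image_image
    by (simp only: path_curve.simps(1) 3(2) nth_Cons_0 nth_Cons_Suc)
qed auto

lemma path_curve_verts:
  assumes "plane_graph G" "successively (adj G) p"
  shows "path_curve G p \<inter> verts G \<subseteq> set p"
  using assms(2)
proof (induction p rule: induct_list012)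
  case (3 u v p)
  then show ?case using edgeD(2)[OF assms(1), of u v] by auto
qed auto

lemma edge_inter_path:
  assumes "plane_graph G" "successively (adj G) p" "adj G u v" "u \<notin> set p"
  shows "edge G u v \<inter> path_curve G p \<subseteq> {u, v} \<inter> set p"
  using assms(2,4)
proof (induction p rule: induct_list012)
  case (3 x y p)
  then have "edge G u v \<inter> edge G x y = {u, v} \<inter> {x, y}"
    by (intro edge_inter_edge) (use assms in auto)
  then have "edge G u v \<inter> edge G x y \<subseteq> {u, v} \<inter> set (x # y # p)" by auto
  moreover have "edge G u v \<inter> path_curve G (y # p) \<subseteq> {u, v} \<inter> set (y # p)" using 3 by simp
  then have "edge G u v \<inter> path_curve G (y # p) \<subseteq> {u, v} \<inter> set (x # y # p)" by auto
  ultimately show ?case unfolding path_curve.simps Int_Un_distrib by (rule Un_least)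
qed auto

lemma path_inter_path:
  assumes "plane_graph G" "successively (adj G) p" "successively (adj G) q" "set p \<inter> set q = {}"
  shows "path_curve G p \<inter> path_curve G q = {}"
  using assms(3,4)
proof (induction q rule: induct_list012)
  case (3 x y q)
  have "edge G x y \<inter> path_curve G p \<subseteq> {x, y} \<inter> set p"
    by (rule edge_inter_path) (use 3 assms in auto)
  moreover have "path_curve G p \<inter> path_curve G (y # q) = {}" using 3 by simp
  ultimately show ?case using 3(4) by auto
qed auto

lemma path_curve_arc:
  assumes "plane_graph G" "successively (adj G) p" "distinct p" "2 \<le> length p"
  shows "arc_between (path_curve G p) (hd p) (last p)"
  using assms(2-4)
proof (induction p rule: induct_list012)
  case (3 u v p)
  note e = edgeD(3)[OF assms(1), of u v]
  show ?case
  proof (cases p)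
    case Nil
    then show ?thesis using e 3 by auto
  next
    case (Cons w q)
    have "edge G u v \<inter> path_curve G (v # p) \<subseteq> {u, v} \<inter> set (v # p)"
      by (rule edge_inter_path) (use 3 assms in auto)
    then have "arc_between (edge G u v \<union> path_curve G (v # p)) u (last (v # p))"
      by (intro arc_between_join[of _ u v]) (use 3 e Cons in auto)
    then show ?thesis by simp
  qed
qed auto

text \<open>Repeating the head at the end turns the cyclic condition into a linear one, so that
  results on paths and their curves apply to cycles.\<close>

lemma is_cycle_iff:
  "is_cycle G C \<longleftrightarrow> 3 \<le> length C \<and> distinct C \<and> successively (adj G) (C @ [hd C])"
proof (cases "C = []")
  case False
  have nth: "(C @ [hd C]) ! Suc i = C ! (Suc i mod length C)" if "i < length C" for i
    using that False by (cases "Suc i = length C") (auto simp: nth_append hd_conv_nth)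
  have "successively (adj G) (C @ [hd C]) \<longleftrightarrow> (\<forall>i<length C. adj G (C ! i) (C ! (Suc i mod length C)))"
    unfolding successively_conv_nth using nth by (auto simp: nth_append simp del: append.simps)
  moreover have "set C \<subseteq> verts G" if "\<forall>i<length C. adj G (C ! i) (C ! (Suc i mod length C))"
    using that adj_verts by (metis in_set_conv_nth subsetI)
  ultimately show ?thesis unfolding is_cycle_def by blast
qed (auto simp: is_cycle_def)

lemma cycle_edges_eq:
  assumes "plane_graph G" "is_cycle G C"
  shows "cycle_edges G C = {edge G (C ! i) (C ! (Suc i mod length C)) | i. i < length C}"
proof -
  have adj: "adj G (C ! i) (C ! (Suc i mod length C))" if "i < length C" for i
    using assms(2) that by (simp add: is_cycle_def)
  show ?thesis
  proof (intro set_eqI iffI)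
    fix e assume "e \<in> cycle_edges G C"
    then obtain i where "e \<in> edges G" "i < length C" "e \<inter> verts G = {C ! i, C ! (Suc i mod length C)}"
      by (auto simp: cycle_edges_def)
    then show "e \<in> {edge G (C ! i) (C ! (Suc i mod length C)) | i. i < length C}"
      using edge_eqI[OF assms(1)] by blast
  next
    fix e assume "e \<in> {edge G (C ! i) (C ! (Suc i mod length C)) | i. i < length C}"
    then obtain i where i: "i < length C" "e = edge G (C ! i) (C ! (Suc i mod length C))" by blast
    show "e \<in> cycle_edges G C"
      unfolding cycle_edges_def using edgeD(1,2)[OF assms(1) adj[OF i(1)]] i by blast
  qed
qed

lemma cycle_curve_eq:
  assumes "plane_graph G" "is_cycle G C"
  shows "cycle_curve G C = path_curve G (C @ [hd C])"
proof -
  have ne: "C \<noteq> []" using assms(2) by (auto simp: is_cycle_def)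
  have nth: "(C @ [hd C]) ! Suc i = C ! (Suc i mod length C)" "(C @ [hd C]) ! i = C ! i" if "i < length C" for i
    using that ne by (cases "Suc i = length C"; auto simp: nth_append hd_conv_nth)+
  have "path_curve G (C @ [hd C]) = (\<Union>i\<in>{i. i < length C}. edge G ((C @ [hd C]) ! i) ((C @ [hd C]) ! Suc i))"
    unfolding path_curve_conv_nth by simp
  also have "\<dots> = (\<Union>i\<in>{i. i < length C}. edge G (C ! i) (C ! (Suc i mod length C)))"
    using nth by auto
  finally show ?thesis unfolding cycle_curve_def cycle_edges_eq[OF assms] by blast
qed

lemma is_cycle3: "is_cycle G [a, b, c] \<longleftrightarrow> adj G a b \<and> adj G b c \<and> adj G c a"
  unfolding is_cycle_iff using adj_verts[of G] by auto

lemma is_cycle4: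
  "is_cycle G [a, b, c, d] \<longleftrightarrow> a \<noteq> c \<and> b \<noteq> d \<and> adj G a b \<and> adj G b c \<and> adj G c d \<and> adj G d a"
  unfolding is_cycle_iff using adj_verts[of G] by auto

lemma setcompr_image_lessThan: "{f i | i. i < n} = f ` {..<n::nat}"
  by auto

lemma cycle_edges3:
  assumes "plane_graph G" "is_cycle G [a, b, c]"
  shows "cycle_edges G [a, b, c] = {edge G a b, edge G b c, edge G c a}"
proof -
  have l: "length [a, b, c] = 3" by simp
  have "cycle_edges G [a, b, c] = (\<lambda>i. edge G ([a, b, c] ! i) ([a, b, c] ! (Suc i mod 3))) ` {..<3}"
    unfolding cycle_edges_eq[OF assms] setcompr_image_lessThan l ..
  also have "{..<3} = {0, 1, 2::nat}" by auto
  finally show ?thesis by (simp only: image_insert image_empty) simp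
qed

lemma cycle_edges4:
  assumes "plane_graph G" "is_cycle G [a, b, c, d]"
  shows "cycle_edges G [a, b, c, d] = {edge G a b, edge G b c, edge G c d, edge G d a}"
proof -
  have l: "length [a, b, c, d] = 4" by simp
  have "cycle_edges G [a, b, c, d] = (\<lambda>i. edge G ([a, b, c, d] ! i) ([a, b, c, d] ! (Suc i mod 4))) ` {..<4}"
    unfolding cycle_edges_eq[OF assms] setcompr_image_lessThan l ..
  also have "{..<4} = {0, 1, 2, 3::nat}" by auto
  finally show ?thesis by (simp only: image_insert image_empty) simp
qed

text \<open>The quadrangle is cut at an opposite pair into two arcs, the form in which crosscuts
  from \<open>a\<close> to \<open>c\<close> need it.\<close>

lemma cycle4_arcs:
  assumes "plane_graph G" "is_cycle G [a, b, c, d]"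
  defines "J1 \<equiv> edge G a b \<union> edge G b c" and "J2 \<equiv> edge G c d \<union> edge G d a"
  shows "cycle_curve G [a, b, c, d] = J1 \<union> J2" "arc_between J1 a c" "arc_between J2 a c" "J1 \<inter> J2 = {a, c}"
    "jordan_side (cycle_curve G [a, b, c, d]) (inside (cycle_curve G [a, b, c, d]))"
proof -
  have A: "adj G a b" "adj G b c" "adj G c d" "adj G d a" "a \<noteq> c" "b \<noteq> d" using assms(2) by (auto simp: is_cycle4)
  then have ne: "a \<noteq> b" "b \<noteq> c" "c \<noteq> d" "d \<noteq> a" using adj_verts by blast+
  show 1: "cycle_curve G [a, b, c, d] = J1 \<union> J2"
    unfolding cycle_curve_def cycle_edges4[OF assms(1,2)] J1_def J2_def by auto
  show 2: "arc_between J1 a c" using path_curve_arc[OF assms(1), of "[a, b, c]"] A ne by (simp add: J1_def)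
  show 3: "arc_between J2 a c"
    using arc_between_sym[OF path_curve_arc[OF assms(1), of "[c, d, a]"]] A ne by (simp add: J2_def)
  note i = edge_inter_edge[OF assms(1)]
  show 4: "J1 \<inter> J2 = {a, c}"
    unfolding J1_def J2_def Int_Un_distrib Int_Un_distrib2
    using i[of a b c d] i[of a b d a] i[of b c c d] i[of b c d a] A ne by (auto simp: doubleton_eq_iff)
  show "jordan_side (cycle_curve G [a, b, c, d]) (inside (cycle_curve G [a, b, c, d]))"
    unfolding 1 by (rule jordan_of_arcs[OF 2 3]) (use 4 in auto)
qed

lemma cycle3_arcs:
  assumes "plane_graph G" "is_cycle G [a, b, c]"
  shows "cycle_curve G [a, b, c] = edge G a b \<union> edge G b c \<union> edge G c a"
    "jordan_side (cycle_curve G [a, b, c]) (inside (cycle_curve G [a, b, c]))"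
proof -
  have A: "adj G a b" "adj G b c" "adj G c a" using assms(2) by (auto simp: is_cycle3)
  then have ne: "a \<noteq> b" "b \<noteq> c" "c \<noteq> a" using adj_verts by blast+
  show 1: "cycle_curve G [a, b, c] = edge G a b \<union> edge G b c \<union> edge G c a"
    unfolding cycle_curve_def cycle_edges3[OF assms(1,2)] by auto
  have 2: "arc_between (edge G a b \<union> edge G b c) a c" using path_curve_arc[OF assms(1), of "[a, b, c]"] A ne by simp
  have 3: "arc_between (edge G c a) a c" using arc_between_sym[OF edgeD(3)[OF assms(1) A(3)]] .
  note i = edge_inter_edge[OF assms(1)]
  show "jordan_side (cycle_curve G [a, b, c]) (inside (cycle_curve G [a, b, c]))"
    unfolding 1 by (rule jordan_of_arcs[OF 2 3]) (use i[of a b c a] i[of b c c a] A ne in \<open>auto simp: doubleton_eq_iff\<close>)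
qed

section \<open>Faces as components and as sides of Jordan curves\<close>

lemma faces_basic:
  assumes "plane_graph G" "F \<in> faces G"
  shows "open F" "connected F" "F \<noteq> {}" "F \<inter> (verts G \<union> \<Union>(edges G)) = {}"
proof -
  have "compact e" if "e \<in> edges G" for e using plane_graph_edgeE[OF assms(1) that] arc_betweenD(4) by metis
  moreover have "finite (verts G)" "finite (edges G)" using assms(1) by (simp_all add: plane_graph_def)
  ultimately have "compact (verts G \<union> \<Union>(edges G))"
    by (intro compact_Un compact_Union) (simp_all add: finite_imp_compact)
  then have "open (- (verts G \<union> \<Union>(edges G)))" by (intro open_Compl compact_imp_closed)
  then show "open F" using assms(2) open_components unfolding faces_def by blast
  show "connected F" "F \<noteq> {}" "F \<inter> (verts G \<union> \<Union>(edges G)) = {}"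
    using assms(2) in_components_connected in_components_nonempty in_components_subset unfolding faces_def by blast+
qed

lemma faces_Union: "\<Union>(faces G) = - (verts G \<union> \<Union>(edges G))"
  unfolding faces_def by (rule Union_components)

lemma faces_disjoint: "F \<in> faces G \<Longrightarrow> F' \<in> faces G \<Longrightarrow> F \<noteq> F' \<Longrightarrow> F \<inter> F' = {}"
  unfolding faces_def by (metis components_nonoverlap)

text \<open>Any partition of the complement into nonempty open connected sets is its family of
  components. This yields the faces after an insertion or a pasting without computing
  components.\<close>

lemma faces_eqI:
  assumes "\<Union>A = - (verts G \<union> \<Union>(edges G))" "\<And>X Y. X \<in> A \<Longrightarrow> Y \<in> A \<Longrightarrow> X \<noteq> Y \<Longrightarrow> X \<inter> Y = {}"
    "\<And>X. X \<in> A \<Longrightarrow> open X \<and> connected X \<and> X \<noteq> {}"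
  shows "faces G = A"
  unfolding faces_def by (rule components_open_unique) (use assms in \<open>auto simp: pairwise_def disjnt_def\<close>)

lemma triangular_faceE:
  assumes "triangular_face G F"
  obtains a b c where "face_bounded_by G F [a, b, c]" "is_cycle G [a, b, c]"
proof -
  obtain T where T: "length T = 3" "face_bounded_by G F T" using assms unfolding triangular_face_def by blast
  obtain a b c where abc: "T = [a, b, c]" using T(1) by (auto simp: length_Suc_conv numeral_3_eq_3)
  show thesis using that[of a b c] T(2) unfolding abc face_bounded_by_def by blast
qed

lemma triangular_face_side:
  assumes "plane_graph G" "face_bounded_by G F [a, b, c]"
  shows "jordan_side (cycle_curve G [a, b, c]) F"
proof -
  have F: "F \<in> faces G" using assms(2) by (simp add: face_bounded_by_def)
  show ?thesis
    using assms(2) unfolding face_bounded_by_def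
    by (intro jordan_sideI_frontier[OF cycle3_arcs(2)[OF assms(1)] faces_basic(2,1,3)[OF assms(1) F]]) auto
qed

lemma quadrangular_face_side:
  assumes "plane_graph G" "face_bounded_by G F [a, b, c, d]"
  shows "jordan_side (cycle_curve G [a, b, c, d]) F"
proof -
  have F: "F \<in> faces G" using assms(2) by (simp add: face_bounded_by_def)
  show ?thesis
    using assms(2) unfolding face_bounded_by_def
    by (intro jordan_sideI_frontier[OF cycle4_arcs(5)[OF assms(1)] faces_basic(2,1,3)[OF assms(1) F]]) auto
qed

lemma edge_subset_cycle_curve:
  assumes "plane_graph G" "e \<in> edges G" "p \<in> e" "p \<notin> verts G" "p \<in> cycle_curve G C"
  shows "e \<in> cycle_edges G C"
proof -
  obtain e' where e': "e' \<in> cycle_edges G C" "p \<in> e'" using assms(5) by (auto simp: cycle_curve_def)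
  then have "e' \<in> edges G" by (simp add: cycle_edges_def)
  then have "e' = e" using plane_edges_inter[OF assms(1) assms(2)] assms(3,4) e'(2) by blast
  then show ?thesis using e' by simp
qed

lemma edge_interior_point:
  assumes "plane_graph G" "e \<in> edges G"
  obtains p where "p \<in> e" "p \<notin> verts G"
proof -
  obtain u v where "arc_between e u v" "e \<inter> verts G = {u, v}" using plane_graph_edgeE[OF assms] by metis
  then show thesis using arc_betweenD(7)[of e u v] that by blast
qed

lemma edge_subset_cycle_curve_iff:
  assumes "plane_graph G" "e \<in> edges G"
  shows "e \<subseteq> cycle_curve G C \<longleftrightarrow> e \<in> cycle_edges G C"
  using edge_interior_point[OF assms] edge_subset_cycle_curve[OF assms] unfolding cycle_curve_def by (metis Union_upper subsetD)


section \<open>Sperner's argument in a quadrangle\<close>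

text \<open>Around a point \<open>p\<close> of \<open>e\<close> that is no vertex the drawing
  coincides with the Jordan curve bounding \<open>F\<close>, so only \<open>F\<close> and one face
  across the curve come near \<open>p\<close>. Hypothesis \<open>fr\<close> makes frontiers unions
  of edges: a face approaching \<open>p\<close> borders on the whole edge.\<close>

lemma edge_two_faces:
  assumes G: "plane_graph G" and fr: "\<And>X. X \<in> faces G \<Longrightarrow> \<exists>T. frontier X = cycle_curve G T"
    and F: "F \<in> faces G" "jordan_side (cycle_curve G T) F" and e: "e \<in> cycle_edges G T"
  obtains F' where "F' \<in> faces G" "F' \<noteq> F" "{X \<in> faces G. e \<subseteq> frontier X} = {F, F'}"
proof -
  define S where "S = verts G \<union> \<Union>(edges G)"
  let ?J = "cycle_curve G T"
  have eG: "e \<in> edges G" and eJ: "e \<subseteq> ?J" using e by (auto simp: cycle_edges_def cycle_curve_def)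
  have JS: "?J \<subseteq> S" by (auto simp: S_def cycle_curve_def cycle_edges_def)
  obtain p where p: "p \<in> e" "p \<notin> verts G" using edge_interior_point[OF G eG] by blast
  have cpt: "compact x" if "x \<in> edges G" for x using plane_graph_edgeE[OF G that] arc_betweenD(4) by metis
  have fin: "finite (verts G)" "finite (edges G)" using G by (simp_all add: plane_graph_def)
  have "closed (verts G \<union> \<Union>(edges G - {e}))"
    using fin cpt by (intro closed_Un closed_Union) (simp_all add: finite_imp_closed compact_imp_closed)
  moreover have "p \<notin> verts G \<union> \<Union>(edges G - {e})" using plane_edges_inter[OF G eG] p by blast
  ultimately obtain r where r: "r > 0" "ball p r \<subseteq> - (verts G \<union> \<Union>(edges G - {e}))"
    by (meson ComplI open_Compl open_contains_ball)
  have "ball p r \<inter> S \<subseteq> ?J" using r(2) eJ unfolding S_def by blast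
  then obtain d where d: "0 < d"
    "\<And>x y D'. \<lbrakk>jordan_side ?J D'; x \<in> ball p d \<inter> D'; y \<in> ball p d \<inter> D'\<rbrakk> \<Longrightarrow> connected_component (- S) x y"
    using jordan_side_local[OF F(2) _ r(1)] eJ p(1) by blast
  obtain D' where D': "jordan_side ?J D'" "F \<inter> D' = {}" "F \<union> D' = - ?J" using jordan_side_opposite[OF F(2)] by blast
  have pD': "p \<in> closure D'" using jordan_sideD(4)[OF D'(1)] eJ p(1) by (auto simp: frontier_def)
  obtain z where z: "z \<in> ball p d" "z \<in> D'" using closure_meets_ball[OF pD' d(1)] by blast
  \<comment> \<open>The choice of \<open>z\<close> is immaterial: all points across the curve and
    close to \<open>p\<close> are connected to it without touching the drawing.\<close>
  define F' where "F' = connected_component_set (- S) z"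
  have "connected_component (- S) z z" using d(2)[OF D'(1)] z by blast
  then have zS: "z \<in> - S" using connected_component_in by metis
  then have zF': "z \<in> F'" by (simp add: F'_def)
  have F': "F' \<in> faces G" using zS unfolding F'_def faces_def components_def S_def by blast
  have ne: "F' \<noteq> F" using zF' z D'(2) by blast
  have near: "y \<in> F'" if "y \<in> ball p d" "y \<in> D'" for y
    using d(2)[OF D'(1), of z y] that z unfolding F'_def by simp
  have sub: "e \<subseteq> frontier X" if X: "X \<in> faces G" and "p \<in> closure X" for X
  proof -
    obtain T' where T': "frontier X = cycle_curve G T'" using fr[OF X] by blast
    have "p \<notin> X" using faces_basic(4)[OF G X] p(1) eG by blast
    then have "p \<in> cycle_curve G T'" using that T' faces_basic(1)[OF G X] by (auto simp: frontier_def interior_open)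
    then have "e \<in> cycle_edges G T'" by (rule edge_subset_cycle_curve[OF G eG p])
    then show ?thesis unfolding T' cycle_curve_def by blast
  qed
  have "p \<in> closure F'"
    unfolding closure_approachable
  proof (intro allI impI)
    fix x :: real assume "0 < x"
    then have "0 < min x d" using d(1) by simp
    then obtain y where "y \<in> ball p (min x d)" "y \<in> D'" using closure_meets_ball[OF pD'] by blast
    then show "\<exists>y\<in>F'. dist y p < x" using near[of y] by (auto simp: dist_commute)
  qed
  then have eF': "e \<subseteq> frontier F'" using sub F' by blast
  have eF: "e \<subseteq> frontier F" using eJ jordan_sideD(4)[OF F(2)] by simp
  have "X = F'" if X: "X \<in> faces G" "e \<subseteq> frontier X" "X \<noteq> F" for X
  proof -
    have "p \<in> closure X" using X(2) p(1) by (auto simp: frontier_def)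
    then obtain y where y: "y \<in> ball p d" "y \<in> X" using closure_meets_ball d(1) by blast
    have "y \<notin> F" using faces_disjoint[OF X(1) F(1) X(3)] y by blast
    moreover have "y \<notin> ?J" using faces_basic(4)[OF G X(1)] y(2) JS unfolding S_def by blast
    ultimately have "y \<in> F'" using near y(1) D'(3) by blast
    then show ?thesis using faces_disjoint[OF X(1) F'] y(2) by blast
  qed
  then have "{X \<in> faces G. e \<subseteq> frontier X} = {F, F'}" using eF eF' F(1) F' by blast
  then show thesis using that F' ne by blast
qed

lemma rtranclp_distinct_path:
  assumes "(\<lambda>x y. R x y \<and> Q x \<and> Q y)\<^sup>*\<^sup>* u v" "Q u"
  obtains p where "p \<noteq> []" "distinct p" "hd p = u" "last p = v" "successively R p" "\<forall>x\<in>set p. Q x"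
proof -
  have "\<exists>p. p \<noteq> [] \<and> distinct p \<and> hd p = u \<and> last p = v \<and> successively R p \<and> (\<forall>x\<in>set p. Q x)"
    using assms(1)
  proof (induction rule: rtranclp_induct)
    case base
    show ?case by (rule exI[of _ "[u]"]) (use assms(2) in auto)
  next
    case (step y z)
    then obtain p where p: "p \<noteq> []" "distinct p" "hd p = u" "last p = y" "successively R p" "\<forall>x\<in>set p. Q x" by blast
    show ?case
    proof (cases "z \<in> set p")
      case True
      then obtain a b where ab: "p = a @ z # b" by (meson split_list)
      show ?thesis
        by (rule exI[of _ "a @ [z]"]) (use p ab in \<open>auto simp: successively_append_iff hd_append split: if_splits\<close>)
    next
      case False
      show ?thesis
        by (rule exI[of _ "p @ [z]"]) (use p False step(2) in \<open>auto simp: successively_append_iff\<close>)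
    qed
  qed
  then show thesis using that by blast
qed

lemma smpg_atD:
  assumes "smpg_at F0 G [v1, v2, v3, v4]"
  shows "plane_graph G" "F0 \<in> faces G" "is_cycle G [v1, v2, v3, v4]" "jordan_side (cycle_curve G [v1, v2, v3, v4]) F0"
    "\<And>X. X \<in> faces G \<Longrightarrow> \<exists>T. frontier X = cycle_curve G T" "frontier F0 = cycle_curve G [v1, v2, v3, v4]"
    "adj G v1 v2" "adj G v2 v3" "adj G v3 v4" "adj G v4 v1" "v1 \<noteq> v3" "v2 \<noteq> v4"
    "distinct [v1, v2, v3, v4]" "set [v1, v2, v3, v4] \<subseteq> verts G"
proof -
  show G: "plane_graph G" and F: "F0 \<in> faces G" and c: "is_cycle G [v1, v2, v3, v4]"
    and f: "frontier F0 = cycle_curve G [v1, v2, v3, v4]"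
    using assms by (auto simp: smpg_at_def face_bounded_by_def)
  show "jordan_side (cycle_curve G [v1, v2, v3, v4]) F0"
    by (rule quadrangular_face_side[OF G]) (use assms in \<open>simp add: smpg_at_def\<close>)
  show "\<exists>T. frontier X = cycle_curve G T" if "X \<in> faces G" for X
    using that assms unfolding smpg_at_def triangular_face_def face_bounded_by_def by metis
  show "adj G v1 v2" "adj G v2 v3" "adj G v3 v4" "adj G v4 v1" "v1 \<noteq> v3" "v2 \<noteq> v4" using c by (auto simp: is_cycle4)
  show "distinct [v1, v2, v3, v4]" "set [v1, v2, v3, v4] \<subseteq> verts G" using c by (auto simp: is_cycle_def)
qed

text \<open>A triangular face is a side of one of the finitely many triangles on the vertex set. The
  double count in Sperner's argument needs this finiteness.\<close>

lemma finite_triangular_faces: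
  assumes "plane_graph G" "\<And>F. F \<in> A \<Longrightarrow> triangular_face G F"
  shows "finite A"
proof -
  let ?T = "{T. set T \<subseteq> verts G \<and> length T = 3}"
  have "A \<subseteq> (\<lambda>T. inside (cycle_curve G T)) ` ?T \<union> (\<lambda>T. outside (cycle_curve G T)) ` ?T"
  proof
    fix F assume "F \<in> A"
    then obtain a b c where F: "face_bounded_by G F [a, b, c]" "is_cycle G [a, b, c]"
      using triangular_faceE assms(2) by metis
    have "F = inside (cycle_curve G [a, b, c]) \<or> F = outside (cycle_curve G [a, b, c])"
      using triangular_face_side[OF assms(1) F(1)] unfolding jordan_side_def by blast
    moreover have "[a, b, c] \<in> ?T" using F(2) by (simp add: is_cycle_def)
    ultimately show "F \<in> (\<lambda>T. inside (cycle_curve G T)) ` ?T \<union> (\<lambda>T. outside (cycle_curve G T)) ` ?T" by blast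
  qed
  moreover have "finite ?T" using assms(1) by (intro finite_lists_length_eq) (simp add: plane_graph_def)
  ultimately show ?thesis using finite_subset by blast
qed

lemma card_Int_triple:
  "A \<noteq> B \<Longrightarrow> B \<noteq> C \<Longrightarrow> C \<noteq> A \<Longrightarrow> card ({A, B, C} \<inter> E) = of_bool (A \<in> E) + of_bool (B \<in> E) + of_bool (C \<in> E)"
  by (auto simp: Int_insert_left)

text \<open>
  Sperner's argument: if neither path exists, mark the \<open>P\<close>-vertices reachable from \<open>v1\<close> and the
  other vertices reachable from \<open>v2\<close>. Every triangle has an even number of edges joining the two
  kinds of marked vertices, while exactly one edge of the outer cycle is of this kind.
\<close>
lemma quadrangle_path_or_dual_path:
  assumes "smpg_at F0 G [v1, v2, v3, v4]" "P v1" "P v3" "\<not> P v2" "\<not> P v4"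
  obtains p where "p \<noteq> []" "distinct p" "hd p = v1" "last p = v3" "successively (adj G) p" "\<forall>x\<in>set p. P x"
  | p where "p \<noteq> []" "distinct p" "hd p = v2" "last p = v4" "successively (adj G) p" "\<forall>x\<in>set p. \<not> P x"
proof -
  note sm = smpg_atD[OF assms(1)]
  note G = sm(1)
  define a where "a v \<longleftrightarrow> (\<lambda>x y. adj G x y \<and> P x \<and> P y)\<^sup>*\<^sup>* v1 v" for v
  define b where "b v \<longleftrightarrow> (\<lambda>x y. adj G x y \<and> \<not> P x \<and> \<not> P y)\<^sup>*\<^sup>* v2 v" for v
  have "a v3 \<or> b v4"
  proof (rule ccontr)
    assume no: "\<not> (a v3 \<or> b v4)"
    have aP: "P v" if "a v" for v using that assms(2) unfolding a_def by (induction rule: rtranclp_induct) auto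
    have bP: "\<not> P v" if "b v" for v using that assms(4) unfolding b_def by (induction rule: rtranclp_induct) auto
    have a_step: "a y" if "a x" "adj G x y" "P y" for x y
      using that aP[OF that(1)] unfolding a_def by (auto intro: rtranclp.rtrancl_into_rtrancl)
    have b_step: "b y" if "b x" "adj G x y" "\<not> P y" for x y
      using that bP[OF that(1)] unfolding b_def by (auto intro: rtranclp.rtrancl_into_rtrancl)
    have a1: "a v1" and b2: "b v2" by (simp_all add: a_def b_def)
    define m where "m x y \<longleftrightarrow> a x \<and> b y \<or> a y \<and> b x" for x y
    define E where "E = {e \<in> edges G. \<exists>x y. e \<inter> verts G = {x, y} \<and> m x y}"
    have inE: "edge G x y \<in> E \<longleftrightarrow> m x y" if "adj G x y" for x y
      using edgeD(1,2)[OF G that] by (auto simp: E_def doubleton_eq_iff m_def)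
    have finE: "finite E" using G by (simp add: E_def plane_graph_def)
    define Tri where "Tri = faces G - {F0}"
    have tri: "triangular_face G F" if "F \<in> Tri" for F using that assms(1) by (auto simp: Tri_def smpg_at_def)
    have finT: "finite Tri" using finite_triangular_faces[OF G] tri by blast
    have even_face: "even (card {e \<in> E. e \<subseteq> frontier F})" if F: "F \<in> Tri" for F
    proof -
      obtain x y z where xyz: "face_bounded_by G F [x, y, z]" "is_cycle G [x, y, z]"
        using triangular_faceE[OF tri[OF F]] by blast
      then have adj: "adj G x y" "adj G y z" "adj G z x" by (simp_all add: is_cycle3)
      have "frontier F = cycle_curve G [x, y, z]" using xyz(1) by (simp add: face_bounded_by_def)
      then have "{e \<in> E. e \<subseteq> frontier F} = {edge G x y, edge G y z, edge G z x} \<inter> E"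
        using edge_subset_cycle_curve_iff[OF G, of _ "[x, y, z]"] cycle_edges3[OF G xyz(2)]
        by (auto simp: E_def)
      moreover have "edge G x y \<noteq> edge G y z" "edge G y z \<noteq> edge G z x" "edge G z x \<noteq> edge G x y"
        using edgeD(2)[OF G adj(1)] edgeD(2)[OF G adj(2)] edgeD(2)[OF G adj(3)] adj adj_verts[of G]
        by (metis doubleton_eq_iff)+
      ultimately have "card {e \<in> E. e \<subseteq> frontier F} = of_bool (m x y) + of_bool (m y z) + of_bool (m z x)"
        by (simp add: card_Int_triple inE adj)
      moreover have "even (of_bool (m x y) + of_bool (m y z) + of_bool (m z x) :: nat)"
      proof -
        have st: "(a u \<and> P v \<longrightarrow> a v) \<and> (b u \<and> \<not> P v \<longrightarrow> b v) \<and> (a v \<and> P u \<longrightarrow> a u) \<and> (b v \<and> \<not> P u \<longrightarrow> b u)"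
          if "adj G u v" for u v
          using that a_step[of u v] a_step[of v u] b_step[of u v] b_step[of v u] adj_sym[of G u v] by blast
        \<comment> \<open>The equivalence says that an even number of the three edges is counted. If
          \<open>x\<close> and \<open>y\<close> carry marks of different kinds, \<open>z\<close> is
          adjacent to both and acquires one of the marks, according to \<open>P z\<close>.\<close>
        have "m x y \<longleftrightarrow> (m y z \<longleftrightarrow> \<not> m z x)"
          using st[OF adj(1)] st[OF adj(2)] st[OF adj(3)] aP[of x] aP[of y] aP[of z] bP[of x] bP[of y] bP[of z]
          unfolding m_def by argo
        then show ?thesis by auto
      qed
      ultimately show ?thesis by metis
    qed
    define e12 where "e12 = edge G v1 v2"
    have e12: "e12 \<in> E" unfolding e12_def using inE[OF sm(7)] a1 b2 by (simp add: m_def)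
    have ce: "cycle_edges G [v1, v2, v3, v4] = {e12, edge G v2 v3, edge G v3 v4, edge G v4 v1}"
      unfolding e12_def by (rule cycle_edges4[OF G sm(3)])
    have "\<not> m v2 v3" "\<not> m v3 v4" "\<not> m v4 v1" using no aP bP assms(2-5) by (auto simp: m_def)
    then have only: "e = e12" if "e \<in> E" "e \<in> cycle_edges G [v1, v2, v3, v4]" for e
      using that inE sm(8-10) unfolding ce by auto
    define dg where "dg e = card {F \<in> Tri. e \<subseteq> frontier F}" for e
    \<comment> \<open>One side of an outer edge is the exceptional face \<open>F0\<close>, so just
      one triangle is left.\<close>
    have dg12: "dg e12 = 1"
    proof -
      obtain F' where F': "F' \<in> faces G" "F' \<noteq> F0" "{X \<in> faces G. e12 \<subseteq> frontier X} = {F0, F'}"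
        using edge_two_faces[OF G sm(5,2,4), of e12] ce by blast
      have "{F \<in> Tri. e12 \<subseteq> frontier F} = {X \<in> faces G. e12 \<subseteq> frontier X} - {F0}" by (auto simp: Tri_def)
      then have "{F \<in> Tri. e12 \<subseteq> frontier F} = {F'}" using F' by auto
      then show ?thesis by (simp add: dg_def)
    qed
    \<comment> \<open>A counted edge other than \<open>e12\<close> is not on the outer cycle, so
      \<open>F0\<close> does not border on it; once a triangle does, there are exactly two.\<close>
    have dg_even: "even (dg e)" if e: "e \<in> E" "e \<noteq> e12" for e
    proof (cases "{F \<in> Tri. e \<subseteq> frontier F} = {}")
      case True then show ?thesis unfolding dg_def True by simp
    next
      case False
      then obtain F where F: "F \<in> Tri" "e \<subseteq> frontier F" by blast
      have eG: "e \<in> edges G" using e by (simp add: E_def)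
      obtain x y z where xyz: "face_bounded_by G F [x, y, z]" "is_cycle G [x, y, z]"
        using triangular_faceE[OF tri[OF F(1)]] by blast
      have FG: "F \<in> faces G" using F(1) by (simp add: Tri_def)
      have ex: "e \<in> cycle_edges G [x, y, z]"
        using F(2) xyz(1) edge_subset_cycle_curve_iff[OF G eG] by (simp add: face_bounded_by_def)
      obtain F' where F': "F' \<in> faces G" "F' \<noteq> F" "{X \<in> faces G. e \<subseteq> frontier X} = {F, F'}"
        by (rule edge_two_faces[OF G sm(5) FG triangular_face_side[OF G xyz(1)] ex])
      have "\<not> e \<subseteq> frontier F0"
        using only e edge_subset_cycle_curve_iff[OF G eG] sm(6) by metis
      then have "{F \<in> Tri. e \<subseteq> frontier F} = {X \<in> faces G. e \<subseteq> frontier X}" by (auto simp: Tri_def)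
      then show ?thesis using F' by (simp add: dg_def)
    qed
    \<comment> \<open>Pairs of a triangle and a counted edge on its frontier, summed in both
      orders.\<close>
    have "(\<Sum>F\<in>Tri. card {e \<in> E. e \<subseteq> frontier F}) = (\<Sum>e\<in>E. dg e)"
      using sum.swap_restrict[OF finT finE, of "\<lambda>_ _. 1::nat" "\<lambda>F e. e \<subseteq> frontier F"] by (simp add: dg_def)
    also have "\<dots> = dg e12 + (\<Sum>e\<in>E - {e12}. dg e)" by (rule sum.remove[OF finE e12])
    finally have "(\<Sum>F\<in>Tri. card {e \<in> E. e \<subseteq> frontier F}) = 1 + (\<Sum>e\<in>E - {e12}. dg e)" by (simp only: dg12)
    moreover have "even (\<Sum>F\<in>Tri. card {e \<in> E. e \<subseteq> frontier F})" by (rule dvd_sum) (use even_face in auto)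
    moreover have "even (\<Sum>e\<in>E - {e12}. dg e)" by (rule dvd_sum) (use dg_even in auto)
    ultimately show False by simp
  qed
  then show thesis
  proof
    assume "a v3"
    then show thesis using rtranclp_distinct_path[of "adj G" P v1 v3] that(1) assms(2) unfolding a_def by blast
  next
    assume "b v4"
    then show thesis using rtranclp_distinct_path[of "adj G" "\<lambda>x. \<not> P x" v2 v4] that(2) assms(4) unfolding b_def by blast
  qed
qed


section \<open>Crossing paths\<close>

definition subdrawing :: "drawing \<Rightarrow> drawing \<Rightarrow> bool" where
  "subdrawing G H \<longleftrightarrow> plane_graph G \<and> plane_graph H \<and> verts G \<subseteq> verts H \<and> edges G \<subseteq> edges H"

text \<open>In both plane drawings the edge carries exactly two vertices, so the larger drawing
  cannot place a vertex inside an old edge; adjacency therefore survives.\<close>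

lemma subdrawing_ends:
  assumes "subdrawing G H" "e \<in> edges G"
  shows "e \<inter> verts H = e \<inter> verts G"
proof -
  have G: "plane_graph G" "plane_graph H" "verts G \<subseteq> verts H" "e \<in> edges H" using assms by (auto simp: subdrawing_def)
  obtain u v where 1: "u \<noteq> v" "e \<inter> verts G = {u, v}" using plane_graph_edgeE[OF G(1) assms(2)] by metis
  obtain x y where 2: "x \<noteq> y" "e \<inter> verts H = {x, y}" using plane_graph_edgeE[OF G(2,4)] by metis
  have "{u, v} \<subseteq> {x, y}" using 1(2) 2(2) G(3) by blast
  then show ?thesis using 1 2 by auto
qed

lemma subdrawing_adj: "subdrawing G H \<Longrightarrow> adj G u v \<Longrightarrow> adj H u v"
  using subdrawing_ends[of G H] unfolding adj_def subdrawing_def by (metis subsetD)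

lemma subdrawing_edge:
  assumes "subdrawing G H" "adj G u v"
  shows "edge H u v = edge G u v"
proof -
  have G: "plane_graph G" "plane_graph H" "edges G \<subseteq> edges H" using assms by (auto simp: subdrawing_def)
  show ?thesis
    using edgeD(1,2)[OF G(1) assms(2)] subdrawing_ends[OF assms(1)] G(3) by (intro edge_eqI[OF G(2)]) auto
qed

lemma subdrawing_successively: "subdrawing G H \<Longrightarrow> successively (adj G) p \<Longrightarrow> successively (adj H) p"
  using successively_mono subdrawing_adj by metis

lemma subdrawing_path_curve:
  assumes "subdrawing G H" "successively (adj G) p"
  shows "path_curve H p = path_curve G p"
  using assms(2) by (induction p rule: induct_list012) (auto simp: subdrawing_edge[OF assms(1)])

lemma subdrawing_cycle:
  assumes "subdrawing G H" "is_cycle G C"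
  shows "is_cycle H C" "cycle_curve H C = cycle_curve G C" "cycle_edges H C = cycle_edges G C"
proof -
  have G: "plane_graph G" "plane_graph H" using assms by (auto simp: subdrawing_def)
  show H: "is_cycle H C" using assms subdrawing_successively unfolding is_cycle_iff by blast
  show "cycle_curve H C = cycle_curve G C"
    unfolding cycle_curve_eq[OF G(1) assms(2)] cycle_curve_eq[OF G(2) H]
    by (rule subdrawing_path_curve[OF assms(1)]) (use assms(2) in \<open>simp add: is_cycle_iff\<close>)
  have "edge H (C ! i) (C ! (Suc i mod length C)) = edge G (C ! i) (C ! (Suc i mod length C))" if "i < length C" for i
    using that assms(2) by (intro subdrawing_edge[OF assms(1)]) (simp add: is_cycle_def)
  then show "cycle_edges H C = cycle_edges G C"
    unfolding cycle_edges_eq[OF G(1) assms(2)] cycle_edges_eq[OF G(2) H] by auto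
qed

text \<open>\<open>P\<close> and \<open>Q\<close> cut the two sides of the curve into two regions
  each. The regions bordering on \<open>J1\<close> merge across it into one open set, those
  bordering on \<open>J2\<close> into another. These sets are disjoint and cover the complement of
  the loop, so neither side of the loop, being connected, contains both \<open>x\<close> and
  \<open>y\<close>.\<close>

lemma jordan_crossing:
  assumes D: "jordan_side (J1 \<union> J2) D" "jordan_side (J1 \<union> J2) D'" "D \<inter> D' = {}"
    and J: "arc_between J1 a b" "arc_between J2 a b" "J1 \<inter> J2 = {a, b}"
    and P: "arc_between P a b" "P - {a, b} \<subseteq> D" and Q: "arc_between Q a b" "Q - {a, b} \<subseteq> D'"
    and x: "x \<in> J1 - {a, b}" and y: "y \<in> J2 - {a, b}"
  shows "x \<in> inside (P \<union> Q) \<longleftrightarrow> y \<notin> inside (P \<union> Q)"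
proof -
  obtain A1 A2 where A: "jordan_side (J1 \<union> P) A1" "jordan_side (J2 \<union> P) A2" "A1 \<inter> A2 = {}" "A1 \<union> A2 = D - P"
    using jordan_crosscut[OF D(1) J P] by blast
  obtain B1 B2 where B: "jordan_side (J1 \<union> Q) B1" "jordan_side (J2 \<union> Q) B2" "B1 \<inter> B2 = {}" "B1 \<union> B2 = D' - Q"
    using jordan_crosscut[OF D(2) J Q] by blast
  have DD: "D \<union> D' = - (J1 \<union> J2)"
  proof -
    obtain D'' where D'': "jordan_side (J1 \<union> J2) D''" "D \<inter> D'' = {}" "D \<union> D'' = - (J1 \<union> J2)"
      using jordan_side_opposite[OF D(1)] by blast
    have "D \<noteq> D''" "D \<noteq> D'" using D''(2) D(3) jordan_sideD(3)[OF D(1)] by auto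
    then have "D' = D''" using jordan_sides_unique[OF D(1) D''(1) D(2)] by simp
    then show ?thesis using D''(3) by simp
  qed
  have ends: "a \<in> P" "b \<in> P" "a \<in> Q" "b \<in> Q" using P Q arc_betweenD(2,3) by auto
  have disD: "D \<inter> (J1 \<union> J2) = {}" "D' \<inter> (J1 \<union> J2) = {}" using jordan_sideD(5) D(1,2) by auto
  have PQ: "P \<inter> Q \<subseteq> {a, b}" using P(2) Q(2) D(3) by blast
  have K: "jordan_side (P \<union> Q) (inside (P \<union> Q))" "jordan_side (P \<union> Q) (outside (P \<union> Q))"
    using jordan_of_arcs[OF P(1) Q(1) PQ] unfolding jordan_side_def by auto
  define X where "X = A1 \<union> B1 \<union> (J1 - {a, b})"
  define Y where "Y = A2 \<union> B2 \<union> (J2 - {a, b})"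
  \<comment> \<open>Writing each set as the complement of closed sets gives openness, also at the
    points of \<open>J1\<close> and \<open>J2\<close>.\<close>
  have Xc: "X = - (closure A2 \<union> closure B2 \<union> (P \<union> Q))" and Yc: "Y = - (closure A1 \<union> closure B1 \<union> (P \<union> Q))"
    and XY: "X \<inter> Y = {}" "- (P \<union> Q) \<subseteq> X \<union> Y"
  proof -
    have cl: "closure A1 = A1 \<union> (J1 \<union> P)" "closure A2 = A2 \<union> (J2 \<union> P)" "closure B1 = B1 \<union> (J1 \<union> Q)" "closure B2 = B2 \<union> (J2 \<union> Q)"
      using jordan_sideD(4)[OF A(1)] jordan_sideD(4)[OF A(2)] jordan_sideD(4)[OF B(1)] jordan_sideD(4)[OF B(2)]
      by (simp_all add: closure_Un_frontier)
    have J12: "z \<in> J1 \<and> z \<in> J2 \<longleftrightarrow> z = a \<or> z = b" for z using J(3) by blast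
    have zD: "z \<in> D' \<longleftrightarrow> z \<notin> D \<and> z \<notin> J1 \<and> z \<notin> J2" "z \<in> D \<longrightarrow> z \<notin> J1 \<and> z \<notin> J2" for z
      using DD D(3) disD by auto
    have zA: "z \<in> A1 \<longleftrightarrow> z \<in> D \<and> z \<notin> P \<and> z \<notin> A2" "z \<in> A2 \<longrightarrow> z \<in> D \<and> z \<notin> P" for z
      using A(3,4) by auto
    have zB: "z \<in> B1 \<longleftrightarrow> z \<in> D' \<and> z \<notin> Q \<and> z \<notin> B2" "z \<in> B2 \<longrightarrow> z \<in> D' \<and> z \<notin> Q" for z
      using B(3,4) by auto
    have zPQ: "z \<in> P \<longrightarrow> z = a \<or> z = b \<or> z \<in> D" "z \<in> Q \<longrightarrow> z = a \<or> z = b \<or> z \<in> D'" for z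
      using P(2) Q(2) by auto
    note zs = zD zA zB zPQ
    show "X = - (closure A2 \<union> closure B2 \<union> (P \<union> Q))"
    proof (rule set_eqI)
      fix z show "z \<in> X \<longleftrightarrow> z \<in> - (closure A2 \<union> closure B2 \<union> (P \<union> Q))"
        unfolding cl X_def using zs[of z] J12[of z] ends by (simp add: cl) metis
    qed
    show "Y = - (closure A1 \<union> closure B1 \<union> (P \<union> Q))"
    proof (rule set_eqI)
      fix z show "z \<in> Y \<longleftrightarrow> z \<in> - (closure A1 \<union> closure B1 \<union> (P \<union> Q))"
        unfolding cl Y_def using zs[of z] J12[of z] ends by (simp add: cl) metis
    qed
    have "\<not> (z \<in> X \<and> z \<in> Y)" "z \<in> X \<or> z \<in> Y \<or> z \<in> P \<or> z \<in> Q" for z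
      unfolding X_def Y_def using zs[of z] J12[of z] ends by (simp; metis)+
    then show "X \<inter> Y = {}" "- (P \<union> Q) \<subseteq> X \<union> Y" by auto
  qed
  have cPQ: "closed (P \<union> Q)" using jordan_sideD(6)[OF K(1)] by (rule compact_imp_closed)
  have op: "open X" "open Y"
    unfolding Xc Yc by (rule open_Compl[OF closed_Un[OF closed_Un[OF closed_closure closed_closure] cPQ]])+
  have xX: "x \<in> X" and yY: "y \<in> Y" using x y by (auto simp: X_def Y_def)
  have *: "\<not> (x \<in> R \<and> y \<in> R)" if R: "jordan_side (P \<union> Q) R" for R
  proof
    assume "x \<in> R \<and> y \<in> R"
    moreover have "R \<subseteq> X \<union> Y" using jordan_sideD(5)[OF R] XY(2) by blast
    ultimately show False using connectedD[OF jordan_sideD(2)[OF R] op] XY(1) xX yY by blast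
  qed
  have "x \<in> inside (P \<union> Q) \<union> outside (P \<union> Q)" "y \<in> inside (P \<union> Q) \<union> outside (P \<union> Q)"
    unfolding inside_Un_outside using xX yY Xc Yc by blast+
  then show ?thesis using *[OF K(1)] *[OF K(2)] by blast
qed

section \<open>Paths of a semi-maximal graph as crosscuts\<close>

lemma smpg_at_rotate:
  assumes "smpg_at F0 G [v1, v2, v3, v4]"
  shows "smpg_at F0 G [v2, v3, v4, v1]" "cycle_curve G [v2, v3, v4, v1] = cycle_curve G [v1, v2, v3, v4]"
    "cycle_edges G [v2, v3, v4, v1] = cycle_edges G [v1, v2, v3, v4]"
proof -
  note sm = smpg_atD[OF assms]
  have c: "is_cycle G [v2, v3, v4, v1]" using sm(3) unfolding is_cycle4 by auto
  show ce: "cycle_edges G [v2, v3, v4, v1] = cycle_edges G [v1, v2, v3, v4]"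
    unfolding cycle_edges4[OF sm(1) c] cycle_edges4[OF sm(1) sm(3)] by (simp add: insert_commute)
  then show "cycle_curve G [v2, v3, v4, v1] = cycle_curve G [v1, v2, v3, v4]" by (simp add: cycle_curve_def)
  then show "smpg_at F0 G [v2, v3, v4, v1]"
    using assms c unfolding smpg_at_def face_bounded_by_def by simp
qed

lemma smpg_at_sides:
  assumes "smpg_at F0 G [v1, v2, v3, v4]" "jordan_side (cycle_curve G [v1, v2, v3, v4]) D" "F0 \<inter> D = {}"
  shows "F0 \<union> D = - cycle_curve G [v1, v2, v3, v4]"
proof -
  note sm = smpg_atD[OF assms(1)]
  obtain D' where D': "jordan_side (cycle_curve G [v1, v2, v3, v4]) D'" "F0 \<inter> D' = {}"
    "F0 \<union> D' = - cycle_curve G [v1, v2, v3, v4]"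
    using jordan_side_opposite[OF sm(4)] by blast
  have "F0 \<noteq> D'" "F0 \<noteq> D" using D'(2) assms(3) jordan_sideD(3)[OF sm(4)] by auto
  then show ?thesis using jordan_sides_unique[OF sm(4) D'(1) assms(2)] D'(3) by auto
qed

lemma smpg_at_subset:
  assumes "smpg_at F0 G [v1, v2, v3, v4]" "jordan_side (cycle_curve G [v1, v2, v3, v4]) D" "F0 \<inter> D = {}"
  shows "verts G \<union> \<Union>(edges G) \<subseteq> cycle_curve G [v1, v2, v3, v4] \<union> D"
  using smpg_at_sides[OF assms] faces_basic(4)[OF smpg_atD(1,2)[OF assms(1)]] by blast

lemma cycle4_curve_verts:
  assumes "plane_graph G" "is_cycle G [a, b, c, d]"
  shows "cycle_curve G [a, b, c, d] \<inter> verts G = {a, b, c, d}"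
proof -
  have "adj G a b" "adj G b c" "adj G c d" "adj G d a" using assms(2) by (simp_all add: is_cycle4)
  then show ?thesis
    unfolding cycle4_arcs(1)[OF assms] Int_Un_distrib2 by (auto simp: edgeD(2)[OF assms(1)])
qed

text \<open>Each boundary edge ends in \<open>v2\<close> or \<open>v4\<close>, which the path
  avoids; thus the path touches the quadrangle only in \<open>v1\<close> and
  \<open>v3\<close>.\<close>

lemma path_crosscut:
  assumes "smpg_at F0 G [v1, v2, v3, v4]" "jordan_side (cycle_curve G [v1, v2, v3, v4]) D" "F0 \<inter> D = {}"
    and p: "successively (adj G) p" "distinct p" "p \<noteq> []" "hd p = v1" "last p = v3" "v2 \<notin> set p" "v4 \<notin> set p"
  shows "arc_between (path_curve G p) v1 v3" "path_curve G p - {v1, v3} \<subseteq> D" "2 \<le> length p"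
proof -
  note sm = smpg_atD[OF assms(1)]
  show len: "2 \<le> length p" using p(3-5) sm(11) by (cases p; cases "tl p") auto
  show "arc_between (path_curve G p) v1 v3" using path_curve_arc[OF sm(1) p(1,2) len] p by simp
  have *: "edge G x y \<inter> path_curve G p \<subseteq> {v1, v3}" if "adj G x y" "x \<notin> set p" "y \<in> {v1, v3}" for x y
    using edge_inter_path[OF sm(1) p(1) that(1,2)] that by auto
  have "edge G v1 v2 \<inter> path_curve G p \<subseteq> {v1, v3}" "edge G v2 v3 \<inter> path_curve G p \<subseteq> {v1, v3}"
    "edge G v3 v4 \<inter> path_curve G p \<subseteq> {v1, v3}" "edge G v4 v1 \<inter> path_curve G p \<subseteq> {v1, v3}"
    using *[of v2 v1] *[of v2 v3] *[of v4 v3] *[of v4 v1] sm(7-10) p(6,7)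
    unfolding adj_sym[of G v2 v1] adj_sym[of G v4 v3] edge_sym[of G v1 v2] edge_sym[of G v3 v4] by simp_all
  then have "path_curve G p \<inter> cycle_curve G [v1, v2, v3, v4] \<subseteq> {v1, v3}"
    unfolding cycle4_arcs(1)[OF sm(1,3)] by blast
  moreover have "path_curve G p \<subseteq> \<Union>(edges G)"
    unfolding path_curve_conv_nth using p(1) edgeD(1)[OF sm(1)] by (auto simp: successively_conv_nth)
  ultimately show "path_curve G p - {v1, v3} \<subseteq> D" using smpg_at_subset[OF assms(1-3)] by blast
qed

text \<open>The arc \<open>Q\<close> need not belong to the drawing: it is a curve drawn through
  \<open>F0\<close> in one application and a path of the exterior graph in the other.\<close>

lemma crossing_paths_inside:
  assumes G: "smpg_at F0 G [v1, v2, v3, v4]" and p: "successively (adj G) p" "distinct p" "p \<noteq> []" "hd p = v1" "last p = v3" "v2 \<notin> set p" "v4 \<notin> set p"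
    and Q: "arc_between Q v1 v3" "Q - {v1, v3} \<subseteq> F0"
  shows "v2 \<in> inside (path_curve G p \<union> Q) \<longleftrightarrow> v4 \<notin> inside (path_curve G p \<union> Q)"
proof -
  note sm = smpg_atD[OF G]
  obtain D where D: "jordan_side (cycle_curve G [v1, v2, v3, v4]) D" "F0 \<inter> D = {}"
    by (rule jordan_side_opposite[OF sm(4)])
  note P = path_crosscut[OF G D p]
  note J = cycle4_arcs[OF sm(1,3)]
  have "v2 \<in> edge G v1 v2" "v4 \<in> edge G v3 v4" using edgeD(2)[OF sm(1) sm(7)] edgeD(2)[OF sm(1) sm(9)] by auto
  then show ?thesis
    by (intro jordan_crossing[OF D(1)[unfolded J(1)] sm(4)[unfolded J(1)] _ J(2-4) P(1,2) Q])
       (use D sm(13) in auto)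
qed

text \<open>Closing \<open>p\<close> by an arc through \<open>F0\<close> gives a loop that separates
  \<open>v2\<close> from \<open>v4\<close>. The curve of \<open>q\<close> would have to cross it,
  but it shares no point with that of \<open>p\<close> and does not enter \<open>F0\<close>.\<close>

lemma no_crossing_paths:
  assumes G: "smpg_at F0 G [v1, v2, v3, v4]"
    and p: "successively (adj G) p" "distinct p" "p \<noteq> []" "hd p = v1" "last p = v3"
    and q: "successively (adj G) q" "distinct q" "q \<noteq> []" "hd q = v2" "last q = v4"
    and dis: "set p \<inter> set q = {}"
  shows False
proof -
  note sm = smpg_atD[OF G]
  have vp: "v1 \<in> set p" "v3 \<in> set p" and vq: "v2 \<in> set q" "v4 \<in> set q" using p q hd_in_set last_in_set by metis+
  then have nv: "v2 \<notin> set p" "v4 \<notin> set p" "v3 \<notin> set q" "v1 \<notin> set q" using dis by auto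
  have J: "v1 \<in> cycle_curve G [v1, v2, v3, v4]" "v3 \<in> cycle_curve G [v1, v2, v3, v4]"
    unfolding cycle4_arcs(1)[OF sm(1,3)] using edgeD(2)[OF sm(1) sm(7)] edgeD(2)[OF sm(1) sm(9)] by auto
  obtain R where R: "arc_between R v1 v3" "R - {v1, v3} \<subseteq> F0" using jordan_crosscut_exists[OF sm(4) J sm(11)] by blast
  note cr = crossing_paths_inside[OF G p nv(1,2) R]
  obtain D where D: "jordan_side (cycle_curve G [v1, v2, v3, v4]) D" "F0 \<inter> D = {}"
    by (rule jordan_side_opposite[OF sm(4)])
  note rot = smpg_at_rotate[OF G]
  note Q = path_crosscut[OF rot(1) D(1)[folded rot(2)] D(2) q nv(3,4)]
  have "path_curve G q \<inter> path_curve G p = {}"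
    by (rule path_inter_path[OF sm(1) q(1) p(1)]) (use dis in auto)
  moreover have "path_curve G q \<subseteq> verts G \<union> \<Union>(edges G)"
    unfolding path_curve_conv_nth using q(1) edgeD(1)[OF sm(1)] by (auto simp: successively_conv_nth)
  then have "path_curve G q \<inter> F0 = {}" using faces_basic(4)[OF sm(1,2)] by blast
  moreover have "path_curve G q \<inter> {v1, v3} = {}"
    using path_curve_verts[OF sm(1) q(1)] nv sm(14) by auto
  ultimately have dQ: "path_curve G q \<subseteq> - (path_curve G p \<union> R)" using R(2) by blast
  have "connected_component (- (path_curve G p \<union> R)) v2 v4"
    unfolding connected_component_def
    using arc_betweenD(2,3,5)[OF Q(1)] dQ by blast
  then have "v2 \<in> inside (path_curve G p \<union> R) \<longleftrightarrow> v4 \<in> inside (path_curve G p \<union> R)"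
    using inside_same_component connected_component_sym by metis
  then show False using cr by blast
qed


section \<open>Kempe chains in a pasted graph\<close>

text \<open>Leaves out the extensionality built into \<open>colouring\<close>, so that one function
  can serve as a colouring of the pasted graph and of both its parts.\<close>

definition proper :: "drawing \<Rightarrow> (complex \<Rightarrow> nat) \<Rightarrow> bool" where
  "proper G f \<longleftrightarrow> (\<forall>v\<in>verts G. f v \<in> {1..4}) \<and> (\<forall>u v. adj G u v \<longrightarrow> f u \<noteq> f v)"

lemma colouring_iff_proper: "colouring 4 G f \<longleftrightarrow> f \<in> extensional (verts G) \<and> proper G f"
  unfolding colouring_def proper_def PiE_def by auto

lemma proper_subdrawing: "subdrawing G H \<Longrightarrow> proper H f \<Longrightarrow> proper G f"
  using subdrawing_adj unfolding proper_def subdrawing_def by blast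

lemma proper_cong: "proper G f \<Longrightarrow> (\<And>v. v \<in> verts G \<Longrightarrow> g v = f v) \<Longrightarrow> proper G g"
  unfolding proper_def using adj_verts by metis

text \<open>An edge leaving the interior of \<open>K\<close> meets the curve, and in a plane graph
  this happens in a vertex. Its other end therefore lies on \<open>K\<close> and carries a colour
  that the exchange leaves alone.\<close>

lemma swap_inside_proper:
  assumes G: "plane_graph G" and f: "proper G f" and K: "is_cycle G K" and st: "{s, t} = {1..4} - f ` set K"
  shows "proper G (swap_inside G K s t f)"
proof -
  let ?g = "swap_inside G K s t f"
  let ?K = "cycle_curve G K"
  have st4: "s \<in> {1..4}" "t \<in> {1..4}" "s \<notin> f ` set K" "t \<notin> f ` set K" using st by blast+
  have bdry: "v \<in> set K" if u: "u \<in> inside ?K" and uv: "adj G u v" and v: "v \<notin> inside ?K" for u v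
  proof -
    note e = edgeD[OF G uv]
    have ce: "edge G u v \<inter> ?K \<noteq> {}"
    proof
      assume "edge G u v \<inter> ?K = {}"
      then have "connected_component (- ?K) u v"
        unfolding connected_component_def using arc_betweenD(2,3,5)[OF e(3)] by blast
      then show False using inside_same_component u v by blast
    qed
    then obtain z e' where z: "z \<in> edge G u v" "z \<in> e'" "e' \<in> cycle_edges G K" unfolding cycle_curve_def by blast
    have uK: "u \<notin> ?K" using u inside_no_overlap by blast
    have e'G: "e' \<in> edges G" using z(3) by (simp add: cycle_edges_def)
    obtain i where i: "i < length K" "e' \<inter> verts G = {K ! i, K ! (Suc i mod length K)}"
      using z(3) by (auto simp: cycle_edges_def)
    then have "Suc i mod length K < length K" by (intro mod_less_divisor) auto
    then have e'K: "e' \<inter> verts G \<subseteq> set K" using i by simp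
    have "e' \<noteq> edge G u v" using uK z(3) arc_betweenD(2)[OF e(3)] unfolding cycle_curve_def by blast
    then have zV: "z \<in> verts G" using plane_edges_inter[OF G e(1) e'G] z by blast
    then have "z \<in> {u, v}" using e(2) z(1) by blast
    moreover have "z \<in> ?K" using z unfolding cycle_curve_def by blast
    ultimately have "z = v" using uK by blast
    then show ?thesis using e'K z(2) zV by blast
  qed
  have t1: "Transposition.transpose s t x \<noteq> y" if "x \<noteq> y" "y \<in> f ` set K" for x y
    using that st4(3,4) by (auto simp: Transposition.transpose_def)
  show ?thesis
    unfolding proper_def
  proof (intro conjI ballI allI impI)
    fix v assume "v \<in> verts G"
    then show "?g v \<in> {1..4}" using f st4 by (auto simp: proper_def swap_inside_def Transposition.transpose_def)
  next
    fix u v assume uv: "adj G u v"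
    then have ne: "f u \<noteq> f v" "u \<in> verts G" "v \<in> verts G" using f adj_verts by (auto simp: proper_def)
    consider "u \<in> inside ?K" "v \<in> inside ?K" | "u \<in> inside ?K" "v \<notin> inside ?K" | "u \<notin> inside ?K" "v \<in> inside ?K"
      | "u \<notin> inside ?K" "v \<notin> inside ?K" by blast
    then show "?g u \<noteq> ?g v"
    proof cases
      case 1 then show ?thesis using ne by (auto simp: swap_inside_def Transposition.transpose_def)
    next
      case 2
      have "f v \<in> f ` set K" using bdry[OF 2(1) uv 2(2)] by blast
      then show ?thesis using t1[OF ne(1)] 2 ne by (simp add: swap_inside_def)
    next
      case 3
      have "f u \<in> f ` set K" using bdry[OF 3(2) uv[unfolded adj_sym[of G u v]] 3(1)] by blast
      then show ?thesis using t1[OF ne(1)[symmetric]] 3 ne by (auto simp: swap_inside_def)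
    next
      case 4 then show ?thesis using ne by (simp add: swap_inside_def)
    qed
  qed
qed

section \<open>Kempe classes, quadrangle colours and Kempe paths\<close>

lemma kempe_step_colouring:
  assumes G: "plane_graph G" and f: "colouring 4 G f" and st: "sigma_step G f g \<or> renaming G f g"
  shows "colouring 4 G g"
  using st
proof
  assume "sigma_step G f g"
  then obtain K s t where K: "bichromatic_cycle G f K" "{s, t} = {1..4} - f ` set K" "g = swap_inside G K s t f"
    unfolding sigma_step_def by blast
  then have "proper G g" using swap_inside_proper[OF G] f by (simp add: colouring_iff_proper bichromatic_cycle_def)
  moreover have "g \<in> extensional (verts G)"
    using f K(3) by (auto simp: colouring_iff_proper extensional_def swap_inside_def)
  ultimately show ?thesis by (simp add: colouring_iff_proper)
next
  assume "renaming G f g"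
  then obtain p where p: "p permutes {1..4}" "g = restrict (p \<circ> f) (verts G)" unfolding renaming_def by blast
  have "proper G g"
    using f p permutes_in_image[OF p(1)] permutes_inj[OF p(1)] adj_verts[of G]
    by (auto simp: colouring_iff_proper proper_def inj_eq)
  then show ?thesis using p(2) by (simp add: colouring_iff_proper)
qed

lemma kempe_class_colouring:
  assumes "plane_graph G" "colouring 4 G f" "g \<in> kempe_class G f"
  shows "colouring 4 G g"
proof -
  have "(\<lambda>h h'. sigma_step G h h' \<or> renaming G h h')\<^sup>*\<^sup>* f g" using assms(3) by (simp add: kempe_class_def)
  then show ?thesis
    by (induction rule: rtranclp_induct) (use assms kempe_step_colouring in blast)+
qed

lemma kempe_class_step:
  assumes "g \<in> kempe_class G f" "sigma_step G g h \<or> renaming G g h"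
  shows "h \<in> kempe_class G f"
  using assms unfolding kempe_class_def by (auto intro: rtranclp.rtrancl_into_rtrancl)

lemma kempe_class_refl: "f \<in> kempe_class G f"
  by (simp add: kempe_class_def)

lemma quadrangle_colours:
  assumes "proper G f" "is_cycle G [v1, v2, v3, v4]" "card (f ` {v1, v2, v3, v4}) = 2"
  shows "f v3 = f v1" "f v4 = f v2" "f v1 \<noteq> f v2" "f v1 \<in> {1..4}" "f v2 \<in> {1..4}"
proof -
  have ne: "f v1 \<noteq> f v2" "f v2 \<noteq> f v3" "f v3 \<noteq> f v4" "f v4 \<noteq> f v1" and V: "v1 \<in> verts G" "v2 \<in> verts G"
    using assms(1,2) adj_verts[of G] by (auto simp: proper_def is_cycle4)
  obtain x y where "f ` {v1, v2, v3, v4} = {x, y}" using assms(3) by (auto simp: card_2_iff)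
  then have "f v1 \<in> {x, y}" "f v2 \<in> {x, y}" "f v3 \<in> {x, y}" "f v4 \<in> {x, y}" by blast+
  then show "f v3 = f v1" "f v4 = f v2" using ne by auto
  show "f v1 \<noteq> f v2" by (rule ne)
  show "f v1 \<in> {1..4}" "f v2 \<in> {1..4}" using assms(1) V by (auto simp: proper_def)
qed

lemma remaining_colours:
  fixes a b c :: nat
  assumes "a \<in> {1..4}" "b \<in> {1..4}" "a \<noteq> b" "c \<in> {1..4} - {a, b}"
  obtains d where "distinct [a, b, c, d]" "{a, b, c, d} = {1..4}"
proof -
  have "card {a, b, c} = 3" using assms by auto
  then have "card ({1..4} - {a, b, c}) = 1" using assms by (subst card_Diff_subset) auto
  then obtain d where d: "{1..4} - {a, b, c} = {d}" by (auto simp: card_1_singleton_iff)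
  then have "d \<in> {1..4} - {a, b, c}" by simp
  then have "distinct [a, b, c, d]" using assms by auto
  moreover have "{a, b, c, d} = {1..4}" using d assms by blast
  ultimately show thesis using that by blast
qed

lemma third_colour:
  obtains c where "c \<in> {1..4::nat} - {a, b}"
proof -
  have "card {a, b} \<le> 2" by (simp add: card_insert_if)
  then have "\<not> {1..4} \<subseteq> {a, b}" using card_mono[of "{a, b}" "{1..4}"] by auto
  then show thesis using that by blast
qed

text \<open>With distinct ends each vertex of the list has a neighbour on it, which already puts it
  into \<open>verts G\<close>; only a one-vertex list could lie outside.\<close>

lemma kempe_paths_iff:
  assumes "u \<noteq> v"
  shows "p \<in> kempe_paths G f i j u v \<longleftrightarrow>
    p \<noteq> [] \<and> distinct p \<and> hd p = u \<and> last p = v \<and> successively (adj G) p \<and> (\<forall>x\<in>set p. f x \<in> {i, j})"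
proof -
  have "set p \<subseteq> verts G" if "p \<noteq> []" "hd p = u" "last p = v" "successively (adj G) p"
  proof
    fix x assume "x \<in> set p"
    then obtain a b where ab: "p = a @ x # b" by (meson split_list)
    have "a \<noteq> [] \<or> b \<noteq> []" using ab that assms by auto
    then have "adj G (last a) x \<or> adj G x (hd b)" using that(4) unfolding ab by (auto simp: successively_append_iff successively_Cons)
    then show "x \<in> verts G" using adj_verts by blast
  qed
  then show ?thesis unfolding kempe_paths_def by blast
qed

lemma kempe_paths_verts: "p \<in> kempe_paths G f i j u v \<Longrightarrow> set p \<subseteq> verts G"
  by (simp add: kempe_paths_def)

lemma kempe_paths_cong:
  assumes "\<And>x. x \<in> verts G \<Longrightarrow> g x \<in> {k, l} \<longleftrightarrow> f x \<in> {i, j}"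
  shows "kempe_paths G g k l u v = kempe_paths G f i j u v"
  using assms unfolding kempe_paths_def by (intro Collect_cong) blast

text \<open>Exclusion is \<open>no_crossing_paths\<close>. Existence is Sperner's argument where
  \<open>P\<close> selects the colours \<open>f v1\<close> and \<open>c\<close>, so that its
  complement selects \<open>f v2\<close> and \<open>d\<close>.\<close>

lemma kempe_paths_dichotomy:
  assumes G: "smpg_at F0 G [v1, v2, v3, v4]" and f: "proper G f"
    and c: "f v3 = f v1" "f v4 = f v2" "distinct [f v1, f v2, c, d]" "{f v1, f v2, c, d} = {1..4}"
  shows "kempe_paths G f (f v1) c v1 v3 \<noteq> {} \<longleftrightarrow> kempe_paths G f (f v2) d v2 v4 = {}"
proof -
  note sm = smpg_atD[OF G]
  have col: "f x \<in> {f v2, d} \<longleftrightarrow> f x \<notin> {f v1, c}" if "x \<in> verts G" for x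
  proof -
    have "f x \<in> {f v1, f v2, c, d}" unfolding c(4) using f that by (simp only: proper_def)
    then show ?thesis using c(3) by auto
  qed
  show ?thesis
  proof
    assume "kempe_paths G f (f v1) c v1 v3 \<noteq> {}"
    then obtain p where p: "p \<in> kempe_paths G f (f v1) c v1 v3" by blast
    show "kempe_paths G f (f v2) d v2 v4 = {}"
    proof (rule ccontr)
      assume "kempe_paths G f (f v2) d v2 v4 \<noteq> {}"
      then obtain q where q: "q \<in> kempe_paths G f (f v2) d v2 v4" by blast
      have "set p \<inter> set q = {}"
        using p q col kempe_paths_verts[OF p] unfolding kempe_paths_iff[OF sm(11)] kempe_paths_iff[OF sm(12)] by blast
      then show False
        using no_crossing_paths[OF G, of p q] p q unfolding kempe_paths_iff[OF sm(11)] kempe_paths_iff[OF sm(12)] by blast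
    qed
  next
    assume no: "kempe_paths G f (f v2) d v2 v4 = {}"
    have 1: "f v1 \<in> {f v1, c}" "f v3 \<in> {f v1, c}" "\<not> f v2 \<in> {f v1, c}" "\<not> f v4 \<in> {f v1, c}" using c by auto
    show "kempe_paths G f (f v1) c v1 v3 \<noteq> {}"
    proof (rule quadrangle_path_or_dual_path[OF G, of "\<lambda>x. f x \<in> {f v1, c}", OF 1])
      fix p assume "p \<noteq> []" "distinct p" "hd p = v1" "last p = v3" "successively (adj G) p" "\<forall>x\<in>set p. f x \<in> {f v1, c}"
      then have "p \<in> kempe_paths G f (f v1) c v1 v3" unfolding kempe_paths_iff[OF sm(11)] by blast
      then show ?thesis by blast
    next
      fix p assume p: "p \<noteq> []" "distinct p" "hd p = v2" "last p = v4" "successively (adj G) p" "\<forall>x\<in>set p. f x \<notin> {f v1, c}"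
      \<comment> \<open>The 0-1 colouring is auxiliary: it serves to obtain from
        \<open>kempe_paths_iff\<close> that the path stays in \<open>verts G\<close>.\<close>
      have "p \<in> kempe_paths G (\<lambda>x. of_bool (f x \<in> {f v1, c})) 0 0 v2 v4"
        unfolding kempe_paths_iff[OF sm(12)] using p by auto
      then have "set p \<subseteq> verts G" by (rule kempe_paths_verts)
      then have "p \<in> kempe_paths G f (f v2) d v2 v4" unfolding kempe_paths_iff[OF sm(12)] using p col by blast
      then show ?thesis using no by blast
    qed
  qed
qed

text \<open>Common interface for the exterior graph given by a base module and for the cap
  constructed later: the two parts lie on opposite sides of one curve.\<close>

definition pasted :: "drawing \<Rightarrow> drawing \<Rightarrow> complex \<Rightarrow> complex \<Rightarrow> complex \<Rightarrow> complex \<Rightarrow> bool" where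
  "pasted G G1 v1 v2 v3 v4 \<longleftrightarrow>
     smpg_at (outside (cycle_curve G [v1, v2, v3, v4])) G [v1, v2, v3, v4] \<and>
     smpg_at (inside (cycle_curve G [v1, v2, v3, v4])) G1 [v1, v2, v3, v4] \<and>
     cycle_curve G1 [v1, v2, v3, v4] = cycle_curve G [v1, v2, v3, v4] \<and>
     verts G \<inter> verts G1 = {v1, v2, v3, v4} \<and> plane_graph (graph_union G G1)"

lemma pastedD:
  assumes "pasted G G1 v1 v2 v3 v4"
  shows "smpg_at (outside (cycle_curve G [v1, v2, v3, v4])) G [v1, v2, v3, v4]"
    "smpg_at (inside (cycle_curve G [v1, v2, v3, v4])) G1 [v1, v2, v3, v4]"
    "cycle_curve G1 [v1, v2, v3, v4] = cycle_curve G [v1, v2, v3, v4]"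
    "verts G \<inter> verts G1 = {v1, v2, v3, v4}" "plane_graph (graph_union G G1)"
    "subdrawing G (graph_union G G1)" "subdrawing G1 (graph_union G G1)"
  using assms smpg_atD(1) unfolding pasted_def subdrawing_def by (auto simp: graph_union_def)

lemma pasted_rotate:
  assumes "pasted G G1 v1 v2 v3 v4"
  shows "pasted G G1 v2 v3 v4 v1"
  unfolding pasted_def
  using pastedD[OF assms] smpg_at_rotate[OF pastedD(1)[OF assms]] smpg_at_rotate[OF pastedD(2)[OF assms]]
  by (simp add: insert_commute)

text \<open>The two paths close up to a bichromatic cycle with exactly one of \<open>v2\<close>,
  \<open>v4\<close> inside. Exchanging \<open>h v2\<close> and \<open>d\<close> there recolours one
  of these two only, so three colours appear on the quadrangle.\<close>

lemma pasted_crossing_step: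
  assumes pa: "pasted G G1 v1 v2 v3 v4" and h: "proper (graph_union G G1) h"
    and c: "h v3 = h v1" "h v4 = h v2" "distinct [h v1, h v2, c, d]" "{h v1, h v2, c, d} = {1..4}"
    and p: "p \<in> kempe_paths G h (h v1) c v1 v3" and q: "q \<in> kempe_paths G1 h (h v1) c v1 v3"
  obtains h' where "sigma_step (graph_union G G1) h h'" "card (h' ` {v1, v2, v3, v4}) \<noteq> 2"
proof -
  define H where "H = graph_union G G1"
  note pD = pastedD[OF pa, folded H_def]
  note sm = smpg_atD[OF pD(1)] and sm1 = smpg_atD[OF pD(2)]
  note p' = p[unfolded kempe_paths_iff[OF sm(11)]] and q' = q[unfolded kempe_paths_iff[OF sm(11)]]
  have nv: "v2 \<notin> set p" "v4 \<notin> set p" "v2 \<notin> set q" "v4 \<notin> set q" using p' q' c by auto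
  have inside1: "jordan_side (cycle_curve G1 [v1, v2, v3, v4]) (outside (cycle_curve G [v1, v2, v3, v4]))"
    using sm(4) pD(3) by simp
  have dj: "inside (cycle_curve G [v1, v2, v3, v4]) \<inter> outside (cycle_curve G [v1, v2, v3, v4]) = {}" by simp
  have Q: "arc_between (path_curve G1 q) v1 v3" "path_curve G1 q - {v1, v3} \<subseteq> outside (cycle_curve G [v1, v2, v3, v4])" "2 \<le> length q"
    using path_crosscut[OF pD(2) inside1 dj, of q] q' nv by auto
  have ins: "v2 \<in> inside (path_curve G p \<union> path_curve G1 q) \<longleftrightarrow> v4 \<notin> inside (path_curve G p \<union> path_curve G1 q)"
    using crossing_paths_inside[OF pD(1), of p, OF _ _ _ _ _ _ _ Q(1,2)] p' nv by auto
  obtain m where m: "q = v1 # m @ [v3]"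
  proof -
    obtain q1 where q1: "q = v1 # q1" "q1 \<noteq> []" using q' Q(3) by (cases q; cases "tl q") auto
    then have "q = v1 # butlast q1 @ [v3]" using q' by (metis append_butlast_last_id last_ConsR)
    then show thesis using that by blast
  qed
  have p_snoc: "p = butlast p @ [v3]" using p' by (metis append_butlast_last_id)
  have p2: "p \<noteq> []" "hd p = v1" "last p = v3" "distinct p" "successively (adj H) p" "path_curve H p = path_curve G p"
    using p' subdrawing_successively[OF pD(6)] subdrawing_path_curve[OF pD(6)] by auto
  have q2: "distinct q" "successively (adj H) q" "path_curve H q = path_curve G1 q"
    using q' subdrawing_successively[OF pD(7)] subdrawing_path_curve[OF pD(7)] by auto
  \<comment> \<open>\<open>v1\<close> and \<open>v3\<close> have equal colours, so \<open>p\<close>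
    must have an inner vertex. This gives the cycle length at least 3 and ensures that colour
    \<open>c\<close> occurs on it.\<close>
  have noadj: "\<not> adj H v1 v3" using h c(1) unfolding proper_def H_def by metis
  have len: "3 \<le> length p"
  proof (rule ccontr)
    assume "\<not> 3 \<le> length p"
    then show False
      using p2(1-3,5) sm(11) noadj by (cases p; cases "tl p"; cases "tl (tl p)") auto
  qed
  \<comment> \<open>\<open>rev m\<close> is \<open>q\<close> traversed backwards without its ends,
    so \<open>v1\<close> and \<open>v3\<close> are listed once.\<close>
  define K where "K = p @ rev m"
  have hdK: "hd K = v1" using p2 by (simp add: K_def)
  have pm: "set p \<inter> set m = {}"
  proof -
    have "set p \<inter> set q \<subseteq> {v1, v3}" using kempe_paths_verts[OF p] kempe_paths_verts[OF q] pD(4) nv by blast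
    then show ?thesis using m q2(1) by auto
  qed
  have Kext: "K @ [v1] = butlast p @ v3 # (rev m @ [v1])" "v3 # rev m @ [v1] = rev q"
    using p_snoc by (simp_all add: K_def m)
  have sq: "successively (adj H) (rev q)" using q2(2) adj_sym[of H] by (simp add: adj_sym[of H] cong: successively_cong)
  have sK: "successively (adj H) (K @ [v1])"
  proof -
    have "successively (adj H) (rev m @ [v1]) \<and> adj H v3 (hd (rev m @ [v1]))"
      using sq unfolding Kext(2)[symmetric] by (auto simp: successively_Cons)
    then have "successively (adj H) (p @ (rev m @ [v1]))"
      using p2 by (subst successively_append_iff) auto
    then show ?thesis by (simp add: K_def)
  qed
  have cyc: "is_cycle H K"
    unfolding is_cycle_iff hdK using sK len p2(4) pm q2(1) m by (auto simp: K_def)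
  have curve: "cycle_curve H K = path_curve G p \<union> path_curve G1 q"
    unfolding cycle_curve_eq[OF pD(5) cyc] hdK Kext(1) path_curve_append[of H "butlast p" v3 "rev m @ [v1]"]
    unfolding Kext(2) p_snoc[symmetric] path_curve_rev p2(6) q2(3) ..
  have hK: "h ` set K = {h v1, c}"
  proof
    show "h ` set K \<subseteq> {h v1, c}" using p' q' m by (auto simp: K_def)
    have "h v1 \<in> h ` set K" using hdK len by (metis K_def append_is_Nil_conv hd_in_set image_eqI p2(1))
    obtain x where x: "x \<in> set K" "adj H v1 x"
    proof -
      obtain y z where "p = v1 # y # z" using len p2(2) by (cases p; cases "tl p") auto
      then show thesis using that[of y] p2(5) by (simp add: K_def)
    qed
    have "h x \<noteq> h v1" using h x(2) unfolding proper_def H_def by metis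
    then have "h x = c" using \<open>h ` set K \<subseteq> {h v1, c}\<close> x(1) by blast
    then show "{h v1, c} \<subseteq> h ` set K" using x(1) \<open>h v1 \<in> h ` set K\<close> by blast
  qed
  define h' where "h' = swap_inside H K (h v2) d h"
  show thesis
  proof
    have "bichromatic_cycle H h K" using cyc c(3) by (simp add: bichromatic_cycle_def hK)
    moreover have "{h v2, d} = {1..4} - h ` set K" unfolding hK c(4)[symmetric] using c(3) by auto
    ultimately show "sigma_step (graph_union G G1) h h'"
      unfolding sigma_step_def H_def[symmetric] h'_def using c(3) by (intro exI[of _ K] exI[of _ "h v2"] exI[of _ d]) auto
    have V: "v1 \<in> verts H" "v2 \<in> verts H" "v4 \<in> verts H" using sm(14) pD(6) by (auto simp: subdrawing_def)
    have "v1 \<notin> inside (cycle_curve H K)"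
      using inside_no_overlap[of "cycle_curve H K"] arc_betweenD(2)[OF Q(1)] unfolding curve by blast
    then have "h' v1 = h v1" "h' v2 \<noteq> h' v4 \<and> h' v2 \<in> {h v2, d} \<and> h' v4 \<in> {h v2, d}"
      using ins c V unfolding h'_def swap_inside_def curve by auto
    then have "{h v1, h v2, d} \<subseteq> h' ` {v1, v2, v3, v4}" by auto
    then have "card {h v1, h v2, d} \<le> card (h' ` {v1, v2, v3, v4})" by (rule card_mono[rotated]) simp
    then show "card (h' ` {v1, v2, v3, v4}) \<noteq> 2" using c(3) by auto
  qed
qed

text \<open>By the crossing step at most one part has a path between \<open>v1\<close> and
  \<open>v3\<close>. By the same step on the rotated quadrangle at most one has a dual path between
  \<open>v2\<close> and \<open>v4\<close>, and the dichotomy in each part turns this into at least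
  one path between \<open>v1\<close> and \<open>v3\<close>.\<close>

lemma pasted_paths_complementary:
  assumes pa: "pasted G G1 v1 v2 v3 v4" and h: "proper (graph_union G G1) h"
    and c: "h v3 = h v1" "h v4 = h v2" "distinct [h v1, h v2, c, d]" "{h v1, h v2, c, d} = {1..4}"
    and ub: "\<And>h'. sigma_step (graph_union G G1) h h' \<Longrightarrow> card (h' ` {v1, v2, v3, v4}) = 2"
  shows "kempe_paths G h (h v1) c v1 v3 \<noteq> {} \<longleftrightarrow> kempe_paths G1 h (h v1) c v1 v3 = {}"
proof -
  note pD = pastedD[OF pa]
  have hG: "proper G h" "proper G1 h" using h proper_subdrawing pD(6,7) by blast+
  note d1 = kempe_paths_dichotomy[OF pD(1) hG(1) c] and d2 = kempe_paths_dichotomy[OF pD(2) hG(2) c]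
  have n1: "kempe_paths G h (h v1) c v1 v3 = {} \<or> kempe_paths G1 h (h v1) c v1 v3 = {}"
    using pasted_crossing_step[OF pa h c] ub by blast
  have "kempe_paths G h (h v2) d v2 v4 = {} \<or> kempe_paths G1 h (h v2) d v2 v4 = {}"
  proof (rule ccontr)
    assume "\<not> ?thesis"
    then obtain p q where pq: "p \<in> kempe_paths G h (h v2) d v2 v4" "q \<in> kempe_paths G1 h (h v2) d v2 v4" by blast
    have "distinct [h v2, h v3, d, c]" "{h v2, h v3, d, c} = {1..4}" using c by auto
    then obtain h' where "sigma_step (graph_union G G1) h h'" "card (h' ` {v2, v3, v4, v1}) \<noteq> 2"
      using pasted_crossing_step[OF pasted_rotate[OF pa] h _ _ _ _ pq] c by metis
    then show False using ub by (metis insert_commute)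
  qed
  then show ?thesis using n1 d1 d2 by blast
qed


section \<open>Restricting a Kempe class to one side of the quadrangle\<close>

lemma jordan_side_unbounded:
  assumes "jordan_side J D"
  shows "bounded D \<longleftrightarrow> D = inside J" "bounded (inside J)" "\<not> bounded (outside J)"
proof -
  obtain \<gamma> where g: "simple_path \<gamma>" "pathfinish \<gamma> = pathstart \<gamma>" "path_image \<gamma> = J" and D: "D = inside J \<or> D = outside J"
    using assms unfolding jordan_side_def by blast
  show "bounded (inside J)" "\<not> bounded (outside J)"
    using Jordan_inside_outside[OF g(1,2), unfolded g(3)] by auto
  then show "bounded D \<longleftrightarrow> D = inside J" using D by auto
qed

lemma smpg_iff:
  "smpg G [v1, v2, v3, v4] \<longleftrightarrow> smpg_at (outside (cycle_curve G [v1, v2, v3, v4])) G [v1, v2, v3, v4]"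
proof
  assume "smpg G [v1, v2, v3, v4]"
  then obtain F where F: "\<not> bounded F" "smpg_at F G [v1, v2, v3, v4]" unfolding smpg_def by blast
  then have "F = outside (cycle_curve G [v1, v2, v3, v4])"
    using smpg_atD(4)[OF F(2)] jordan_side_unbounded unfolding jordan_side_def by blast
  then show "smpg_at (outside (cycle_curve G [v1, v2, v3, v4])) G [v1, v2, v3, v4]" using F by simp
next
  assume s: "smpg_at (outside (cycle_curve G [v1, v2, v3, v4])) G [v1, v2, v3, v4]"
  then show "smpg G [v1, v2, v3, v4]"
    unfolding smpg_def using jordan_side_unbounded(3)[OF smpg_atD(4)[OF s]] by blast
qed

text \<open>\<open>outside J\<close> is connected, unbounded and misses \<open>X\<close>, so it lies
  in no bounded component of the complement of \<open>X\<close>; the points of \<open>J\<close>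
  follow by passing to the closure. Consequently a cycle drawn in \<open>G\<close> encloses nothing
  of the exterior graph.\<close>

lemma inside_avoids_outside:
  assumes D: "jordan_side J (outside J)" and X: "closed X" "X \<subseteq> J \<union> inside J"
  shows "inside X \<inter> (J \<union> outside J) = {}"
proof -
  have dis: "outside J \<inter> X = {}" using X(2) inside_Int_outside[of J] outside_no_overlap[of J] by blast
  have "inside X \<inter> outside J = {}"
  proof (rule ccontr)
    assume "inside X \<inter> outside J \<noteq> {}"
    then obtain z where z: "z \<in> inside X" "z \<in> outside J" by blast
    have "outside J \<subseteq> connected_component_set (- X) z"
      by (rule connected_component_maximal) (use z jordan_sideD(2)[OF D] dis in auto)
    then have "bounded (outside J)" using z(1) bounded_subset by (auto simp: inside_def)
    then show False using jordan_side_unbounded(3)[OF D] by blast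
  qed
  moreover have "J \<subseteq> closure (outside J)" using jordan_sideD(4)[OF D] by (auto simp: frontier_def)
  ultimately have "inside X \<inter> closure (outside J) = {}"
    using open_Int_closure_eq_empty[OF open_inside[OF X(1)]] by blast
  then show ?thesis using \<open>J \<subseteq> closure (outside J)\<close> closure_subset[of "outside J"] by blast
qed

lemma closed_cycle_curve:
  assumes "plane_graph G"
  shows "closed (cycle_curve G K)"
  unfolding cycle_curve_def
proof (rule closed_Union)
  show "finite (cycle_edges G K)" using assms by (simp add: cycle_edges_def plane_graph_def)
  show "\<forall>e\<in>cycle_edges G K. closed e"
  proof
    fix e assume "e \<in> cycle_edges G K"
    then have "e \<in> edges G" by (simp add: cycle_edges_def)
    then show "closed e" using plane_graph_edgeE[OF assms] arc_betweenD(4) compact_imp_closed by metis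
  qed
qed

lemma pasted_inside:
  assumes "pasted G G1 v1 v2 v3 v4" "v \<in> verts G1"
  shows "v \<notin> inside (cycle_curve G K)"
proof -
  let ?J = "cycle_curve G [v1, v2, v3, v4]"
  note pD = pastedD[OF assms(1)]
  have D: "jordan_side ?J (outside ?J)" "jordan_side ?J (inside ?J)"
    using smpg_atD(4)[OF pD(1)] smpg_atD(4)[OF pD(2)] pD(3) by auto
  have dj: "outside ?J \<inter> inside ?J = {}" "inside ?J \<inter> outside ?J = {}" by (auto simp: Int_commute)
  have "cycle_curve G K \<subseteq> \<Union>(edges G)" unfolding cycle_curve_def cycle_edges_def by blast
  then have "cycle_curve G K \<subseteq> ?J \<union> inside ?J" using smpg_at_subset[OF pD(1) D(2) dj(1)] by blast
  then have "inside (cycle_curve G K) \<inter> (?J \<union> outside ?J) = {}"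
    by (rule inside_avoids_outside[OF D(1) closed_cycle_curve[OF smpg_atD(1)[OF pD(1)]]])
  moreover have "v \<in> ?J \<union> outside ?J"
    using smpg_at_subset[OF pD(2) _ dj(2)] D(1) assms(2) pD(3) by auto
  ultimately show ?thesis by blast
qed

text \<open>Every step in \<open>G\<close> is replayed in the pasted graph. A cycle of
  \<open>G\<close> has the same curve there and no vertex of \<open>G1\<close> inside it, so the
  colours on \<open>G1\<close> change by renamings only, which accumulate in \<pi>.\<close>

lemma pasted_lift:
  assumes pa: "pasted G G1 v1 v2 v3 v4" and f: "colouring 4 (graph_union G G1) f"
    and g: "g \<in> kempe_class G (restrict f (verts G))"
  obtains h \<pi> where "h \<in> kempe_class (graph_union G G1) f" "g = restrict h (verts G)" "\<pi> permutes {1..4}"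
    "\<And>v. v \<in> verts G1 \<Longrightarrow> h v = \<pi> (f v)"
proof -
  define H where "H = graph_union G G1"
  note pD = pastedD[OF pa, folded H_def]
  have GH: "verts G \<subseteq> verts H" using pD(6) by (simp add: subdrawing_def)
  have "(\<lambda>h h'. sigma_step G h h' \<or> renaming G h h')\<^sup>*\<^sup>* (restrict f (verts G)) g"
    using g by (simp add: kempe_class_def)
  then have "\<exists>h \<pi>. h \<in> kempe_class H f \<and> g = restrict h (verts G) \<and> \<pi> permutes {1..4} \<and> (\<forall>v\<in>verts G1. h v = \<pi> (f v))"
  proof (induction rule: rtranclp_induct)
    case base
    show ?case by (rule exI[of _ f], rule exI[of _ id], intro conjI kempe_class_refl refl permutes_id ballI) simp
  next
    case (step y z)
    then obtain h \<pi> where h: "h \<in> kempe_class H f" "y = restrict h (verts G)" "\<pi> permutes {1..4}" "\<forall>v\<in>verts G1. h v = \<pi> (f v)"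
      by blast
    from step(2) show ?case
    proof
      assume "sigma_step G y z"
      then obtain K s t where K: "bichromatic_cycle G y K" "s \<noteq> t" "{s, t} = {1..4} - y ` set K" "z = swap_inside G K s t y"
        unfolding sigma_step_def by blast
      have cG: "is_cycle G K" and c2: "card (y ` set K) = 2" using K(1) by (auto simp: bichromatic_cycle_def)
      note cH = subdrawing_cycle[OF pD(6) cG]
      have "set K \<subseteq> verts G" using cG by (simp add: is_cycle_def)
      then have yh: "y ` set K = h ` set K" unfolding h(2) by (intro image_cong) auto
      define h' where "h' = swap_inside H K s t h"
      have "sigma_step H h h'" unfolding sigma_step_def bichromatic_cycle_def h'_def
        using cH(1) c2 K(2,3) yh by (intro exI[of _ K] exI[of _ s] exI[of _ t]) simp
      then have "h' \<in> kempe_class H f" using kempe_class_step h(1) by blast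
      moreover have "z = restrict h' (verts G)"
        unfolding K(4) h(2) h'_def swap_inside_def cH(2) using GH by (auto simp: fun_eq_iff)
      moreover have "\<forall>v\<in>verts G1. h' v = \<pi> (f v)"
        using pasted_inside[OF pa] h(4) unfolding h'_def swap_inside_def cH(2) by simp
      ultimately show ?thesis using h(3) by blast
    next
      assume "renaming G y z"
      then obtain \<rho> where r: "\<rho> permutes {1..4}" "z = restrict (\<rho> \<circ> y) (verts G)" unfolding renaming_def by blast
      define h' where "h' = restrict (\<rho> \<circ> h) (verts H)"
      have "renaming H h h'" unfolding renaming_def h'_def using r(1) by blast
      then have "h' \<in> kempe_class H f" using kempe_class_step h(1) by blast
      moreover have "z = restrict h' (verts G)"
        unfolding r(2) h(2) h'_def using GH by (auto simp: fun_eq_iff)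
      moreover have "\<forall>v\<in>verts G1. h' v = (\<rho> \<circ> \<pi>) (f v)"
        unfolding h'_def using h(4) pD(7) by (auto simp: subdrawing_def)
      moreover have "\<rho> \<circ> \<pi> permutes {1..4}" using permutes_compose[OF h(3) r(1)] .
      ultimately show ?thesis by blast
    qed
  qed
  then show thesis using that unfolding H_def by blast
qed

lemma F2_iff: "f \<in> F2 G [v1, v2, v3, v4] \<longleftrightarrow> colouring 4 G f \<and> card (f ` {v1, v2, v3, v4}) = 2"
  by (simp add: F2_def)

lemma shared_endpoint_24_iff:
  "shared_endpoint_24 G [v1, v2, v3, v4] f \<longleftrightarrow> f \<in> F2 G [v1, v2, v3, v4] \<and>
     (\<forall>i \<in> {1..4} - {f v1, f v2}. kempe_paths G f (f v1) i v1 v3 = {})"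
  by (simp add: shared_endpoint_24_def numeral_2_eq_2)

lemma shared_endpoint_13_iff:
  "shared_endpoint_13 G [v1, v2, v3, v4] f \<longleftrightarrow> f \<in> F2 G [v1, v2, v3, v4] \<and>
     (\<forall>i \<in> {1..4} - {f v1, f v2}. kempe_paths G f (f v1) i v1 v3 \<noteq> {})"
  by (simp add: shared_endpoint_13_def numeral_2_eq_2)

lemma base_module4_pasted:
  assumes "base_module4 G [v1, v2, v3, v4]"
  obtains G1 where "pasted G G1 v1 v2 v3 v4" "UBCMPG (graph_union G G1) [v1, v2, v3, v4]"
proof -
  let ?C = "[v1, v2, v3, v4]"
  obtain G1 where G1: "smpg G ?C" "exterior_smpg G1 ?C" "verts G \<inter> verts G1 = set ?C"
    "edges G \<inter> edges G1 = cycle_edges G ?C" "UBCMPG (graph_union G G1) ?C"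
    using assms unfolding base_module4_def by blast
  have s: "smpg_at (outside (cycle_curve G ?C)) G ?C" using G1(1) by (simp add: smpg_iff)
  have s1: "smpg_at (inside (cycle_curve G1 ?C)) G1 ?C" using G1(2) by (simp add: exterior_smpg_def)
  note sm = smpg_atD[OF s] and sm1 = smpg_atD[OF s1]
  have H: "plane_graph (graph_union G G1)" using G1(5) by (simp add: UBCMPG_def maximal_plane_def)
  have sub: "subdrawing G (graph_union G G1)" "subdrawing G1 (graph_union G G1)"
    unfolding subdrawing_def using H sm(1) sm1(1) by (auto simp: graph_union_def)
  have "cycle_edges G1 ?C = cycle_edges G ?C"
    using subdrawing_cycle(3)[OF sub(1) sm(3)] subdrawing_cycle(3)[OF sub(2) sm1(3)] by simp
  then have "cycle_curve G1 ?C = cycle_curve G ?C" by (simp add: cycle_curve_def)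
  then have "pasted G G1 v1 v2 v3 v4" unfolding pasted_def using s s1 H G1(3) by simp
  then show thesis using that G1(5) by blast
qed

lemma base_module4_imp_shared_endpoint:
  assumes "base_module4 G [v1, v2, v3, v4]"
  shows "\<exists>f0 \<in> F2 G [v1, v2, v3, v4].
       (\<forall>f \<in> kempe_class G f0. shared_endpoint_24 G [v1, v2, v3, v4] f) \<or>
       (\<forall>f \<in> kempe_class G f0. shared_endpoint_13 G [v1, v2, v3, v4] f)"
proof -
  let ?C = "[v1, v2, v3, v4]"
  obtain G1 where pa: "pasted G G1 v1 v2 v3 v4" and ubc: "UBCMPG (graph_union G G1) ?C"
    by (rule base_module4_pasted[OF assms])
  define H where "H = graph_union G G1"
  note pD = pastedD[OF pa, folded H_def]
  note sm = smpg_atD[OF pD(1)]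
  have vG: "{v1, v2, v3, v4} \<subseteq> verts G" and vG1: "{v1, v2, v3, v4} \<subseteq> verts G1" using pD(4) by blast+
  obtain f where f: "colouring 4 H f" "bichromatic_cycle H f ?C" and ub: "\<And>f'. f' \<in> kempe_class H f \<Longrightarrow> card (f' ` {v1, v2, v3, v4}) = 2"
    using ubc unfolding UBCMPG_def UB_cycle_def H_def by auto
  have colH: "colouring 4 H h" if "h \<in> kempe_class H f" for h
    by (rule kempe_class_colouring[OF pD(5) f(1) that])
  have cycH: "is_cycle H ?C" using f(2) by (simp add: bichromatic_cycle_def)
  have quad: "h v3 = h v1" "h v4 = h v2" "h v1 \<noteq> h v2" "h v1 \<in> {1..4}" "h v2 \<in> {1..4}" if "h \<in> kempe_class H f" for h
    using quadrangle_colours[OF _ cycH ub[OF that]] colH[OF that] unfolding colouring_iff_proper by blast+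
  define T where "T c \<longleftrightarrow> kempe_paths G1 f (f v1) c v1 v3 = {}" for c
  have complementary: "kempe_paths G h (h v1) c v1 v3 \<noteq> {} \<longleftrightarrow> kempe_paths G1 h (h v1) c v1 v3 = {}"
    if h: "h \<in> kempe_class H f" and c: "c \<in> {1..4} - {h v1, h v2}" for h c
  proof -
    obtain d where "distinct [h v1, h v2, c, d]" "{h v1, h v2, c, d} = {1..4}"
      using remaining_colours quad(3-5)[OF h] c by metis
    moreover have "proper H h" using colH[OF h] by (simp add: colouring_iff_proper)
    ultimately show ?thesis
      using pasted_paths_complementary[OF pa, folded H_def] quad(1,2)[OF h] ub kempe_class_step[OF h] by blast
  qed
  note ff = quad[OF kempe_class_refl]
  \<comment> \<open>The change at the quadrangle swaps \<open>c\<close> and \<open>d\<close>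
    throughout \<open>G\<close> and fixes \<open>G1\<close>. Complementarity after it compares the
    \<open>c\<close>-paths of \<open>G1\<close> with the former \<open>d\<close>-paths of
    \<open>G\<close>.\<close>
  have T_const: "T c \<longleftrightarrow> T d" if cd: "distinct [f v1, f v2, c, d]" "{f v1, f v2, c, d} = {1..4}" for c d
  proof -
    define f' where "f' = swap_inside H ?C c d f"
    have fC: "f ` set ?C = {f v1, f v2}" using ff by auto
    have "{c, d} = {1..4} - f ` set ?C" unfolding fC cd(2)[symmetric] using cd(1) by auto
    then have "sigma_step H f f'" unfolding sigma_step_def f'_def using f(2) cd(1)
      by (intro exI[of _ ?C] exI[of _ c] exI[of _ d]) simp
    then have f': "f' \<in> kempe_class H f" using kempe_class_step kempe_class_refl by blast
    have cG: "cycle_curve H ?C = cycle_curve G ?C" by (rule subdrawing_cycle(2)[OF pD(6) sm(3)])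
    have f'1: "f' v = f v" if "v \<in> verts G1" for v
      using pasted_inside[OF pa that] unfolding f'_def swap_inside_def cG by simp
    have f'v: "f' v1 = f v1" "f' v2 = f v2" using f'1 vG1 by auto
    \<comment> \<open>Vertices on the quadrangle are not recoloured, but there the transposition
      acts trivially because neither \<open>c\<close> nor \<open>d\<close> occurs.\<close>
    have f'G: "f' v = Transposition.transpose c d (f v)" if v: "v \<in> verts G" for v
    proof (cases "v \<in> inside (cycle_curve G ?C)")
      case True
      then show ?thesis using v pD(6) unfolding f'_def swap_inside_def cG by (auto simp: subdrawing_def)
    next
      case False
      have io: "outside (cycle_curve G ?C) \<inter> inside (cycle_curve G ?C) = {}" by (simp add: Int_commute)
      have "jordan_side (cycle_curve G ?C) (inside (cycle_curve G ?C))"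
        using smpg_atD(4)[OF pD(2)] pD(3) by simp
      then have "v \<in> cycle_curve G ?C" using smpg_at_subset[OF pD(1) _ io] v False by blast
      then have "v \<in> {v1, v2, v3, v4}" using cycle4_curve_verts[OF sm(1,3)] v by blast
      then have "f v \<in> {f v1, f v2}" "f' v = f v" using ff f'1 vG1 by auto
      then show ?thesis using cd(1) by (auto simp: Transposition.transpose_def)
    qed
    have c4: "c \<in> {1..4} - {f v1, f v2}" "d \<in> {1..4} - {f v1, f v2}" unfolding cd(2)[symmetric] using cd(1) by auto
    have "kempe_paths G f' (f v1) c v1 v3 = kempe_paths G f (f v1) d v1 v3"
      by (rule kempe_paths_cong) (use f'G cd(1) in \<open>auto simp: Transposition.transpose_def split: if_splits\<close>)
    moreover have "kempe_paths G1 f' (f v1) c v1 v3 = kempe_paths G1 f (f v1) c v1 v3"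
      by (rule kempe_paths_cong) (use f'1 in auto)
    ultimately show ?thesis
      using complementary[OF f', of c] complementary[OF kempe_class_refl c4(2)] c4(1) unfolding T_def f'v by simp
  qed
  obtain c where c: "c \<in> {1..4} - {f v1, f v2}" by (rule third_colour)
  have T_all: "T x \<longleftrightarrow> T c" if x: "x \<in> {1..4} - {f v1, f v2}" for x
  proof -
    obtain d where d: "distinct [f v1, f v2, c, d]" "{f v1, f v2, c, d} = {1..4}"
      using remaining_colours[OF ff(4,5,3) c] by blast
    then have "x = c \<or> x = d" using x by blast
    then show ?thesis using T_const[OF d] by blast
  qed
  define f0 where "f0 = restrict f (verts G)"
  have main: "g \<in> F2 G ?C \<and> (\<forall>i \<in> {1..4} - {g v1, g v2}. kempe_paths G g (g v1) i v1 v3 \<noteq> {} \<longleftrightarrow> T c)"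
    if g: "g \<in> kempe_class G f0" for g
  proof -
    obtain h \<pi> where h: "h \<in> kempe_class H f" "g = restrict h (verts G)" "\<pi> permutes {1..4}"
      "\<And>v. v \<in> verts G1 \<Longrightarrow> h v = \<pi> (f v)"
      using pasted_lift[OF pa _ g[unfolded f0_def], folded H_def, OF f(1)] by blast
    have gh: "g v = h v" if "v \<in> verts G" for v using that h(2) by simp
    have "proper G h" using proper_subdrawing[OF pD(6)] colH[OF h(1)] by (simp add: colouring_iff_proper)
    then have "proper G g" by (rule proper_cong) (simp add: gh)
    then have "colouring 4 G g" using h(2) by (simp add: colouring_iff_proper)
    moreover have "g ` {v1, v2, v3, v4} = h ` {v1, v2, v3, v4}" using gh vG by (intro image_cong) auto
    ultimately have "g \<in> F2 G ?C" using ub[OF h(1)] by (simp add: F2_iff)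
    moreover have "kempe_paths G g (g v1) i v1 v3 \<noteq> {} \<longleftrightarrow> T c" if i: "i \<in> {1..4} - {g v1, g v2}" for i
    proof -
      have g12: "g v1 = h v1" "g v2 = h v2" using gh vG by auto
      have h12: "h v1 = \<pi> (f v1)" "h v2 = \<pi> (f v2)" using h(4) vG1 by auto
      \<comment> \<open>Paths are compared with those of the initial colouring of \<open>G1\<close>,
        in which colour \<open>i\<close> is called \<open>x\<close>.\<close>
      obtain x where x: "i = \<pi> x" using permutes_surj[OF h(3)] by (metis surjD)
      have inj: "\<pi> y = \<pi> z \<longleftrightarrow> y = z" for y z using permutes_inj[OF h(3)] by (simp add: inj_eq)
      have "x \<in> {1..4}" using i permutes_in_image[OF h(3), of x] unfolding x by blast
      then have x4: "x \<in> {1..4} - {f v1, f v2}" using i unfolding x g12 h12 by auto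
      have "kempe_paths G g (g v1) i v1 v3 = kempe_paths G h (h v1) i v1 v3"
        unfolding g12 by (rule kempe_paths_cong) (simp add: gh)
      moreover have "kempe_paths G1 h (h v1) i v1 v3 = kempe_paths G1 f (f v1) x v1 v3"
        by (rule kempe_paths_cong) (use h(4) in \<open>simp add: x h12 inj\<close>)
      ultimately show ?thesis
        using complementary[OF h(1), of i] i T_all[OF x4] unfolding g12 T_def by simp
    qed
    ultimately show ?thesis by blast
  qed
  have "f0 \<in> F2 G ?C" using main kempe_class_refl by blast
  \<comment> \<open>\<open>T c\<close> says that \<open>G1\<close> lacks the path, hence that
    \<open>G\<close> has it: this selects the second alternative.\<close>
  then show ?thesis
    unfolding shared_endpoint_24_iff shared_endpoint_13_iff
    using main by (cases "T c") (intro bexI[of _ f0]; blast)+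
qed


section \<open>Adding paths and chords inside a face\<close>

definition points :: "drawing \<Rightarrow> complex set" where
  "points G = verts G \<union> \<Union>(edges G)"

definition add_vertex :: "complex \<Rightarrow> drawing \<Rightarrow> drawing" where
  "add_vertex a G = \<lparr>verts = insert a (verts G), edges = edges G\<rparr>"

definition add_edge :: "complex set \<Rightarrow> drawing \<Rightarrow> drawing" where
  "add_edge c G = \<lparr>verts = verts G, edges = insert c (edges G)\<rparr>"

section \<open>Inserting vertices, edges and crosscuts into a drawing\<close>

lemma plane_graphI:
  assumes "finite (verts G)" "finite (edges G)"
    "\<And>e. e \<in> edges G \<Longrightarrow> \<exists>u\<in>verts G. \<exists>v\<in>verts G. arc_between e u v \<and> e \<inter> verts G = {u, v}"
    "\<And>e e'. e \<in> edges G \<Longrightarrow> e' \<in> edges G \<Longrightarrow> e \<noteq> e' \<Longrightarrow> e \<inter> e' \<subseteq> verts G \<and> e \<inter> verts G \<noteq> e' \<inter> verts G"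
  shows "plane_graph G"
  unfolding plane_graph_def using assms by blast

lemma add_vertex_plane:
  assumes G: "plane_graph G" and a: "a \<notin> points G"
  shows "subdrawing G (add_vertex a G)" "adj (add_vertex a G) w z \<longleftrightarrow> adj G w z"
proof -
  have e: "e \<inter> insert a (verts G) = e \<inter> verts G" if "e \<in> edges G" for e
    using that a by (auto simp: points_def)
  have "plane_graph (add_vertex a G)"
  proof (rule plane_graphI)
    show "finite (verts (add_vertex a G))" "finite (edges (add_vertex a G))"
      using G by (simp_all add: add_vertex_def plane_graph_def)
    fix x assume x: "x \<in> edges (add_vertex a G)"
    obtain u v where "arc_between x u v" "x \<inter> verts G = {u, v}" "u \<in> verts G" "v \<in> verts G"
      using plane_graph_edgeE[OF G] x adj_verts by (metis add_vertex_def drawing.select_convs(2))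
    then show "\<exists>u\<in>verts (add_vertex a G). \<exists>v\<in>verts (add_vertex a G). arc_between x u v \<and> x \<inter> verts (add_vertex a G) = {u, v}"
      using e x by (intro bexI[of _ u] bexI[of _ v]) (auto simp: add_vertex_def)
    fix y assume y: "y \<in> edges (add_vertex a G)" "x \<noteq> y"
    have "x \<inter> verts G \<noteq> y \<inter> verts G" using plane_edge_unique[OF G, of x y] x y by (auto simp: add_vertex_def)
    then show "x \<inter> y \<subseteq> verts (add_vertex a G) \<and> x \<inter> verts (add_vertex a G) \<noteq> y \<inter> verts (add_vertex a G)"
      using plane_edges_inter[OF G, of x y] x y e[of x] e[of y] by (auto simp: add_vertex_def)
  qed
  then show "subdrawing G (add_vertex a G)" using G by (auto simp: subdrawing_def add_vertex_def)
  show "adj (add_vertex a G) w z \<longleftrightarrow> adj G w z"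
    unfolding adj_def add_vertex_def using e by auto
qed

lemma add_edge_plane:
  assumes G: "plane_graph G" and c: "arc_between c u v" "c \<inter> verts G = {u, v}" "c \<inter> \<Union>(edges G) \<subseteq> {u, v}"
    and n: "\<not> adj G u v"
  shows "subdrawing G (add_edge c G)" "adj (add_edge c G) w z \<longleftrightarrow> adj G w z \<or> {w, z} = {u, v}"
proof -
  have uv: "u \<noteq> v" by (rule arc_betweenD(1)[OF c(1)])
  have old: "x \<inter> c \<subseteq> verts G \<and> x \<inter> verts G \<noteq> c \<inter> verts G" if "x \<in> edges G" for x
    using that c(2,3) n uv by (auto simp: adj_def)
  have "plane_graph (add_edge c G)"
  proof (rule plane_graphI)
    show "finite (verts (add_edge c G))" "finite (edges (add_edge c G))"
      using G by (simp_all add: add_edge_def plane_graph_def)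
    fix x assume x: "x \<in> edges (add_edge c G)"
    show "\<exists>u\<in>verts (add_edge c G). \<exists>v\<in>verts (add_edge c G). arc_between x u v \<and> x \<inter> verts (add_edge c G) = {u, v}"
    proof (cases "x = c")
      case True
      then show ?thesis using c by (intro bexI[of _ u] bexI[of _ v]) (auto simp: add_edge_def)
    next
      case False
      then have "x \<in> edges G" using x by (simp add: add_edge_def)
      then obtain u v where "arc_between x u v" "x \<inter> verts G = {u, v}" "u \<in> verts G" "v \<in> verts G"
        using plane_graph_edgeE[OF G] adj_verts by metis
      then show ?thesis by (intro bexI[of _ u] bexI[of _ v]) (auto simp: add_edge_def)
    qed
    fix y assume y: "y \<in> edges (add_edge c G)" "x \<noteq> y"
    show "x \<inter> y \<subseteq> verts (add_edge c G) \<and> x \<inter> verts (add_edge c G) \<noteq> y \<inter> verts (add_edge c G)"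
    proof (cases "x \<in> edges G \<and> y \<in> edges G")
      case True
      then show ?thesis using plane_edge_unique[OF G, of x y] plane_edges_inter[OF G, of x y] y(2) by (simp add: add_edge_def) blast
    next
      case False
      then have "x = c \<and> y \<in> edges G \<or> y = c \<and> x \<in> edges G" using x y by (auto simp: add_edge_def)
      then show ?thesis using old[of x] old[of y] by (auto simp: add_edge_def Int_commute)
    qed
  qed
  then show "subdrawing G (add_edge c G)" using G by (auto simp: subdrawing_def add_edge_def)
  show "adj (add_edge c G) w z \<longleftrightarrow> adj G w z \<or> {w, z} = {u, v}"
    unfolding adj_def add_edge_def using c(2) uv by (auto simp: doubleton_eq_iff)
qed

lemma face_bounded_by_subdrawing:
  assumes "subdrawing G H" "face_bounded_by G F T" "F \<in> faces H"
  shows "face_bounded_by H F T"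
  using assms subdrawing_cycle[OF assms(1), of T] by (simp add: face_bounded_by_def)

lemma triangular_face_subdrawing:
  assumes "subdrawing G H" "triangular_face G F" "F \<in> faces H"
  shows "triangular_face H F"
  using assms face_bounded_by_subdrawing unfolding triangular_face_def by blast

text \<open>Of the new drawing only the point set enters, so the same computation of faces covers a
  chord and a path of two edges with a new middle vertex.\<close>

lemma crosscut_faces:
  assumes G: "plane_graph G" and F: "face_bounded_by G F [u, x, v, y]"
    and c: "arc_between c u v" "c - {u, v} \<subseteq> F" and G': "points G' = points G \<union> c"
  obtains F1 F2 where "faces G' = faces G - {F} \<union> {F1, F2}" "F1 \<subseteq> F" "F2 \<subseteq> F" "F1 \<inter> F2 = {}" "F1 \<noteq> {}" "F2 \<noteq> {}"
    "frontier F1 = edge G u x \<union> edge G x v \<union> c" "frontier F2 = edge G v y \<union> edge G y u \<union> c"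
proof -
  have FG: "F \<in> faces G" and cyc: "is_cycle G [u, x, v, y]" using F by (simp_all add: face_bounded_by_def)
  note J = cycle4_arcs[OF G cyc]
  note D = quadrangular_face_side[OF G F, unfolded J(1)]
  obtain F1 F2 where A: "jordan_side (edge G u x \<union> edge G x v \<union> c) F1" "jordan_side (edge G v y \<union> edge G y u \<union> c) F2"
    "F1 \<inter> F2 = {}" "F1 \<union> F2 = F - c"
    by (rule jordan_crosscut[OF D J(2-4) c])
  have uvc: "u \<in> points G" "v \<in> points G" using cyc by (auto simp: is_cycle_def points_def)
  have Fp: "F \<inter> points G = {}" using faces_basic(4)[OF G FG] by (simp add: points_def)
  have "faces G' = faces G - {F} \<union> {F1, F2}"
  proof (rule faces_eqI)
    have old: "X \<inter> c = {}" if "X \<in> faces G - {F}" for X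
    proof -
      have "X \<inter> F = {}" "X \<inter> points G = {}"
        using that faces_disjoint[of X G F] FG faces_basic(4)[OF G, of X] by (auto simp: points_def)
      then show ?thesis using c(2) uvc by blast
    qed
    have "\<Union>(faces G - {F}) = - points G - F"
      using faces_Union[of G] faces_disjoint[of _ G F] FG by (auto simp: points_def)
    then have "\<Union>(faces G - {F} \<union> {F1, F2}) = (- points G - F) \<union> (F - c)" using A(4) by auto
    also have "\<dots> = - points G'" unfolding G' using Fp c(2) uvc by auto
    finally show "\<Union>(faces G - {F} \<union> {F1, F2}) = - (verts G' \<union> \<Union>(edges G'))" by (simp add: points_def)
    have F12: "F1 \<subseteq> F" "F2 \<subseteq> F" using A(4) by auto
    fix X assume X: "X \<in> faces G - {F} \<union> {F1, F2}"
    then show "open X \<and> connected X \<and> X \<noteq> {}"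
      using faces_basic(1-3)[OF G] jordan_sideD(1-3)[OF A(1)] jordan_sideD(1-3)[OF A(2)] by auto
    fix Y assume Y: "Y \<in> faces G - {F} \<union> {F1, F2}" "X \<noteq> Y"
    have dj: "Z \<inter> F = {}" if "Z \<in> faces G - {F}" for Z using faces_disjoint[of Z G F] FG that by auto
    consider "X \<in> faces G - {F}" "Y \<in> faces G - {F}" | "X \<in> faces G - {F}" "Y \<subseteq> F" | "X \<subseteq> F" "Y \<in> faces G - {F}"
      | "X = F1" "Y = F2" | "X = F2" "Y = F1"
      using X Y F12 by auto
    then show "X \<inter> Y = {}"
    proof cases
      case 1 then show ?thesis using faces_disjoint[of X G Y] Y(2) by auto
    qed (use dj[of X] dj[of Y] A(3) in auto)
  qed
  then show thesis
    using that A jordan_sideD(3)[OF A(1)] jordan_sideD(3)[OF A(2)] jordan_sideD(4)[OF A(1)] jordan_sideD(4)[OF A(2)]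
    by (metis Diff_subset le_sup_iff)
qed

lemma face_crosscut_exists:
  assumes G: "plane_graph G" and F: "face_bounded_by G F [u, x, v, y]"
  obtains c where "arc_between c u v" "c - {u, v} \<subseteq> F" "c \<inter> points G = {u, v}"
proof -
  have FG: "F \<in> faces G" and cyc: "is_cycle G [u, x, v, y]" using F by (simp_all add: face_bounded_by_def)
  have adj: "adj G u x" "adj G x v" and uv: "u \<noteq> v" using cyc by (auto simp: is_cycle4)
  have "u \<in> cycle_curve G [u, x, v, y]" "v \<in> cycle_curve G [u, x, v, y]"
    unfolding cycle4_arcs(1)[OF G cyc] using edgeD(2)[OF G adj(1)] edgeD(2)[OF G adj(2)] by auto
  then obtain c where c: "arc_between c u v" "c - {u, v} \<subseteq> F"
    using jordan_crosscut_exists[OF quadrangular_face_side[OF G F] _ _ uv] by metis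
  moreover have "c \<inter> points G = {u, v}"
    using faces_basic(4)[OF G FG] c(2) arc_betweenD(2,3)[OF c(1)] cyc by (auto simp: points_def is_cycle_def)
  ultimately show thesis using that by blast
qed

lemma add_chord:
  assumes G: "plane_graph G" and F: "face_bounded_by G F [u, x, v, y]" and n: "\<not> adj G u v"
  obtains c F1 F2 where "arc_between c u v" "subdrawing G (add_edge c G)"
    "\<And>w z. adj (add_edge c G) w z \<longleftrightarrow> adj G w z \<or> {w, z} = {u, v}"
    "faces (add_edge c G) = faces G - {F} \<union> {F1, F2}"
    "triangular_face (add_edge c G) F1" "triangular_face (add_edge c G) F2"
proof -
  obtain c where c: "arc_between c u v" "c - {u, v} \<subseteq> F" "c \<inter> points G = {u, v}"
    by (rule face_crosscut_exists[OF G F])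
  have cyc: "is_cycle G [u, x, v, y]" using F by (simp add: face_bounded_by_def)
  then have V: "u \<in> verts G" "v \<in> verts G" by (auto simp: is_cycle_def)
  let ?G = "add_edge c G"
  have cv: "c \<inter> verts G = {u, v}" "c \<inter> \<Union>(edges G) \<subseteq> {u, v}" using c(3) V by (auto simp: points_def)
  note ae = add_edge_plane[OF G c(1) cv n]
  have pG: "plane_graph ?G" using ae(1) by (simp add: subdrawing_def)
  have "points ?G = points G \<union> c" by (auto simp: points_def add_edge_def)
  then obtain F1 F2 where f: "faces ?G = faces G - {F} \<union> {F1, F2}"
    "frontier F1 = edge G u x \<union> edge G x v \<union> c" "frontier F2 = edge G v y \<union> edge G y u \<union> c"
    using crosscut_faces[OF G F c(1,2)] by metis
  have A: "adj G u x" "adj G x v" "adj G v y" "adj G y u" using cyc by (auto simp: is_cycle4)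
  have nc: "edge ?G u v = c"
    by (rule edge_eqI[OF pG]) (use cv in \<open>auto simp: add_edge_def\<close>)
  have c1: "is_cycle ?G [u, x, v]" "is_cycle ?G [v, y, u]"
    unfolding is_cycle3 ae(2) using A by (auto simp: insert_commute)
  have ee: "edge ?G u x = edge G u x" "edge ?G x v = edge G x v" "edge ?G v y = edge G v y" "edge ?G y u = edge G y u"
    using subdrawing_edge[OF ae(1)] A by auto
  have "face_bounded_by ?G F1 [u, x, v]" "face_bounded_by ?G F2 [v, y, u]"
    unfolding face_bounded_by_def using c1 f cycle3_arcs(1)[OF pG c1(1)] cycle3_arcs(1)[OF pG c1(2)]
    by (simp_all add: ee nc edge_sym[of ?G v u])
  then have "triangular_face ?G F1" "triangular_face ?G F2"
    unfolding triangular_face_def by (metis length_Cons list.size(3) numeral_3_eq_3)+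
  then show thesis using that[OF c(1) ae f(1)] by blast
qed

text \<open>The new vertex is an arbitrary inner point of a crosscut, which it divides into two
  edges. Inclusion, disjointness and nonemptiness of \<open>F1\<close> and \<open>F2\<close> are
  recorded in order to tell faces apart in later insertions.\<close>

lemma add_path:
  assumes G: "plane_graph G" and F: "face_bounded_by G F [u, x, v, y]"
  obtains a c1 c2 F1 F2 where "a \<in> F" "a \<in> c1" "a \<in> c2" "a \<notin> verts G"
    "subdrawing G (add_edge c2 (add_edge c1 (add_vertex a G)))"
    "\<And>w z. adj (add_edge c2 (add_edge c1 (add_vertex a G))) w z \<longleftrightarrow> adj G w z \<or> {w, z} = {u, a} \<or> {w, z} = {a, v}"
    "faces (add_edge c2 (add_edge c1 (add_vertex a G))) = faces G - {F} \<union> {F1, F2}"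
    "F1 \<subseteq> F" "F2 \<subseteq> F" "F1 \<inter> F2 = {}" "F1 \<noteq> {}" "F2 \<noteq> {}"
    "face_bounded_by (add_edge c2 (add_edge c1 (add_vertex a G))) F1 [u, x, v, a]"
    "face_bounded_by (add_edge c2 (add_edge c1 (add_vertex a G))) F2 [u, a, v, y]"
proof -
  obtain c where c: "arc_between c u v" "c - {u, v} \<subseteq> F" "c \<inter> points G = {u, v}"
    by (rule face_crosscut_exists[OF G F])
  have cyc: "is_cycle G [u, x, v, y]" and FG: "F \<in> faces G" using F by (simp_all add: face_bounded_by_def)
  then have V: "u \<in> verts G" "v \<in> verts G" "u \<noteq> v" by (auto simp: is_cycle_def)
  obtain a where a: "a \<in> c - {u, v}" using arc_betweenD(7)[OF c(1)] by blast
  obtain c1 c2 where cc: "arc_between c1 u a" "arc_between c2 a v" "c1 \<union> c2 = c" "c1 \<inter> c2 = {a}"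
    by (rule arc_between_split[OF c(1) a])
  have ends: "u \<in> c1" "a \<in> c1" "a \<in> c2" "v \<in> c2" using cc(1,2) arc_betweenD(2,3) by auto
  then have nends: "v \<notin> c1" "u \<notin> c2" using cc(4) a by auto
  have aG: "a \<notin> points G" using c(3) a by blast
  then have aV: "a \<notin> verts G" by (simp add: points_def)
  define G1 where "G1 = add_vertex a G"
  define G2 where "G2 = add_edge c1 G1"
  define G3 where "G3 = add_edge c2 G2"
  note av = add_vertex_plane[OF G aG, folded G1_def]
  have pG1: "plane_graph G1" using av(1) by (simp add: subdrawing_def)
  have cp: "z \<in> c \<Longrightarrow> z \<in> verts G \<or> z \<in> \<Union>(edges G) \<Longrightarrow> z = u \<or> z = v" for z using c(3) by (auto simp: points_def)
  have c1V: "c1 \<inter> verts G1 = {u, a}" "c1 \<inter> \<Union>(edges G1) \<subseteq> {u, a}"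
    using cp cc(3) ends nends V unfolding G1_def add_vertex_def by auto
  have n1: "\<not> adj G1 u a" unfolding av(2) using adj_verts[of G u a] aV by blast
  note a1 = add_edge_plane[OF pG1 cc(1) c1V n1, folded G2_def]
  have pG2: "plane_graph G2" using a1(1) by (simp add: subdrawing_def)
  have c2V: "c2 \<inter> verts G2 = {a, v}" "c2 \<inter> \<Union>(edges G2) \<subseteq> {a, v}"
    using cp cc(3,4) ends nends V unfolding G2_def G1_def add_edge_def add_vertex_def by auto
  have n2: "\<not> adj G2 a v" unfolding a1(2) av(2) using adj_verts[of G a v] aV V(3) a by (auto simp: doubleton_eq_iff)
  note a2 = add_edge_plane[OF pG2 cc(2) c2V n2, folded G3_def]
  have pG3: "plane_graph G3" using a2(1) by (simp add: subdrawing_def)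
  have sub: "subdrawing G G3" using av(1) a1(1) a2(1) by (auto simp: subdrawing_def)
  have adj3: "adj G3 w z \<longleftrightarrow> adj G w z \<or> {w, z} = {u, a} \<or> {w, z} = {a, v}" for w z
    unfolding a2(2) a1(2) av(2) by blast
  have "points G3 = points G \<union> c"
    using ends cc(3) by (auto simp: points_def G3_def G2_def G1_def add_edge_def add_vertex_def)
  then obtain F1 F2 where f: "faces G3 = faces G - {F} \<union> {F1, F2}" "F1 \<subseteq> F" "F2 \<subseteq> F" "F1 \<inter> F2 = {}" "F1 \<noteq> {}" "F2 \<noteq> {}"
    "frontier F1 = edge G u x \<union> edge G x v \<union> c" "frontier F2 = edge G v y \<union> edge G y u \<union> c"
    by (rule crosscut_faces[OF G F c(1,2)])
  have A: "adj G u x" "adj G x v" "adj G v y" "adj G y u" "x \<noteq> y" using cyc by (auto simp: is_cycle4)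
  have xy: "x \<noteq> a" "y \<noteq> a" using A adj_verts[of G] aV by blast+
  have e1: "edge G3 u a = c1"
    by (rule edge_eqI[OF pG3]) (use c1V in \<open>auto simp: G3_def G2_def add_edge_def\<close>)
  have e2: "edge G3 a v = c2"
    by (rule edge_eqI[OF pG3]) (use c2V in \<open>auto simp: G3_def add_edge_def\<close>)
  have cyc1: "is_cycle G3 [u, x, v, a]" and cyc2: "is_cycle G3 [u, a, v, y]"
    unfolding is_cycle4 adj3 using A V(3) xy by (auto simp: insert_commute)
  have ee: "edge G3 u x = edge G u x" "edge G3 x v = edge G x v" "edge G3 v y = edge G v y" "edge G3 y u = edge G y u"
    using subdrawing_edge[OF sub] A by auto
  have "face_bounded_by G3 F1 [u, x, v, a]"
    unfolding face_bounded_by_def cycle4_arcs(1)[OF pG3 cyc1] using f(1,7) cyc1 cc(3)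
    by (simp add: ee e1 e2 edge_sym[of G3 v a] edge_sym[of G3 a u]) blast
  moreover have "face_bounded_by G3 F2 [u, a, v, y]"
    unfolding face_bounded_by_def cycle4_arcs(1)[OF pG3 cyc2] using f(1,8) cyc2 cc(3)
    by (simp add: ee e1 e2) blast
  moreover have "a \<in> F" using a c(2) by blast
  ultimately show thesis
    using that[OF _ ends(2,3) aV] sub adj3 f(1-6) unfolding G3_def G2_def G1_def by metis
qed


section \<open>Capping a quadrangle with an octahedral exterior\<close>

lemma face_bounded_by_rotate:
  assumes "plane_graph G" "face_bounded_by G F [a, b, c, d]"
  shows "face_bounded_by G F [b, c, d, a]"
proof -
  have c: "is_cycle G [a, b, c, d]" "is_cycle G [b, c, d, a]" using assms(2) unfolding face_bounded_by_def is_cycle4 by auto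
  have "cycle_curve G [b, c, d, a] = cycle_curve G [a, b, c, d]"
    unfolding cycle_curve_def cycle_edges4[OF assms(1) c(1)] cycle_edges4[OF assms(1) c(2)] by (simp add: insert_commute)
  then show ?thesis using assms(2) c by (simp add: face_bounded_by_def)
qed

lemma subdrawing_restrict:
  assumes "plane_graph G" "V \<subseteq> verts G" "E \<subseteq> edges G" "\<And>e. e \<in> E \<Longrightarrow> e \<inter> verts G \<subseteq> V"
  shows "subdrawing \<lparr>verts = V, edges = E\<rparr> G"
proof -
  let ?G = "\<lparr>verts = V, edges = E\<rparr>"
  have eq: "e \<inter> V = e \<inter> verts G" if "e \<in> E" for e using assms(2) assms(4)[OF that] by blast
  have fin: "finite (verts G)" "finite (edges G)" using assms(1) by (simp_all add: plane_graph_def)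
  have "plane_graph ?G"
  proof (rule plane_graphI)
    show "finite (verts ?G)" "finite (edges ?G)"
      using fin finite_subset assms(2,3) by auto
    fix x assume x: "x \<in> edges ?G"
    then have xG: "x \<in> edges G" "x \<in> E" using assms(3) by auto
    obtain u v where "arc_between x u v" "x \<inter> verts G = {u, v}"
      using plane_graph_edgeE[OF assms(1) xG(1)] by metis
    then show "\<exists>u\<in>verts ?G. \<exists>v\<in>verts ?G. arc_between x u v \<and> x \<inter> verts ?G = {u, v}"
      using eq[OF xG(2)] by (intro bexI[of _ u] bexI[of _ v]) auto
    fix y assume y: "y \<in> edges ?G" "x \<noteq> y"
    then have yG: "y \<in> edges G" "y \<in> E" using assms(3) by auto
    have "x \<inter> verts G \<noteq> y \<inter> verts G" using plane_edge_unique[OF assms(1) xG(1) yG(1)] y(2) by blast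
    moreover have "x \<inter> y \<subseteq> V" using plane_edges_inter[OF assms(1) xG(1) yG(1) y(2)] eq[OF xG(2)] by blast
    ultimately show "x \<inter> y \<subseteq> verts ?G \<and> x \<inter> verts ?G \<noteq> y \<inter> verts ?G"
      using eq[OF xG(2)] eq[OF yG(2)] by simp
  qed
  then show ?thesis using assms by (simp add: subdrawing_def)
qed

lemma subdrawing_trans: "subdrawing G H \<Longrightarrow> subdrawing H K \<Longrightarrow> subdrawing G K"
  unfolding subdrawing_def by blast

text \<open>The bare quadrangle is the start of the cap: its outside is to be triangulated, its
  inside remains free for \<open>G\<close>.\<close>

lemma quadrangle_drawing:
  assumes "smpg_at F0 G [v1, v2, v3, v4]"
  defines "J \<equiv> cycle_curve G [v1, v2, v3, v4]"
  defines "G0 \<equiv> \<lparr>verts = {v1, v2, v3, v4}, edges = cycle_edges G [v1, v2, v3, v4]\<rparr>"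
  shows "subdrawing G0 G" "faces G0 = {inside J, outside J}"
    "face_bounded_by G0 (inside J) [v1, v2, v3, v4]" "face_bounded_by G0 (outside J) [v1, v2, v3, v4]"
    "adj G0 w z \<longleftrightarrow> {w, z} \<in> {{v1, v2}, {v2, v3}, {v3, v4}, {v4, v1}}"
proof -
  note sm = smpg_atD[OF assms(1)]
  note ce = cycle_edges4[OF sm(1,3)]
  have ends: "edge G v1 v2 \<inter> verts G = {v1, v2}" "edge G v2 v3 \<inter> verts G = {v2, v3}"
    "edge G v3 v4 \<inter> verts G = {v3, v4}" "edge G v4 v1 \<inter> verts G = {v4, v1}"
    using edgeD(2)[OF sm(1)] sm(7-10) by blast+
  show sub: "subdrawing G0 G"
    unfolding G0_def
  proof (rule subdrawing_restrict[OF sm(1)])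
    show "{v1, v2, v3, v4} \<subseteq> verts G" using sm(14) by simp
    show "cycle_edges G [v1, v2, v3, v4] \<subseteq> edges G" by (auto simp: cycle_edges_def)
    show "e \<inter> verts G \<subseteq> {v1, v2, v3, v4}" if "e \<in> cycle_edges G [v1, v2, v3, v4]" for e
      using that ends unfolding ce by auto
  qed
  have pG0: "plane_graph G0" using sub by (simp add: subdrawing_def)
  have ends0: "edge G v1 v2 \<inter> verts G0 = {v1, v2}" "edge G v2 v3 \<inter> verts G0 = {v2, v3}"
    "edge G v3 v4 \<inter> verts G0 = {v3, v4}" "edge G v4 v1 \<inter> verts G0 = {v4, v1}"
    using subdrawing_ends[OF sub] ends unfolding G0_def ce by simp_all
  have ne: "v1 \<noteq> v2" "v2 \<noteq> v3" "v3 \<noteq> v4" "v4 \<noteq> v1" using sm(13) by auto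
  show adj: "adj G0 w z \<longleftrightarrow> {w, z} \<in> {{v1, v2}, {v2, v3}, {v3, v4}, {v4, v1}}" for w z
  proof -
    have "edges G0 = {edge G v1 v2, edge G v2 v3, edge G v3 v4, edge G v4 v1}" by (simp add: G0_def ce)
    then show ?thesis unfolding adj_def using ends0 ne by (auto simp: doubleton_eq_iff)
  qed
  have cyc: "is_cycle G0 [v1, v2, v3, v4]" unfolding is_cycle4 adj using sm(11,12) by simp
  have curve: "cycle_curve G0 [v1, v2, v3, v4] = J" using subdrawing_cycle(2)[OF sub cyc] by (simp add: J_def)
  have js: "jordan_side J (inside J)" "jordan_side J (outside J)" using sm(4) unfolding J_def jordan_side_def by auto
  have JU: "J = \<Union>(edges G0)" by (simp add: J_def cycle_curve_def G0_def)
  have "{v1, v2, v3, v4} \<subseteq> J" unfolding J_def using cycle4_curve_verts[OF sm(1,3)] by blast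
  then have pts: "verts G0 \<union> \<Union>(edges G0) = J" unfolding JU[symmetric] by (auto simp: G0_def)
  show f: "faces G0 = {inside J, outside J}"
  proof (rule faces_eqI)
    show "\<Union>{inside J, outside J} = - (verts G0 \<union> \<Union>(edges G0))"
      unfolding pts by (simp add: inside_Un_outside)
    fix X Y assume "X \<in> {inside J, outside J}" "Y \<in> {inside J, outside J}" "X \<noteq> Y"
    then show "X \<inter> Y = {}" using inside_Int_outside[of J] by blast
  qed (use jordan_sideD(1-3)[OF js(1)] jordan_sideD(1-3)[OF js(2)] in blast)
  show "face_bounded_by G0 (inside J) [v1, v2, v3, v4]" "face_bounded_by G0 (outside J) [v1, v2, v3, v4]"
    unfolding face_bounded_by_def using f cyc curve jordan_sideD(4)[OF js(1)] jordan_sideD(4)[OF js(2)] by auto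
qed

text \<open>Inserted are the path \<open>v1\<close>-\<open>a\<close>-\<open>v3\<close>, the chord
  \<open>v2\<close>-\<open>a\<close>, the path \<open>v1\<close>-\<open>b\<close>-\<open>v3\<close>
  and the chords \<open>a\<close>-\<open>b\<close> and \<open>b\<close>-\<open>v4\<close>, each into
  a quadrangular face left by the previous ones. The clause on edges makes every new edge contain a
  vertex outside \<open>G\<close>, as the pasting requires.\<close>

lemma exterior_cap_exists:
  assumes "smpg_at (outside (cycle_curve G [v1, v2, v3, v4])) G [v1, v2, v3, v4]"
  obtains G1 a b where "smpg_at (inside (cycle_curve G [v1, v2, v3, v4])) G1 [v1, v2, v3, v4]"
    "cycle_curve G1 [v1, v2, v3, v4] = cycle_curve G [v1, v2, v3, v4]"
    "verts G1 = {v1, v2, v3, v4, a, b}" "a \<notin> verts G" "b \<notin> verts G" "a \<noteq> b"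
    "cycle_edges G [v1, v2, v3, v4] \<subseteq> edges G1"
    "\<And>e. e \<in> edges G1 \<Longrightarrow> e \<in> cycle_edges G [v1, v2, v3, v4] \<or> a \<in> e \<or> b \<in> e"
    "\<And>w z. adj G1 w z \<longleftrightarrow> {w, z} \<in> {{v1, v2}, {v2, v3}, {v3, v4}, {v4, v1}, {v1, a}, {a, v3}, {v2, a},
        {v1, b}, {b, v3}, {a, b}, {b, v4}}"
proof -
  let ?C = "[v1, v2, v3, v4]"
  define J where "J = cycle_curve G ?C"
  define G0 where "G0 = \<lparr>verts = {v1, v2, v3, v4}, edges = cycle_edges G ?C\<rparr>"
  note sm = smpg_atD[OF assms]
  note q0 = quadrangle_drawing[OF assms, folded J_def G0_def]
  have p0: "plane_graph G0" using q0(1) by (simp add: subdrawing_def)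
  have OG: "outside J \<inter> verts G = {}" using faces_basic(4)[OF sm(1,2)] unfolding J_def by blast
  have IO: "inside J \<inter> outside J = {}" by simp
  have Ine: "inside J \<noteq> {}" using faces_basic(3)[OF p0, of "inside J"] q0(2) by simp
  obtain a c1 c2 F1 F2 where
    a: "a \<in> outside J" "a \<in> c1" "a \<in> c2" "a \<notin> verts G0" and
    s: "subdrawing G0 (add_edge c2 (add_edge c1 (add_vertex a G0)))" and
    ad: "\<And>w z. adj (add_edge c2 (add_edge c1 (add_vertex a G0))) w z \<longleftrightarrow> adj G0 w z \<or> {w, z} = {v1, a} \<or> {w, z} = {a, v3}" and
    f: "faces (add_edge c2 (add_edge c1 (add_vertex a G0))) = faces G0 - {outside J} \<union> {F1, F2}" and
    F: "F1 \<subseteq> outside J" "F2 \<subseteq> outside J" "F1 \<inter> F2 = {}" "F1 \<noteq> {}" "F2 \<noteq> {}" and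
    b: "face_bounded_by (add_edge c2 (add_edge c1 (add_vertex a G0))) F1 [v1, v2, v3, a]"
    "face_bounded_by (add_edge c2 (add_edge c1 (add_vertex a G0))) F2 [v1, a, v3, v4]"
    by (rule add_path[OF p0 q0(4)]) (rule that; (assumption | simp))
  define G1 where "G1 = add_edge c2 (add_edge c1 (add_vertex a G0))"
  note s1 = s[folded G1_def] and ad1 = ad[folded G1_def] and f1 = f[folded G1_def] and b1 = b[folded G1_def]
  have p1: "plane_graph G1" using s1 by (simp add: subdrawing_def)
  have aG: "a \<notin> verts G" using a(1) OG by blast
  have dist: "a \<noteq> v1" "a \<noteq> v2" "a \<noteq> v3" "a \<noteq> v4" "v1 \<noteq> v2" "v1 \<noteq> v3" "v1 \<noteq> v4" "v2 \<noteq> v3" "v2 \<noteq> v4" "v3 \<noteq> v4"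
    using aG sm(13,14) by auto
  have n1: "\<not> adj G1 v2 a" unfolding ad1 q0(5) using dist by (auto simp: doubleton_eq_iff)
  obtain c3 F3 F4 where c3: "arc_between c3 v2 a" and s2: "subdrawing G1 (add_edge c3 G1)" and
    ad2: "\<And>w z. adj (add_edge c3 G1) w z \<longleftrightarrow> adj G1 w z \<or> {w, z} = {v2, a}" and
    f2: "faces (add_edge c3 G1) = faces G1 - {F1} \<union> {F3, F4}" and
    t2: "triangular_face (add_edge c3 G1) F3" "triangular_face (add_edge c3 G1) F4"
    by (rule add_chord[OF p1 face_bounded_by_rotate[OF p1 b1(1)] n1]) (rule that; (assumption | simp))
  define G2 where "G2 = add_edge c3 G1"
  note s2 = s2[folded G2_def] and ad2 = ad2[folded G2_def] and f2 = f2[folded G2_def] and t2 = t2[folded G2_def]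
  have p2: "plane_graph G2" using s2 by (simp add: subdrawing_def)
  have ne: "inside J \<noteq> outside J" "inside J \<noteq> F1" "F2 \<noteq> F1" using F IO Ine by blast+
  have ff2: "faces G2 = {inside J, F2, F3, F4}"
    unfolding f2 f1 q0(2) using ne by (simp add: insert_Diff_if insert_commute)
  have b2: "face_bounded_by G2 F2 [v1, a, v3, v4]"
    by (rule face_bounded_by_subdrawing[OF s2 b1(2)]) (simp add: ff2)
  obtain b d1 d2 F5 F6 where
    b: "b \<in> F2" "b \<in> d1" "b \<in> d2" "b \<notin> verts G2" and
    s: "subdrawing G2 (add_edge d2 (add_edge d1 (add_vertex b G2)))" and
    ad: "\<And>w z. adj (add_edge d2 (add_edge d1 (add_vertex b G2))) w z \<longleftrightarrow> adj G2 w z \<or> {w, z} = {v1, b} \<or> {w, z} = {b, v3}" and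
    f: "faces (add_edge d2 (add_edge d1 (add_vertex b G2))) = faces G2 - {F2} \<union> {F5, F6}" and
    F': "F5 \<subseteq> F2" "F6 \<subseteq> F2" "F5 \<inter> F6 = {}" "F5 \<noteq> {}" "F6 \<noteq> {}" and
    bb: "face_bounded_by (add_edge d2 (add_edge d1 (add_vertex b G2))) F5 [v1, a, v3, b]"
    "face_bounded_by (add_edge d2 (add_edge d1 (add_vertex b G2))) F6 [v1, b, v3, v4]"
    by (rule add_path[OF p2 b2]) (rule that; (assumption | simp))
  define G3 where "G3 = add_edge d2 (add_edge d1 (add_vertex b G2))"
  note s3 = s[folded G3_def] and ad3 = ad[folded G3_def] and f3 = f[folded G3_def] and b3 = bb[folded G3_def]
  have p3: "plane_graph G3" using s3 by (simp add: subdrawing_def)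
  have bG: "b \<notin> verts G" using b(1) F(2) OG by blast
  have "a \<in> verts G2" by (simp add: G2_def G1_def add_edge_def add_vertex_def)
  then have distb: "a \<noteq> b" "b \<noteq> v1" "b \<noteq> v2" "b \<noteq> v3" "b \<noteq> v4" using bG b(4) sm(14) by auto
  have n3: "\<not> adj G3 a b" unfolding ad3 ad2 ad1 q0(5) using dist distb by (auto simp: doubleton_eq_iff)
  obtain c4 F7 F8 where c4: "arc_between c4 a b" and s4: "subdrawing G3 (add_edge c4 G3)" and
    ad4: "\<And>w z. adj (add_edge c4 G3) w z \<longleftrightarrow> adj G3 w z \<or> {w, z} = {a, b}" and
    f4: "faces (add_edge c4 G3) = faces G3 - {F5} \<union> {F7, F8}" and
    t4: "triangular_face (add_edge c4 G3) F7" "triangular_face (add_edge c4 G3) F8"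
    by (rule add_chord[OF p3 face_bounded_by_rotate[OF p3 b3(1)] n3]) (rule that; (assumption | simp))
  define G4 where "G4 = add_edge c4 G3"
  note s4 = s4[folded G4_def] and ad4 = ad4[folded G4_def] and f4 = f4[folded G4_def] and t4 = t4[folded G4_def]
  have p4: "plane_graph G4" using s4 by (simp add: subdrawing_def)
  have "F6 \<in> faces G4" unfolding f4 f3 using F' by auto
  then have b4: "face_bounded_by G4 F6 [v1, b, v3, v4]" by (rule face_bounded_by_subdrawing[OF s4 b3(2)])
  have n4: "\<not> adj G4 b v4" unfolding ad4 ad3 ad2 ad1 q0(5) using dist distb by (auto simp: doubleton_eq_iff)
  obtain c5 F9 F10 where c5: "arc_between c5 b v4" and s5: "subdrawing G4 (add_edge c5 G4)" and
    ad5: "\<And>w z. adj (add_edge c5 G4) w z \<longleftrightarrow> adj G4 w z \<or> {w, z} = {b, v4}" and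
    f5: "faces (add_edge c5 G4) = faces G4 - {F6} \<union> {F9, F10}" and
    t5: "triangular_face (add_edge c5 G4) F9" "triangular_face (add_edge c5 G4) F10"
    by (rule add_chord[OF p4 face_bounded_by_rotate[OF p4 b4] n4]) (rule that; (assumption | simp))
  define G5 where "G5 = add_edge c5 G4"
  note s5 = s5[folded G5_def] and ad5 = ad5[folded G5_def] and f5 = f5[folded G5_def] and t5 = t5[folded G5_def]
  have p5: "plane_graph G5" using s5 by (simp add: subdrawing_def)
  have sub: "subdrawing G0 G5" "subdrawing G2 G5" "subdrawing G4 G5"
    using subdrawing_trans s1 s2 s3 s4 s5 by blast+
  have ff5: "faces G5 = (((faces G2 - {F2} \<union> {F5, F6}) - {F5} \<union> {F7, F8}) - {F6} \<union> {F9, F10})"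
    unfolding f5 f4 f3 ..
  \<comment> \<open>The faces removed after \<open>G2\<close> all lie outside \<open>J\<close>, so
    the inner face survives.\<close>
  have "inside J \<notin> {F2, F5, F6}" using IO Ine F(2) F'(1,2) by blast
  then have If: "inside J \<in> faces G5" unfolding ff5 ff2 by auto
  have Ib: "face_bounded_by G5 (inside J) ?C" by (rule face_bounded_by_subdrawing[OF sub(1) q0(3) If])
  have tri: "triangular_face G5 X" if X: "X \<in> faces G5" "X \<noteq> inside J" for X
  proof -
    have "X \<in> {F3, F4} \<or> X \<in> {F7, F8} \<or> X \<in> {F9, F10}" using X unfolding ff5 ff2 by blast
    then have "triangular_face G2 X \<or> triangular_face G4 X \<or> triangular_face G5 X" using t2 t4 t5 by blast
    then show ?thesis using triangular_face_subdrawing sub(2,3) X(1) by blast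
  qed
  have cyc0: "is_cycle G0 ?C" using q0(3) by (simp add: face_bounded_by_def)
  have curve: "cycle_curve G5 ?C = J"
    using subdrawing_cycle(2)[OF sub(1) cyc0] subdrawing_cycle(2)[OF q0(1) cyc0] by (simp add: J_def)
  note defs = G5_def G4_def G3_def G2_def G1_def G0_def add_edge_def add_vertex_def
  show thesis
  proof (rule that[of G5 a b, folded J_def])
    show "smpg_at (inside J) G5 ?C" unfolding smpg_at_def using p5 Ib tri by simp
    show "cycle_curve G5 ?C = J" by (rule curve)
    show "verts G5 = {v1, v2, v3, v4, a, b}" unfolding defs by auto
    show "a \<notin> verts G" "b \<notin> verts G" "a \<noteq> b" by fact+
    show "cycle_edges G ?C \<subseteq> edges G5" unfolding defs by auto
    show "e \<in> cycle_edges G ?C \<or> a \<in> e \<or> b \<in> e" if "e \<in> edges G5" for e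
      using that a(2,3) b(2,3) arc_betweenD(2,3)[OF c3] arc_betweenD(2,3)[OF c4] arc_betweenD(2,3)[OF c5]
      unfolding defs by auto
    show "adj G5 w z \<longleftrightarrow> {w, z} \<in> {{v1, v2}, {v2, v3}, {v3, v4}, {v4, v1}, {v1, a}, {a, v3}, {v2, a},
        {v1, b}, {b, v3}, {a, b}, {b, v4}}" for w z
      unfolding ad5 ad4 ad3 ad2 ad1 q0(5) insert_iff empty_iff by argo
  qed
qed

lemma smpg_at_inner_faces:
  assumes "smpg_at F0 G [v1, v2, v3, v4]" "jordan_side (cycle_curve G [v1, v2, v3, v4]) D" "F0 \<inter> D = {}"
  shows "\<Union>(faces G - {F0}) = D - points G" "cycle_curve G [v1, v2, v3, v4] \<subseteq> points G"
    "points G \<subseteq> cycle_curve G [v1, v2, v3, v4] \<union> D"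
proof -
  note sm = smpg_atD[OF assms(1)]
  let ?J = "cycle_curve G [v1, v2, v3, v4]"
  note DD = smpg_at_sides[OF assms]
  show Jp: "?J \<subseteq> points G" by (auto simp: cycle_curve_def cycle_edges_def points_def)
  show "points G \<subseteq> ?J \<union> D" using smpg_at_subset[OF assms] by (simp add: points_def)
  have "\<Union>(faces G - {F0}) = - points G - F0"
    using faces_Union[of G] faces_disjoint[of _ G F0] sm(2) by (auto simp: points_def)
  then show "\<Union>(faces G - {F0}) = D - points G" using DD Jp assms(3) by blast
qed

text \<open>\<open>G\<close> and \<open>G1\<close> share points only on the common curve, so edges
  of different parts cannot cross. Parallel edges are excluded by \<open>new\<close>: without it
  both parts might contain a chord between the same two vertices of the quadrangle.\<close>

lemma paste_maximal:
  assumes G: "smpg_at (outside (cycle_curve G [v1, v2, v3, v4])) G [v1, v2, v3, v4]"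
    and G1: "smpg_at (inside (cycle_curve G [v1, v2, v3, v4])) G1 [v1, v2, v3, v4]"
    and J: "cycle_curve G1 [v1, v2, v3, v4] = cycle_curve G [v1, v2, v3, v4]"
    and V: "verts G \<inter> verts G1 = {v1, v2, v3, v4}"
    and E: "cycle_edges G [v1, v2, v3, v4] \<subseteq> edges G1"
    and new: "\<And>e. e \<in> edges G1 \<Longrightarrow> e \<in> cycle_edges G [v1, v2, v3, v4] \<or> (\<exists>a \<in> e \<inter> verts G1. a \<notin> verts G)"
  shows "pasted G G1 v1 v2 v3 v4" "maximal_plane (graph_union G G1)" "edges G \<inter> edges G1 = cycle_edges G [v1, v2, v3, v4]"
proof -
  let ?C = "[v1, v2, v3, v4]"
  define J where "J = cycle_curve G ?C"
  define H where "H = graph_union G G1"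
  note sm = smpg_atD[OF G] and sm1 = smpg_atD[OF G1]
  have js: "jordan_side J (inside J)" "jordan_side J (outside J)" using sm(4) unfolding J_def jordan_side_def by auto
  have dj: "outside J \<inter> inside J = {}" "inside J \<inter> outside J = {}" by (auto simp: Int_commute)
  note in1 = smpg_at_inner_faces[OF G, folded J_def, OF js(1) dj(1)]
  note in2 = smpg_at_inner_faces[OF G1, unfolded J, folded J_def, OF js(2) dj(2)]
  have JJ: "points G \<inter> points G1 \<subseteq> J" using in1(3) in2(3) dj by blast
  have ce: "cycle_edges G ?C \<subseteq> edges G" by (auto simp: cycle_edges_def)
  have onJ: "p \<in> {v1, v2, v3, v4}" if "p \<in> J" "p \<in> verts G \<or> p \<in> verts G1" for p
    using that cycle4_curve_verts[OF sm(1,3)] cycle4_curve_verts[OF sm1(1,3)] J unfolding J_def by blast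
  have VG: "{v1, v2, v3, v4} \<subseteq> verts G" "{v1, v2, v3, v4} \<subseteq> verts G1" using V by blast+
  have vH: "verts H = verts G \<union> verts G1" and eH: "edges H = edges G \<union> edges G1" by (simp_all add: H_def graph_union_def)
  have endsG: "e \<inter> verts H = e \<inter> verts G" if "e \<in> edges G" for e
  proof -
    have "e \<inter> verts G1 \<subseteq> J" using that JJ by (auto simp: points_def)
    then have "e \<inter> verts G1 \<subseteq> verts G" using onJ VG by blast
    then show ?thesis unfolding vH by blast
  qed
  have endsG1: "e \<inter> verts H = e \<inter> verts G1" if "e \<in> edges G1" for e
  proof -
    have "e \<inter> verts G \<subseteq> J" using that JJ by (auto simp: points_def)
    then have "e \<inter> verts G \<subseteq> verts G1" using onJ VG by blast
    then show ?thesis unfolding vH by blast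
  qed
  have mixed: "e \<inter> e' \<subseteq> verts H \<and> e \<inter> verts H \<noteq> e' \<inter> verts H"
    if e: "e \<in> edges G" and e': "e' \<in> edges G1" and ne: "e \<noteq> e'" for e e'
  proof (cases "e' \<in> cycle_edges G ?C")
    case True
    then have "e' \<in> edges G" using ce by blast
    then show ?thesis
      using plane_edges_inter[OF sm(1) e _ ne] plane_edge_unique[OF sm(1) e, of e'] endsG[of e] endsG[of e'] e ne vH by auto
  next
    case False
    obtain w where w: "w \<in> e' \<inter> verts G1" "w \<notin> verts G" using new[OF e'] False by blast
    have "w \<notin> e \<inter> verts H" unfolding endsG[OF e] using w(2) by blast
    moreover have "w \<in> e' \<inter> verts H" unfolding endsG1[OF e'] by (rule w(1))
    moreover have "e \<inter> e' \<subseteq> verts H"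
    proof
      fix p assume p: "p \<in> e \<inter> e'"
      then have "p \<in> J" using JJ e e' by (auto simp: points_def)
      then obtain k where k: "k \<in> cycle_edges G ?C" "p \<in> k" unfolding J_def cycle_curve_def by blast
      then have "k \<in> edges G1" "k \<noteq> e'" using E False by auto
      then have "p \<in> verts G1" using plane_edges_inter[OF sm1(1) e', of k] p k(2) by blast
      then show "p \<in> verts H" by (simp add: vH)
    qed
    ultimately show ?thesis by blast
  qed
  have pH: "plane_graph H"
  proof (rule plane_graphI)
    show "finite (verts H)" "finite (edges H)" using sm(1) sm1(1) by (simp_all add: vH eH plane_graph_def)
    fix x assume x: "x \<in> edges H"
    show "\<exists>u\<in>verts H. \<exists>v\<in>verts H. arc_between x u v \<and> x \<inter> verts H = {u, v}"
    proof (cases "x \<in> edges G")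
      case True
      then obtain u v where "arc_between x u v" "x \<inter> verts G = {u, v}" using plane_graph_edgeE[OF sm(1)] by metis
      then show ?thesis using endsG[OF True] by (intro bexI[of _ u] bexI[of _ v]) auto
    next
      case False
      then have x1: "x \<in> edges G1" using x by (simp add: eH)
      then obtain u v where "arc_between x u v" "x \<inter> verts G1 = {u, v}" using plane_graph_edgeE[OF sm1(1)] by metis
      then show ?thesis using endsG1[OF x1] by (intro bexI[of _ u] bexI[of _ v]) auto
    qed
    fix y assume y: "y \<in> edges H" "x \<noteq> y"
    consider "x \<in> edges G" "y \<in> edges G" | "x \<in> edges G1" "y \<in> edges G1" | "x \<in> edges G" "y \<in> edges G1" | "x \<in> edges G1" "y \<in> edges G"
      using x y by (auto simp: eH)
    then show "x \<inter> y \<subseteq> verts H \<and> x \<inter> verts H \<noteq> y \<inter> verts H"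
    proof cases
      case 1
      then show ?thesis
        using plane_edges_inter[OF sm(1) 1 y(2)] plane_edge_unique[OF sm(1) 1] endsG[OF 1(1)] endsG[OF 1(2)] y(2) vH by auto
    next
      case 2
      then show ?thesis
        using plane_edges_inter[OF sm1(1) 2 y(2)] plane_edge_unique[OF sm1(1) 2] endsG1[OF 2(1)] endsG1[OF 2(2)] y(2) vH by auto
    next
      case 3 then show ?thesis using mixed y(2) by blast
    next
      case 4 then show ?thesis using mixed[OF 4(2,1)] y(2) by (metis Int_commute)
    qed
  qed
  show pa: "pasted G G1 v1 v2 v3 v4" unfolding pasted_def using G G1 J V pH by (simp add: H_def)
  have sub: "subdrawing G H" "subdrawing G1 H" using pastedD(6,7)[OF pa] by (simp_all add: H_def)
  \<comment> \<open>Each exceptional face is filled by the other part: \<open>outside J\<close> by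
    the faces of \<open>G1\<close>, \<open>inside J\<close> by those of \<open>G\<close>.\<close>
  have fH: "faces H = (faces G - {outside J}) \<union> (faces G1 - {inside J})"
  proof (rule faces_eqI)
    have pHp: "verts H \<union> \<Union>(edges H) = points G \<union> points G1" by (auto simp: vH eH points_def)
    have cov: "inside J \<union> outside J = - J" by (rule inside_Un_outside)
    have "\<Union>((faces G - {outside J}) \<union> (faces G1 - {inside J})) = (inside J - points G) \<union> (outside J - points G1)"
      using in1(1) in2(1) by simp
    also have "\<dots> = - (points G \<union> points G1)"
      using in1(2,3) in2(2,3) cov dj(1) by blast
    finally show "\<Union>((faces G - {outside J}) \<union> (faces G1 - {inside J})) = - (verts H \<union> \<Union>(edges H))"
      unfolding pHp .
    have sG: "X \<subseteq> inside J" if "X \<in> faces G - {outside J}" for X using in1(1) that by blast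
    have sG1: "X \<subseteq> outside J" if "X \<in> faces G1 - {inside J}" for X using in2(1) that by blast
    fix X assume X: "X \<in> (faces G - {outside J}) \<union> (faces G1 - {inside J})"
    then show "open X \<and> connected X \<and> X \<noteq> {}"
      using faces_basic(1-3)[OF sm(1), of X] faces_basic(1-3)[OF sm1(1), of X] by auto
    fix Y assume Y: "Y \<in> (faces G - {outside J}) \<union> (faces G1 - {inside J})" "X \<noteq> Y"
    consider "X \<in> faces G" "Y \<in> faces G" | "X \<in> faces G1" "Y \<in> faces G1" | "X \<subseteq> inside J" "Y \<subseteq> outside J" | "X \<subseteq> outside J" "Y \<subseteq> inside J"
      using X Y sG sG1 by blast
    then show "X \<inter> Y = {}"
      using faces_disjoint[of X G Y] faces_disjoint[of X G1 Y] Y(2) dj by cases auto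
  qed
  have "triangular_face H F" if F: "F \<in> faces H" for F
  proof (cases "F \<in> faces G - {outside J}")
    case True
    then have "triangular_face G F" using G by (simp add: smpg_at_def J_def)
    then show ?thesis using triangular_face_subdrawing[OF sub(1)] F by blast
  next
    case False
    then have "F \<in> faces G1 - {inside J}" using F fH by blast
    then have "triangular_face G1 F" using G1 by (simp add: smpg_at_def J_def)
    then show ?thesis using triangular_face_subdrawing[OF sub(2)] F by blast
  qed
  then show "maximal_plane (graph_union G G1)" using pH by (simp add: maximal_plane_def H_def)
  show "edges G \<inter> edges G1 = cycle_edges G ?C"
  proof
    show "cycle_edges G ?C \<subseteq> edges G \<inter> edges G1" using ce E by blast
    show "edges G \<inter> edges G1 \<subseteq> cycle_edges G ?C"
    proof
      fix e assume e: "e \<in> edges G \<inter> edges G1"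
      show "e \<in> cycle_edges G ?C"
      proof (rule ccontr)
        assume "e \<notin> cycle_edges G ?C"
        then obtain w where "w \<in> e \<inter> verts G1" "w \<notin> verts G" using new e by blast
        then show False using endsG[of e] endsG1[of e] e by blast
      qed
    qed
  qed
qed


section \<open>The characterization\<close>

lemma cycle_remove_vertex:
  assumes K: "is_cycle H K" and w: "w \<in> set K"
  obtains R where "set R = set K - {w}" "distinct R" "successively (adj H) R" "R \<noteq> []"
    "adj H w (hd R)" "adj H (last R) w" "hd R \<noteq> last R"
proof -
  obtain xs ys where xy: "K = xs @ w # ys" using w by (meson split_list)
  have K': "3 \<le> length K" "distinct K" "successively (adj H) (xs @ w # ys @ [hd (xs @ [w])])"
    using K unfolding is_cycle_iff xy by (auto simp: hd_append)
  define R where "R = ys @ xs"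
  have len: "2 \<le> length R" using K'(1) by (simp add: xy R_def)
  then have ne: "R \<noteq> []" by auto
  have d: "distinct R" "set R = set K - {w}" using K'(2) unfolding xy R_def by auto
  have s: "successively (adj H) R" "adj H w (hd R)" "adj H (last R) w"
    using K'(3) ne unfolding R_def by (auto simp: successively_append_iff successively_Cons hd_append split: if_splits)
  have "hd R \<noteq> last R"
    using d(1) len by (cases R) (auto simp: last_in_set split: if_splits)
  then show thesis using that d s ne by blast
qed

text \<open>
  A bichromatic cycle through \<open>w\<close> must use two neighbours of \<open>w\<close> of the same colour. These can
  only be \<open>x\<close> and \<open>y\<close>, so the rest of the cycle is a Kempe path between them.
\<close>
lemma bichromatic_cycle_through_vertex:
  assumes h: "proper H h" and K: "bichromatic_cycle H h K" and w: "w \<in> set K"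
    and nb: "\<And>z. adj H w z \<Longrightarrow> z \<in> {x, y, p, q}"
    and col: "h x = h y" "h p \<noteq> h x" "h q \<noteq> h x" "h p \<noteq> h q"
  obtains R where "R \<noteq> []" "set R = set K - {w}" "distinct R" "successively (adj H) R" "hd R = x" "last R = y"
    "\<And>z. z \<in> set R \<Longrightarrow> h z \<in> {h x, h w}"
proof -
  have cyc: "is_cycle H K" and c2: "card (h ` set K) = 2" using K by (auto simp: bichromatic_cycle_def)
  obtain R where R: "set R = set K - {w}" "distinct R" "successively (adj H) R" "R \<noteq> []"
    "adj H w (hd R)" "adj H (last R) w" "hd R \<noteq> last R"
    by (rule cycle_remove_vertex[OF cyc w])
  have mem: "hd R \<in> set K" "last R \<in> set K" using R(1,4) hd_in_set[OF R(4)] last_in_set[OF R(4)] by auto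
  have ne: "h (hd R) \<noteq> h w" "h (last R) \<noteq> h w" using h R(5,6) unfolding proper_def by metis+
  obtain i j where ij: "h ` set K = {i, j}" using c2 by (auto simp: card_2_iff)
  have "h w \<in> {i, j}" "h (hd R) \<in> {i, j}" "h (last R) \<in> {i, j}" using ij w mem by blast+
  then have eq: "h (hd R) = h (last R)" and hK: "h ` set K = {h (hd R), h w}" using ne ij by auto
  have "hd R \<in> {x, y, p, q}" "last R \<in> {x, y, p, q}" using nb R(5,6) adj_sym by blast+
  then have xy: "hd R = x \<and> last R = y \<or> hd R = y \<and> last R = x" using eq R(7) col by auto
  then have hx: "h z \<in> {h x, h w}" if "z \<in> set R" for z using that hK R(1) col(1) by auto
  have sr: "successively (adj H) (rev R)" using R(3) by (simp add: adj_sym[of H])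
  from xy show thesis
  proof
    assume "hd R = x \<and> last R = y"
    then show thesis using that[of R] R hx by blast
  next
    assume "hd R = y \<and> last R = x"
    then show thesis using that[of "rev R"] R sr hx by (simp add: hd_rev last_rev)
  qed
qed

text \<open>The triangle on the inner side of the edge from \<open>v1\<close> to \<open>v2\<close>
  has its apex off the quadrangle because there are no chords. This is the source of the fourth
  neighbour of \<open>v2\<close> and, after rotation, of \<open>v4\<close>.\<close>

lemma common_interior_neighbour:
  assumes G: "smpg_at F0 G [v1, v2, v3, v4]" and n: "\<not> adj G v1 v3" "\<not> adj G v2 v4"
  obtains x where "adj G v1 x" "adj G v2 x" "x \<notin> {v1, v2, v3, v4}"
proof -
  note sm = smpg_atD[OF G]
  let ?e = "edge G v1 v2"
  have e: "?e \<in> cycle_edges G [v1, v2, v3, v4]" unfolding cycle_edges4[OF sm(1,3)] by simp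
  have eG: "?e \<in> edges G" by (rule edgeD(1)[OF sm(1,7)])
  obtain F where F: "F \<in> faces G" "F \<noteq> F0" "{X \<in> faces G. ?e \<subseteq> frontier X} = {F0, F}"
    by (rule edge_two_faces[OF sm(1,5,2,4) e])
  then have eF: "?e \<subseteq> frontier F" by blast
  have "triangular_face G F" using G F(1,2) by (simp add: smpg_at_def)
  then obtain x y z where xyz: "face_bounded_by G F [x, y, z]" "is_cycle G [x, y, z]" by (rule triangular_faceE)
  have "?e \<in> cycle_edges G [x, y, z]"
    using eF xyz(1) edge_subset_cycle_curve_iff[OF sm(1) eG] by (simp add: face_bounded_by_def)
  moreover have A: "adj G x y" "adj G y z" "adj G z x" using xyz(2) by (simp_all add: is_cycle3)
  ultimately have "{v1, v2} = {x, y} \<or> {v1, v2} = {y, z} \<or> {v1, v2} = {z, x}"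
    unfolding cycle_edges3[OF sm(1) xyz(2)]
    using edgeD(2)[OF sm(1) sm(7)] edgeD(2)[OF sm(1) A(1)] edgeD(2)[OF sm(1) A(2)] edgeD(2)[OF sm(1) A(3)] by auto
  then obtain w where w: "adj G v1 w" "adj G v2 w"
    using A adj_sym by (metis doubleton_eq_iff)
  then have "w \<notin> {v1, v2, v3, v4}" using n adj_verts by blast
  then show thesis using that w by blast
qed

lemma degree_ge_4:
  assumes "plane_graph H" "distinct [a, b, c, d]" "adj H v a" "adj H v b" "adj H v c" "adj H v d"
  shows "4 \<le> degree H v"
proof -
  have "{u. adj H v u} \<subseteq> verts H" using adj_verts by blast
  then have "finite {u. adj H v u}" using assms(1) finite_subset by (auto simp: plane_graph_def)
  then have "card {a, b, c, d} \<le> card {u. adj H v u}" by (rule card_mono) (use assms(3-6) in auto)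
  then show ?thesis using assms(2) by (simp add: degree_def)
qed

text \<open>A colouring of \<open>H\<close> with fewer colours would restrict to one of
  \<open>G\<close>.\<close>

lemma chromatic_number_supergraph:
  assumes "subdrawing G H" "chromatic_number G = 4" "colouring 4 H f"
  shows "chromatic_number H = 4"
  unfolding chromatic_number_def
proof (rule Least_equality)
  show "\<exists>f. colouring 4 H f" using assms(3) by blast
  fix k assume "\<exists>f. colouring k H f"
  then obtain g where g: "colouring k H g" by blast
  have "colouring k G (restrict g (verts G))"
    using g subdrawing_adj[OF assms(1)] adj_verts[of G] assms(1)
    unfolding colouring_def subdrawing_def by (auto simp: PiE_def Pi_def)
  then have "chromatic_number G \<le> k" unfolding chromatic_number_def by (intro Least_le) blast
  then show "4 \<le> k" using assms(2) by simp
qed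

text \<open>With the cap attached, Kempe changes of the pasted graph restrict to Kempe changes of
  \<open>G\<close>. Then sharedness, assumed for the whole class of \<open>f0\<close>, persists and
  keeps the quadrangle bichromatic.\<close>

lemma base_module4I_shared_endpoint_24:
  assumes G: "smpg G [v1, v2, v3, v4]" and chi: "chromatic_number G = 4"
    and deg: "\<forall>v \<in> verts G - {v1, v2, v3, v4}. 4 \<le> degree G v"
    and f0: "f0 \<in> F2 G [v1, v2, v3, v4]"
    and shared: "\<And>f. f \<in> kempe_class G f0 \<Longrightarrow> shared_endpoint_24 G [v1, v2, v3, v4] f"
  shows "base_module4 G [v1, v2, v3, v4]"
proof -
  let ?C = "[v1, v2, v3, v4]"
  have GO: "smpg_at (outside (cycle_curve G ?C)) G ?C" using G by (simp add: smpg_iff)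
  note sm = smpg_atD[OF GO]
  obtain G1 a b where G1: "smpg_at (inside (cycle_curve G ?C)) G1 ?C" "cycle_curve G1 ?C = cycle_curve G ?C"
    and V1: "verts G1 = {v1, v2, v3, v4, a, b}" and ab: "a \<notin> verts G" "b \<notin> verts G" "a \<noteq> b"
    and E1: "cycle_edges G ?C \<subseteq> edges G1"
      "\<And>e. e \<in> edges G1 \<Longrightarrow> e \<in> cycle_edges G ?C \<or> a \<in> e \<or> b \<in> e"
    and A1: "\<And>w z. adj G1 w z \<longleftrightarrow> {w, z} \<in> {{v1, v2}, {v2, v3}, {v3, v4}, {v4, v1}, {v1, a}, {a, v3}, {v2, a},
        {v1, b}, {b, v3}, {a, b}, {b, v4}}"
    by (rule exterior_cap_exists[OF GO]) (rule that; (assumption | simp))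
  define H where "H = graph_union G G1"
  have vG: "v1 \<in> verts G" "v2 \<in> verts G" "v3 \<in> verts G" "v4 \<in> verts G" using sm(14) by auto
  have V: "verts G \<inter> verts G1 = {v1, v2, v3, v4}" using V1 ab vG by auto
  have new: "e \<in> cycle_edges G ?C \<or> (\<exists>w \<in> e \<inter> verts G1. w \<notin> verts G)" if "e \<in> edges G1" for e
    using E1(2)[OF that] ab V1 by auto
  note paste = paste_maximal[OF GO G1 V E1(1) new]
  have pa: "pasted G G1 v1 v2 v3 v4" and mx: "maximal_plane H" and eI: "edges G \<inter> edges G1 = cycle_edges G ?C"
    using paste by (auto simp: H_def)
  note pD = pastedD[OF pa, folded H_def]
  have vH: "verts H = verts G \<union> {a, b}" using V1 vG by (auto simp: H_def graph_union_def)
  have adjH: "adj H w z \<longleftrightarrow> adj G w z \<or> adj G1 w z" for w z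
  proof
    assume "adj H w z"
    then obtain e where e: "w \<noteq> z" "e \<in> edges G \<or> e \<in> edges G1" "e \<inter> verts H = {w, z}"
      by (auto simp: adj_def H_def graph_union_def)
    then show "adj G w z \<or> adj G1 w z"
      using subdrawing_ends[OF pD(6), of e] subdrawing_ends[OF pD(7), of e] unfolding adj_def by metis
  qed (use subdrawing_adj pD(6,7) in blast)
  have dist: "v1 \<noteq> v2" "v2 \<noteq> v3" "v3 \<noteq> v4" "v4 \<noteq> v1" "v1 \<noteq> v3" "v2 \<noteq> v4" using sm(13) by auto
  have abv: "a \<noteq> v1" "a \<noteq> v2" "a \<noteq> v3" "a \<noteq> v4" "b \<noteq> v1" "b \<noteq> v2" "b \<noteq> v3" "b \<noteq> v4" using ab vG by auto
  have nbG: "\<not> adj G a z" "\<not> adj G z a" "\<not> adj G b z" "\<not> adj G z b" for z using adj_verts[of G] ab by blast+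
  have nba: "adj H a z \<longleftrightarrow> z \<in> {v1, v3, v2, b}" and nbb: "adj H b z \<longleftrightarrow> z \<in> {v1, v3, v4, a}" for z
    unfolding adjH A1 using nbG abv ab(3) by (auto simp: doubleton_eq_iff)
  have adjG: "adj G w z" if "adj H w z" "w \<noteq> a" "w \<noteq> b" "z \<noteq> a" "z \<noteq> b" for w z
    using that sm(7-10) unfolding adjH A1 by (auto simp: doubleton_eq_iff adj_sym[of G])
  have f0c: "colouring 4 G f0" "card (f0 ` {v1, v2, v3, v4}) = 2" using f0 by (simp_all add: F2_iff)
  have f0p: "proper G f0" using f0c(1) by (simp add: colouring_iff_proper)
  note q0 = quadrangle_colours[OF f0p sm(3) f0c(2)]
  \<comment> \<open>Opposite vertices of the quadrangle are equally coloured, which rules out both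
    chords; the degrees of \<open>v2\<close> and \<open>v4\<close> depend on this.\<close>
  have nadj: "\<not> adj G v1 v3" "\<not> adj G v2 v4" using f0p q0(1,2) unfolding proper_def by metis+
  obtain c where c: "c \<in> {1..4} - {f0 v1, f0 v2}" by (rule third_colour)
  obtain d where d: "distinct [f0 v1, f0 v2, c, d]" "{f0 v1, f0 v2, c, d} = {1..4}"
    using remaining_colours[OF q0(4,5,3) c] by blast
  \<comment> \<open>\<open>a\<close> and \<open>b\<close> are adjacent and receive the two colours
    absent from the quadrangle.\<close>
  define f where "f = (\<lambda>v. if v = a then c else if v = b then d else f0 v)"
  have fG: "f v = f0 v" if "v \<in> verts G" for v using that ab by (auto simp: f_def)
  have fab: "f a = c" "f b = d" "f v1 = f0 v1" "f v2 = f0 v2" "f v3 = f0 v1" "f v4 = f0 v2"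
    using ab fG vG q0(1,2) by (auto simp: f_def)
  have "proper H f"
    unfolding proper_def
  proof (intro conjI ballI allI impI)
    have "c \<in> {1..4}" "d \<in> {1..4}" using d(2) by blast+
    then show "f v \<in> {1..4}" if "v \<in> verts H" for v using that f0p fG fab(1,2) unfolding vH proper_def by auto
    show "f u \<noteq> f v" if "adj H u v" for u v
    proof (cases "adj G u v")
      case True
      then show ?thesis using f0p fG adj_verts[of G] unfolding proper_def by metis
    next
      case False
      then have "adj G1 u v" using that adjH by blast
      moreover have dl: "f u \<noteq> f v" if "{u, v} = {p, q}" "f p \<noteq> f q" for p q using that by (auto simp: doubleton_eq_iff)
      ultimately show ?thesis
        unfolding A1 insert_iff empty_iff by (elim disjE FalseE; elim dl) (use fab d(1) in auto)
    qed
  qed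
  moreover have "f \<in> extensional (verts H)"
    using f0c(1) unfolding colouring_iff_proper vH by (auto simp: extensional_def f_def)
  ultimately have fH: "colouring 4 H f" by (simp add: colouring_iff_proper)
  have rf: "restrict f (verts G) = f0"
    using f0c(1) fG unfolding colouring_iff_proper by (auto simp: fun_eq_iff extensional_def)
  \<comment> \<open>The opposite direction to \<open>pasted_lift\<close>, restricting instead of
    extending. By the induction hypothesis the quadrangle is bichromatic and free of the forbidden
    paths before each step.\<close>
  have inv: "restrict h (verts G) \<in> kempe_class G f0" if h: "h \<in> kempe_class H f" for h
  proof -
    have "(\<lambda>h h'. sigma_step H h h' \<or> renaming H h h')\<^sup>*\<^sup>* f h" using h by (simp add: kempe_class_def)
    then show ?thesis
    proof (induction rule: rtranclp_induct)
      case base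
      show ?case unfolding rf by (rule kempe_class_refl)
    next
      case (step y z)
      define g where "g = restrict y (verts G)"
      have g: "g \<in> kempe_class G f0" unfolding g_def by (rule step.IH)
      have "y \<in> kempe_class H f" using step(1) by (simp add: kempe_class_def)
      then have yH: "proper H y" using kempe_class_colouring[OF pD(5) fH] by (simp add: colouring_iff_proper)
      have gy: "g v = y v" if "v \<in> verts G" for v using that by (simp add: g_def)
      have sh: "g \<in> F2 G ?C" "\<And>i. i \<in> {1..4} - {g v1, g v2} \<Longrightarrow> kempe_paths G g (g v1) i v1 v3 = {}"
        using shared[OF g] unfolding shared_endpoint_24_iff by blast+
      then have gp: "proper G g" "card (g ` {v1, v2, v3, v4}) = 2" by (simp_all add: F2_iff colouring_iff_proper)
      note q = quadrangle_colours[OF gp(1) sm(3) gp(2)]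
      have qy: "y v3 = y v1" "y v4 = y v2" "y v1 \<noteq> y v2" using q(1-3) gy vG by simp_all
      \<comment> \<open>The quadrangle still has two colours, so the adjacent vertices
        \<open>a\<close> and \<open>b\<close> share out the other two.\<close>
      have ya: "y a \<in> {1..4} - {y v1, y v2}" "y b \<in> {1..4} - {y v1, y v2}" "y a \<noteq> y b"
      proof -
        have "adj H a v1" "adj H a v2" "adj H b v1" "adj H b v4" "adj H a b" by (simp_all add: nba nbb)
        then have "y a \<noteq> y v1" "y a \<noteq> y v2" "y b \<noteq> y v1" "y b \<noteq> y v4" and n: "y a \<noteq> y b"
          using yH unfolding proper_def by blast+
        moreover have "y a \<in> {1..4}" "y b \<in> {1..4}" using yH by (auto simp: proper_def vH)
        ultimately show "y a \<in> {1..4} - {y v1, y v2}" "y b \<in> {1..4} - {y v1, y v2}" using qy by auto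
        show "y a \<noteq> y b" by (rule n)
      qed
      from step(2) show ?case
      proof
        assume "sigma_step H y z"
        then obtain K s t where K: "bichromatic_cycle H y K" "s \<noteq> t" "{s, t} = {1..4} - y ` set K" "z = swap_inside H K s t y"
          unfolding sigma_step_def by blast
        have cycH: "is_cycle H K" and c2: "card (y ` set K) = 2" using K(1) by (auto simp: bichromatic_cycle_def)
        \<comment> \<open>\<open>R\<close> will be the rest of a bichromatic cycle through
          \<open>a\<close> or \<open>b\<close>; inside \<open>G\<close> it is a path forbidden by
          sharedness.\<close>
        have no: False if R: "R \<noteq> []" "distinct R" "successively (adj H) R" "hd R = v1" "last R = v3"
          "\<And>z. z \<in> set R \<Longrightarrow> y z \<in> {y v1, k}" and k: "k \<in> {1..4} - {y v1, y v2}" and nab: "a \<notin> set R" "b \<notin> set R" for R k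
        proof -
          have "successively (adj G) R"
            using R(3) by (rule successively_mono) (use adjG nab in metis)
          \<comment> \<open>The constant colouring is auxiliary again, to read off that the path
            stays in \<open>verts G\<close>.\<close>
          moreover from this have "set R \<subseteq> verts G"
            using kempe_paths_verts[of R G "\<lambda>_. 0" 0 0 v1 v3] R(1,2,4,5) kempe_paths_iff[OF sm(11), of R G "\<lambda>_. 0" 0 0] by auto
          moreover from this have "\<forall>x\<in>set R. g x \<in> {g v1, k}" using R(6) gy vG(1) by (metis subsetD)
          ultimately have "R \<in> kempe_paths G g (g v1) k v1 v3"
            unfolding kempe_paths_iff[OF sm(11)] using R(1,2,4,5) by blast
          then show False using sh(2)[of k] k gy vG by auto
        qed
        have aK: "a \<notin> set K"
        proof
          assume w: "a \<in> set K"
          obtain R where R: "R \<noteq> []" "set R = set K - {a}" "distinct R" "successively (adj H) R" "hd R = v1" "last R = v3"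
            "\<And>z. z \<in> set R \<Longrightarrow> y z \<in> {y v1, y a}"
            by (rule bichromatic_cycle_through_vertex[OF yH K(1) w, of v1 v3 v2 b]) (use nba qy ya in auto)
          \<comment> \<open>The colour of \<open>b\<close> differs from both colours of the
            cycle.\<close>
          have "b \<notin> set R" using R(7)[of b] ya by auto
          then show False using no[OF R(1,3-7) ya(1)] R(2) by blast
        qed
        have bK: "b \<notin> set K"
        proof
          assume w: "b \<in> set K"
          obtain R where R: "R \<noteq> []" "set R = set K - {b}" "distinct R" "successively (adj H) R" "hd R = v1" "last R = v3"
            "\<And>z. z \<in> set R \<Longrightarrow> y z \<in> {y v1, y b}"
            by (rule bichromatic_cycle_through_vertex[OF yH K(1) w, of v1 v3 v4 a]) (use nbb qy ya in auto)
          have "a \<notin> set R" using R(7)[of a] ya by auto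
          then show False using no[OF R(1,3-7) ya(2)] R(2) by blast
        qed
        have cycG: "is_cycle G K"
        proof -
          have "successively (adj H) (K @ [hd K])" and l: "3 \<le> length K" "distinct K" using cycH by (auto simp: is_cycle_iff)
          moreover have "set (K @ [hd K]) = set K" using l by (cases K) auto
          ultimately have "successively (adj G) (K @ [hd K])"
            using aK bK by (elim successively_mono) (metis adjG)
          then show ?thesis using l by (simp add: is_cycle_iff)
        qed
        note cH = subdrawing_cycle[OF pD(6) cycG]
        have "set K \<subseteq> verts G" using cycG by (simp add: is_cycle_def)
        then have gK: "g ` set K = y ` set K" using gy by (intro image_cong) auto
        have "sigma_step G g (swap_inside G K s t g)"
          unfolding sigma_step_def bichromatic_cycle_def
          using cycG c2 K(2,3) gK by (intro exI[of _ K] exI[of _ s] exI[of _ t]) simp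
        moreover have "restrict z (verts G) = swap_inside G K s t g"
          unfolding K(4) g_def swap_inside_def cH(2) vH by (auto simp: fun_eq_iff)
        ultimately show ?thesis using kempe_class_step[OF g] by metis
      next
        assume "renaming H y z"
        then obtain \<rho> where r: "\<rho> permutes {1..4}" "z = restrict (\<rho> \<circ> y) (verts H)" unfolding renaming_def by blast
        have "restrict z (verts G) = restrict (\<rho> \<circ> g) (verts G)"
          unfolding r(2) g_def vH by (auto simp: fun_eq_iff)
        then have "renaming G g (restrict z (verts G))" unfolding renaming_def using r(1) by blast
        then show ?thesis using kempe_class_step[OF g] by blast
      qed
    qed
  qed
  have card2: "card (h ` {v1, v2, v3, v4}) = 2" if h: "h \<in> kempe_class H f" for h
  proof -
    have "restrict h (verts G) \<in> F2 G ?C" using shared[OF inv[OF h]] by (simp add: shared_endpoint_24_def)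
    then have "card (restrict h (verts G) ` {v1, v2, v3, v4}) = 2" by (simp add: F2_iff)
    moreover have "restrict h (verts G) ` {v1, v2, v3, v4} = h ` {v1, v2, v3, v4}"
      using vG by (intro image_cong) auto
    ultimately show ?thesis by simp
  qed
  have cycHC: "is_cycle H ?C" by (rule subdrawing_cycle(1)[OF pD(6) sm(3)])
  have UB: "UB_cycle H f ?C"
    unfolding UB_cycle_def bichromatic_cycle_def using fH cycHC card2 kempe_class_refl by simp
  have H4: "4 \<le> degree H v" if v: "v \<in> verts H" for v
  proof -
    have adjs: "adj H v1 v2" "adj H v1 v4" "adj H v1 a" "adj H v1 b" "adj H v2 v1" "adj H v2 v3" "adj H v2 a"
      "adj H v3 v2" "adj H v3 v4" "adj H v3 a" "adj H v3 b" "adj H v4 v3" "adj H v4 v1" "adj H v4 b"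
      "adj H a v1" "adj H a v2" "adj H a v3" "adj H a b" "adj H b v1" "adj H b v3" "adj H b v4" "adj H b a"
      unfolding adjH A1 by (auto simp: insert_commute)
    \<comment> \<open>The cap gives \<open>v2\<close> a single neighbour; besides the two on the
      quadrangle, a fourth must come from inside \<open>G\<close>.\<close>
    obtain x where x: "adj G v2 x" "x \<notin> {v1, v2, v3, v4}" by (rule common_interior_neighbour[OF GO nadj])
    \<comment> \<open>Two rotations carry the edge from \<open>v1\<close> to \<open>v2\<close> into
      the one from \<open>v3\<close> to \<open>v4\<close>, so the same lemma yields a neighbour of
      \<open>v4\<close>.\<close>
    note rot = smpg_at_rotate(1)[OF smpg_at_rotate(1)[OF GO]]
    have nadj': "\<not> adj G v3 v1" "\<not> adj G v4 v2" using nadj adj_sym by blast+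
    obtain x' where x': "adj G v4 x'" "x' \<notin> {v1, v2, v3, v4}"
      by (rule common_interior_neighbour[OF rot nadj']) (use that in auto)
    have xx: "adj H v2 x" "adj H v4 x'" "x \<noteq> a" "x' \<noteq> b" using x x' adjH nbG by blast+
    consider "v = v1" | "v = v2" | "v = v3" | "v = v4" | "v = a" | "v = b" | "v \<in> verts G - {v1, v2, v3, v4}"
      using v unfolding vH by blast
    then show ?thesis
    proof cases
      case 1 then show ?thesis using degree_ge_4[OF pD(5), of v2 v4 a b v1] adjs dist abv ab by auto
    next
      case 2 then show ?thesis using degree_ge_4[OF pD(5), of v1 v3 a x v2] adjs dist abv xx x by auto
    next
      case 3 then show ?thesis using degree_ge_4[OF pD(5), of v2 v4 a b v3] adjs dist abv ab by auto
    next
      case 4 then show ?thesis using degree_ge_4[OF pD(5), of v3 v1 b x' v4] adjs dist abv xx x' by auto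
    next
      case 5 then show ?thesis using degree_ge_4[OF pD(5), of v1 v2 v3 b a] adjs dist abv by auto
    next
      case 6 then show ?thesis using degree_ge_4[OF pD(5), of v1 v3 v4 a b] adjs dist abv by auto
    next
      case 7
      have "finite (verts H)" using pD(5) by (simp add: plane_graph_def)
      then have "finite {u. adj H v u}" using finite_subset[of "{u. adj H v u}" "verts H"] adj_verts[of H] by blast
      then have "degree G v \<le> degree H v"
        unfolding degree_def by (rule card_mono) (use adjH in blast)
      then show ?thesis using deg 7 by (meson le_trans)
    qed
  qed
  have md: "4 \<le> min_degree H"
  proof -
    have "finite (verts H)" "verts H \<noteq> {}" using pD(5) vH by (auto simp: plane_graph_def)
    then show ?thesis unfolding min_degree_def using H4 by (subst Min_ge_iff) auto
  qed
  have "UBCMPG H ?C"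
    unfolding UBCMPG_def using mx chromatic_number_supergraph[OF pD(6) chi fH] md UB by blast
  moreover have "exterior_smpg G1 ?C" using G1 by (simp add: exterior_smpg_def)
  ultimately show ?thesis
    unfolding base_module4_def using G V eI by (auto simp: H_def)
qed

lemma base_module4_rotate:
  assumes "base_module4 G [v1, v2, v3, v4]"
  shows "base_module4 G [v2, v3, v4, v1]"
proof -
  let ?C = "[v1, v2, v3, v4]" and ?D = "[v2, v3, v4, v1]"
  obtain G1 where G1: "smpg G ?C" "exterior_smpg G1 ?C" "verts G \<inter> verts G1 = set ?C"
    "edges G \<inter> edges G1 = cycle_edges G ?C" "UBCMPG (graph_union G G1) ?C"
    using assms unfolding base_module4_def by blast
  obtain F where F: "\<not> bounded F" "smpg_at F G ?C" using G1(1) unfolding smpg_def by blast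
  note r = smpg_at_rotate[OF F(2)] and r1 = smpg_at_rotate[OF G1(2)[unfolded exterior_smpg_def]]
  have s: "smpg G ?D" "exterior_smpg G1 ?D" using F(1) r r1 unfolding smpg_def exterior_smpg_def by auto
  have "UBCMPG (graph_union G G1) ?D"
    using G1(5) unfolding UBCMPG_def UB_cycle_def bichromatic_cycle_def is_cycle4 by (auto simp: insert_commute)
  then show ?thesis
    unfolding base_module4_def using s G1(3,4) r(3) by (intro conjI exI[of _ G1]) auto
qed

theorem theorem3:
  fixes G :: drawing and v1 v2 v3 v4 :: complex
  assumes "smpg G [v1, v2, v3, v4]"
    and "chromatic_number G = 4"
    and "F2 G [v1, v2, v3, v4] \<noteq> {}"
    and interior_degree: "\<forall>v \<in> verts G - {v1, v2, v3, v4}. 4 \<le> degree G v"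
  shows "base_module4 G [v1, v2, v3, v4] \<longleftrightarrow>
    (\<exists>f0 \<in> F2 G [v1, v2, v3, v4].
       (\<forall>f \<in> kempe_class G f0. shared_endpoint_24 G [v1, v2, v3, v4] f) \<or>
       (\<forall>f \<in> kempe_class G f0. shared_endpoint_13 G [v1, v2, v3, v4] f))"
proof
  assume "base_module4 G [v1, v2, v3, v4]"
  then show "\<exists>f0 \<in> F2 G [v1, v2, v3, v4].
       (\<forall>f \<in> kempe_class G f0. shared_endpoint_24 G [v1, v2, v3, v4] f) \<or>
       (\<forall>f \<in> kempe_class G f0. shared_endpoint_13 G [v1, v2, v3, v4] f)"
    by (rule base_module4_imp_shared_endpoint)
next
  assume "\<exists>f0 \<in> F2 G [v1, v2, v3, v4].
       (\<forall>f \<in> kempe_class G f0. shared_endpoint_24 G [v1, v2, v3, v4] f) \<or>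
       (\<forall>f \<in> kempe_class G f0. shared_endpoint_13 G [v1, v2, v3, v4] f)"
  then obtain f0 where f0: "f0 \<in> F2 G [v1, v2, v3, v4]" and
    "(\<forall>f \<in> kempe_class G f0. shared_endpoint_24 G [v1, v2, v3, v4] f) \<or>
       (\<forall>f \<in> kempe_class G f0. shared_endpoint_13 G [v1, v2, v3, v4] f)" by blast
  then consider "\<forall>f \<in> kempe_class G f0. shared_endpoint_24 G [v1, v2, v3, v4] f"
    | "\<forall>f \<in> kempe_class G f0. shared_endpoint_13 G [v1, v2, v3, v4] f" by blast
  then show "base_module4 G [v1, v2, v3, v4]"
  proof cases
    case 1
    then show ?thesis using base_module4I_shared_endpoint_24[OF assms(1,2,4) f0] by blast
  next
    case 2
    have GO: "smpg_at (outside (cycle_curve G [v1, v2, v3, v4])) G [v1, v2, v3, v4]" using assms(1) by (simp add: smpg_iff)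
    note sm = smpg_atD[OF GO] and rot = smpg_at_rotate[OF GO]
    have F2r: "F2 G [v2, v3, v4, v1] = F2 G [v1, v2, v3, v4]" by (simp add: F2_def insert_commute)
    have sr: "smpg G [v2, v3, v4, v1]" unfolding smpg_iff rot(2) by (rule rot(1))
    \<comment> \<open>By the dichotomy the two paths between \<open>v1\<close> and \<open>v3\<close>
      exclude both paths between \<open>v2\<close> and \<open>v4\<close>, which is the other type of
      sharedness for the rotated quadrangle.\<close>
    have "shared_endpoint_24 G [v2, v3, v4, v1] f" if f: "f \<in> kempe_class G f0" for f
    proof -
      have sh: "f \<in> F2 G [v1, v2, v3, v4]" "\<And>i. i \<in> {1..4} - {f v1, f v2} \<Longrightarrow> kempe_paths G f (f v1) i v1 v3 \<noteq> {}"
        using 2 f unfolding shared_endpoint_13_iff by blast+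
      have fp: "proper G f" "card (f ` {v1, v2, v3, v4}) = 2" using sh(1) by (simp_all add: F2_iff colouring_iff_proper)
      note q = quadrangle_colours[OF fp(1) sm(3) fp(2)]
      have "kempe_paths G f (f v2) i v2 v4 = {}" if i: "i \<in> {1..4} - {f v2, f v3}" for i
      proof -
        have i': "i \<in> {1..4} - {f v1, f v2}" using i q(1) by auto
        obtain j where j: "distinct [f v1, f v2, i, j]" "{f v1, f v2, i, j} = {1..4}"
          using remaining_colours[OF q(4,5,3) i'] by blast
        then have j': "distinct [f v1, f v2, j, i]" "{f v1, f v2, j, i} = {1..4}" "j \<in> {1..4} - {f v1, f v2}"
          by (auto simp: insert_commute)
        show ?thesis using kempe_paths_dichotomy[OF GO fp(1) q(1,2) j'(1,2)] sh(2)[OF j'(3)] by blast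
      qed
      then show ?thesis unfolding shared_endpoint_24_iff F2r using sh(1) by blast
    qed
    moreover have "\<forall>v \<in> verts G - {v2, v3, v4, v1}. 4 \<le> degree G v" using interior_degree by (simp add: insert_commute)
    ultimately have "base_module4 G [v2, v3, v4, v1]"
      using base_module4I_shared_endpoint_24[OF sr assms(2)] f0 F2r by blast
    \<comment> \<open>Three more rotations lead back to the original order.\<close>
    then show ?thesis using base_module4_rotate by blast
  qed
qed

end
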